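(* Let $M$ be a 3-dimensional complex manifold and $S \subset M$ a closed subset of complex codimension 2 or more. Then every holomorphic path geometry on $M \setminus S$ extends to a holomorphic path geometry on $M$.
   Context: A subset $S$ of a complex manifold $M$ is of complex codimension 2 or more if every $s \in S$ has an open neighbourhood $U_s \subset M$ such that $S \cap U_s$ is contained in a complex analytic subvariety of $U_s$ of complex codimension at least 2. A holomorphic contact structure on a complex 3-fold $N$ is a holomorphic rank 2 subbundle of $TN$ which is locally the kernel of a holomorphic 1-form $\alpha$ with $\alpha\wedge d\alpha\ne0$ everywhere. A holomorphic path geometry on $N$ is a holomorphic contact structure together with a pair of nowhere tangent holomorphic Legendre foliations by curves, i.e. a pair of holomorphic foliations whose leaves are complex curves tangent to the contact planes, and whose tangent lines are distinct at every point. (The path geometry arising from a second order equation $d^2w/dz^2=f(z,w,dw/dz)$ lives on a space with coordinates $z,w,p$, has contact structure $dw-p\,dz=0$, and has Legendre foliations $dw-p\,dz=dp-f\,dz=0$ and $dw=dz=0$.) A path geometry on $M \setminus S$ extends to $M$ if there is a path geometry on $M$ restricting to it on $M\setminus S$. *)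

theory Defs
  imports "HOL-Analysis.Analysis" "HOL-Library.Function_Algebras"
begin

section \<open>Holomorphic maps between open subsets of complex coordinate spaces\<close>

definition cholomorphic_on :: "(complex^'n \<Rightarrow> complex) \<Rightarrow> (complex^'n) set \<Rightarrow> bool" where
  "cholomorphic_on f U \<longleftrightarrow>
     (\<forall>z\<in>U. \<exists>f'. (f has_derivative f') (at z) \<and> (\<forall>a v. f' (a *s v) = a * f' v))"

definition cholomorphic_map_on :: "(complex^'n \<Rightarrow> complex^'m) \<Rightarrow> (complex^'n) set \<Rightarrow> bool" where
  "cholomorphic_map_on f U \<longleftrightarrow> (\<forall>i. cholomorphic_on (\<lambda>z. f z $ i) U)"


section \<open>Complex manifolds\<close>

text \<open>A chart is a pair of its domain and its coordinate map. The values of the coordinate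
  map outside the domain are irrelevant.\<close>

type_synonym ('a, 'n) chart = "'a set \<times> ('a \<Rightarrow> complex^'n)"

definition is_chart :: "'a topology \<Rightarrow> ('a, 'n::finite) chart \<Rightarrow> bool" where
  "is_chart M c \<longleftrightarrow>
     openin M (fst c) \<and> open (snd c ` fst c) \<and>
     homeomorphic_map (subtopology M (fst c)) (top_of_set (snd c ` fst c)) (snd c)"

definition chart_inv :: "('a, 'n) chart \<Rightarrow> complex^'n \<Rightarrow> 'a" where
  "chart_inv c = inv_into (fst c) (snd c)"

definition transition :: "('a, 'n) chart \<Rightarrow> ('a, 'n) chart \<Rightarrow> complex^'n \<Rightarrow> complex^'n" where
  "transition c d = snd d \<circ> chart_inv c"

definition compatible :: "('a, 'n::finite) chart \<Rightarrow> ('a, 'n) chart \<Rightarrow> bool" where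
  "compatible c d \<longleftrightarrow>
     cholomorphic_map_on (transition c d) (snd c ` (fst c \<inter> fst d)) \<and>
     cholomorphic_map_on (transition d c) (snd d ` (fst c \<inter> fst d))"

text \<open>The atlas \<open>A\<close> is required to be maximal. Hence every holomorphic local coordinate system
  on \<open>M\<close> belongs to \<open>A\<close>, and an open subset \<open>N\<close> of \<open>M\<close>, with the charts in \<open>A\<close> whose domain
  lies in \<open>N\<close>, is a complex manifold with the same tangent spaces.\<close>

definition complex_manifold :: "'a topology \<Rightarrow> ('a, 'n::finite) chart set \<Rightarrow> bool" where
  "complex_manifold M A \<longleftrightarrow>
     Hausdorff_space M \<and>
     (\<forall>c\<in>A. is_chart M c) \<and>
     topspace M = \<Union> (fst ` A) \<and>
     (\<forall>c\<in>A. \<forall>d\<in>A. compatible c d) \<and>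
     (\<forall>c. is_chart M c \<and> (\<forall>d\<in>A. compatible c d) \<longrightarrow> c \<in> A)"

definition holomorphic_function ::
    "('a, 'n::finite) chart set \<Rightarrow> 'a set \<Rightarrow> ('a \<Rightarrow> complex) \<Rightarrow> bool" where
  "holomorphic_function A U f \<longleftrightarrow>
     (\<forall>c\<in>A. cholomorphic_on (\<lambda>z. f (chart_inv c z)) (snd c ` (U \<inter> fst c)))"


section \<open>Analytic subvarieties and codimension\<close>

definition analytic_subvariety ::
    "'a topology \<Rightarrow> ('a, 'n::finite) chart set \<Rightarrow> 'a set \<Rightarrow> 'a set \<Rightarrow> bool" where
  "analytic_subvariety M A U Z \<longleftrightarrow>
     Z \<subseteq> U \<and>
     (\<forall>p\<in>U. \<exists>W Fs. openin M W \<and> p \<in> W \<and> W \<subseteq> U \<and>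
        finite Fs \<and> (\<forall>f\<in>Fs. holomorphic_function A W f) \<and>
        Z \<inter> W = {q \<in> W. \<forall>f\<in>Fs. f q = 0})"

text \<open>\<open>p\<close> is a regular point of \<open>Z\<close> if near \<open>p\<close> the set \<open>Z\<close> is a complex submanifold, i.e.
  a coordinate slice in some chart; \<open>k\<close> is the number of coordinates that vanish on it.\<close>

definition regular_point_codim ::
    "('a, 'n::finite) chart set \<Rightarrow> 'a set \<Rightarrow> nat \<Rightarrow> 'a \<Rightarrow> bool" where
  "regular_point_codim A Z k p \<longleftrightarrow>
     p \<in> Z \<and>
     (\<exists>c\<in>A. \<exists>I. p \<in> fst c \<and> card I = k \<and>
        Z \<inter> fst c = {q \<in> fst c. \<forall>i\<in>I. snd c q $ i = 0})"

text \<open>The dimension of an analytic set is the largest dimension of the manifold of its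
  regular points (which is dense in it).\<close>

definition subvariety_codim_ge ::
    "('a, 'n::finite) chart set \<Rightarrow> 'a set \<Rightarrow> nat \<Rightarrow> bool" where
  "subvariety_codim_ge A Z r \<longleftrightarrow> (\<forall>k p. regular_point_codim A Z k p \<longrightarrow> r \<le> k)"

definition complex_codim_ge ::
    "'a topology \<Rightarrow> ('a, 'n::finite) chart set \<Rightarrow> 'a set \<Rightarrow> nat \<Rightarrow> bool" where
  "complex_codim_ge M A S r \<longleftrightarrow>
     S \<subseteq> topspace M \<and>
     (\<forall>s\<in>S. \<exists>U Z. openin M U \<and> s \<in> U \<and> S \<inter> U \<subseteq> Z \<and>
        analytic_subvariety M A U Z \<and> subvariety_codim_ge A Z r)"


section \<open>Tangent vectors, subbundles of the tangent bundle and 1-forms\<close>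

text \<open>A tangent vector at \<open>p\<close> is the family of its components \<open>v c\<close> in the charts \<open>c\<close> around
  \<open>p\<close>, which transform by the derivatives of the coordinate changes. For the remaining \<open>c\<close> we
  put \<open>v c = 0\<close>, so that each tangent vector is represented exactly once.\<close>

type_synonym ('a, 'n) tangent_vector = "('a, 'n) chart \<Rightarrow> complex^'n"

definition tangent_space ::
    "('a, 'n::finite) chart set \<Rightarrow> 'a \<Rightarrow> ('a, 'n) tangent_vector set" where
  "tangent_space A p =
     {v. (\<forall>c\<in>A. \<forall>d\<in>A. p \<in> fst c \<inter> fst d \<longrightarrow>
            v d = frechet_derivative (transition c d) (at (snd c p)) (v c)) \<and>
         (\<forall>c. \<not> (c \<in> A \<and> p \<in> fst c) \<longrightarrow> v c = 0)}"

definition tangent_scale ::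
    "complex \<Rightarrow> ('a, 'n::finite) tangent_vector \<Rightarrow> ('a, 'n) tangent_vector" where
  "tangent_scale a v = (\<lambda>c. a *s v c)"

interpretation tangent: vector_space
  "tangent_scale :: complex \<Rightarrow> ('a, 'n::finite) tangent_vector \<Rightarrow> ('a, 'n) tangent_vector"
  by unfold_locales
    (auto simp: tangent_scale_def fun_eq_iff vec_eq_iff algebra_simps)

definition holomorphic_vector_field ::
    "('a, 'n::finite) chart set \<Rightarrow> 'a set \<Rightarrow> ('a \<Rightarrow> ('a, 'n) tangent_vector) \<Rightarrow> bool" where
  "holomorphic_vector_field A U X \<longleftrightarrow>
     (\<forall>q\<in>U. X q \<in> tangent_space A q) \<and>
     (\<forall>c\<in>A. cholomorphic_map_on (\<lambda>z. X (chart_inv c z) c) (snd c ` (U \<inter> fst c)))"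

text \<open>In this and the following definitions, objects on an open subset \<open>N\<close> of \<open>M\<close> are given by
  total functions on the type of points, whose values outside \<open>N\<close> are irrelevant.\<close>

definition holomorphic_subbundle ::
    "'a topology \<Rightarrow> ('a, 'n::finite) chart set \<Rightarrow> 'a set \<Rightarrow> nat \<Rightarrow>
     ('a \<Rightarrow> ('a, 'n) tangent_vector set) \<Rightarrow> bool" where
  "holomorphic_subbundle M A N k E \<longleftrightarrow>
     (\<forall>p\<in>N. \<exists>U X. openin M U \<and> p \<in> U \<and> U \<subseteq> N \<and>
        (\<forall>i<k. holomorphic_vector_field A U (X i)) \<and>
        (\<forall>q\<in>U. E q = tangent.span ((\<lambda>i. X i q) ` {..<k}) \<and> tangent.dim (E q) = k))"

text \<open>The 1-form with coefficient functions \<open>a\<close> on an open subset of a coordinate space, i.e.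
  the sum of the \<open>a z $ i\<close> times \<open>dz\<^sub>i\<close>, and its exterior derivative.\<close>

definition coord_form :: "(complex^'n \<Rightarrow> complex^'n) \<Rightarrow> complex^'n \<Rightarrow> complex^'n \<Rightarrow> complex" where
  "coord_form a z v = (\<Sum>i\<in>UNIV. a z $ i * v $ i)"

definition ext_deriv ::
    "(complex^'n::finite \<Rightarrow> complex^'n \<Rightarrow> complex) \<Rightarrow>
     complex^'n \<Rightarrow> complex^'n \<Rightarrow> complex^'n \<Rightarrow> complex" where
  "ext_deriv \<omega> z v w =
     frechet_derivative (\<lambda>y. \<omega> y w) (at z) v - frechet_derivative (\<lambda>y. \<omega> y v) (at z) w"

definition wedge12 ::
    "('v \<Rightarrow> complex) \<Rightarrow> ('v \<Rightarrow> 'v \<Rightarrow> complex) \<Rightarrow> 'v \<Rightarrow> 'v \<Rightarrow> 'v \<Rightarrow> complex" where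
  "wedge12 \<alpha> \<beta> u v w = \<alpha> u * \<beta> v w - \<alpha> v * \<beta> u w + \<alpha> w * \<beta> u v"

definition form_in_chart ::
    "('a, 'n::finite) chart set \<Rightarrow> 'a set \<Rightarrow> ('a \<Rightarrow> ('a, 'n) tangent_vector \<Rightarrow> complex) \<Rightarrow>
     ('a, 'n) chart \<Rightarrow> (complex^'n \<Rightarrow> complex^'n) \<Rightarrow> bool" where
  "form_in_chart A U \<alpha> c a \<longleftrightarrow>
     cholomorphic_map_on a (snd c ` (U \<inter> fst c)) \<and>
     (\<forall>q\<in>U \<inter> fst c. \<forall>v\<in>tangent_space A q. \<alpha> q v = coord_form a (snd c q) (v c))"

definition holomorphic_one_form ::
    "('a, 'n::finite) chart set \<Rightarrow> 'a set \<Rightarrow> ('a \<Rightarrow> ('a, 'n) tangent_vector \<Rightarrow> complex) \<Rightarrow> bool"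
  where
  "holomorphic_one_form A U \<alpha> \<longleftrightarrow> (\<forall>c\<in>A. \<exists>a. form_in_chart A U \<alpha> c a)"


section \<open>Path geometries\<close>

text \<open>The last conjunct says that \<open>\<alpha> \<and> d\<alpha>\<close> vanishes at no point of \<open>U\<close>.\<close>

definition contact_form ::
    "('a, 3) chart set \<Rightarrow> 'a set \<Rightarrow> ('a \<Rightarrow> ('a, 3) tangent_vector \<Rightarrow> complex) \<Rightarrow> bool" where
  "contact_form A U \<alpha> \<longleftrightarrow>
     holomorphic_one_form A U \<alpha> \<and>
     (\<forall>c\<in>A. \<forall>a. form_in_chart A U \<alpha> c a \<longrightarrow>
        (\<forall>z\<in>snd c ` (U \<inter> fst c).
           \<exists>u v w. wedge12 (coord_form a z) (ext_deriv (coord_form a) z) u v w \<noteq> 0))"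

definition contact_structure ::
    "'a topology \<Rightarrow> ('a, 3) chart set \<Rightarrow> 'a set \<Rightarrow> ('a \<Rightarrow> ('a, 3) tangent_vector set) \<Rightarrow> bool"
  where
  "contact_structure M A N E \<longleftrightarrow>
     holomorphic_subbundle M A N 2 E \<and>
     (\<forall>p\<in>N. \<exists>U \<alpha>. openin M U \<and> p \<in> U \<and> U \<subseteq> N \<and> contact_form A U \<alpha> \<and>
        (\<forall>q\<in>U. E q = {v \<in> tangent_space A q. \<alpha> q v = 0}))"

text \<open>A foliation by curves is given by foliated charts, in which the leaves are locally the
  curves (plaques) along which the second and third coordinate are constant; that the plaques of
  different foliated charts fit together is expressed by their having the same tangent lines.
  So a foliation is recorded here by the field \<open>F\<close> of tangent lines of its leaves.\<close>

definition holomorphic_foliation_by_curves ::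
    "('a, 3) chart set \<Rightarrow> 'a set \<Rightarrow> ('a \<Rightarrow> ('a, 3) tangent_vector set) \<Rightarrow> bool" where
  "holomorphic_foliation_by_curves A N F \<longleftrightarrow>
     (\<forall>p\<in>N. \<exists>c\<in>A. p \<in> fst c \<and> fst c \<subseteq> N \<and>
        (\<forall>q\<in>fst c. F q = {v \<in> tangent_space A q. v c $ 2 = 0 \<and> v c $ 3 = 0}))"

definition path_geometry ::
    "'a topology \<Rightarrow> ('a, 3) chart set \<Rightarrow> 'a set \<Rightarrow>
     ('a \<Rightarrow> ('a, 3) tangent_vector set) \<Rightarrow>
     ('a \<Rightarrow> ('a, 3) tangent_vector set) \<Rightarrow> ('a \<Rightarrow> ('a, 3) tangent_vector set) \<Rightarrow> bool" where
  "path_geometry M A N E F\<^sub>1 F\<^sub>2 \<longleftrightarrow>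
     contact_structure M A N E \<and>
     holomorphic_foliation_by_curves A N F\<^sub>1 \<and>
     holomorphic_foliation_by_curves A N F\<^sub>2 \<and>
     (\<forall>q\<in>N. F\<^sub>1 q \<subseteq> E q \<and> F\<^sub>2 q \<subseteq> E q \<and> F\<^sub>1 q \<noteq> F\<^sub>2 q)"

end

theory Submission
  imports Defs "HOL-Complex_Analysis.Conformal_Mappings"
begin

text \<open>
  Off \<open>S\<close>, a path geometry is described by two tensors without scaling ambiguity. The coefficients of
  these extend over \<open>S\<close> as holomorphic functions, and algebraic identities prevent the extensions
  from degenerating.

  If \<open>\<alpha>\<close> is a local contact form with \<open>\<alpha> \<and> d\<alpha> = h dz\<^sub>1 \<and> dz\<^sub>2 \<and> dz\<^sub>3\<close>, then \<open>\<alpha> \<otimes> \<alpha> / h\<close> does not depend on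
  the choice of \<open>\<alpha>\<close>. Its extension \<open>Q\<close> is symmetric of rank at most one, and its entries are
  \<open>Q\<^sub>l\<^sub>m = Q\<^sub>l \<bullet> curl Q\<^sub>m\<close>. At a zero of \<open>Q\<close> the derivatives of \<open>Q\<close> would form a linear family of symmetric
  matrices of rank one; by the identity they would vanish, and then \<open>\<bar>Q\<bar> \<le> \<epsilon> \<bar>Q\<bar>\<close> nearby, which is absurd.
  So \<open>Q\<close> has no zeros and its nonzero rows are contact forms. If \<open>X\<close> and \<open>Y\<close> span the two lines,
  then \<open>X \<otimes> Y / d\<alpha>(X, Y)\<close> only depends on \<open>\<alpha>\<close>. It extends to a tensor of rank one whose contraction
  with \<open>d\<alpha>\<close> is 1, and whose columns and rows span the extended lines. These are rectified by a
  holomorphic flow, which is obtained by Picard iteration.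

  For the extension of a holomorphic function \<open>f\<close> let \<open>T\<close> be the set of points of the analytic set \<open>Z\<close>
  over which \<open>f\<close> does not extend, and let \<open>q \<in> T\<close> be a point where the vanishing order \<open>m\<close> of an
  equation of \<open>Z\<close> along a fixed direction is minimal. The derivative of order \<open>m - 1\<close> of this equation
  vanishes on \<open>T\<close> and defines a smooth hypersurface near \<open>q\<close>. If \<open>T\<close> is not all of this hypersurface,
  a Cauchy integral across it extends \<open>f\<close>. Otherwise \<open>Z\<close> coincides with it near \<open>q\<close> by Taylor's
  formula, so that \<open>Z\<close> has a regular point of codimension one.
\<close>

section \<open>Holomorphic functions of several variables\<close>

text \<open>Local generators off \<open>S\<close> (a contact form, vector fields along the lines)
  are determined only up to nonvanishing factors, so they need not fit together on the complement of
  \<open>S\<close> near one of its points, and no single function is at hand to extend. Tensors free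
  of these factors extend entry by entry. Replacing \<alpha> by g\<alpha> multiplies the density by
  g^2, because the cross product of grad g with the coefficient vector is orthogonal to that vector;
  this weight dictates the denominator of the contact tensor. The same orthogonality, applied to a
  column of \<open>Q\<close>, which is a function times the coefficient vector of \<alpha>, is the
  origin of the curl identity. Algebraic and differential identities persist over \<open>S\<close>
  by density, but inequalities do not: the real work is to find identities that force nonvanishing.
  Of the analytic set only two properties enter: it has no interior, and it is nowhere a smooth
  hypersurface.\<close>

lemma norm_vector_smult: "norm (t *s v) = norm t * norm v" for v :: "complex^'n"
  by (simp add: norm_vec_def norm_mult L2_set_right_distrib)

lemma norm_axis_complex: "norm (axis i (1::complex)) = 1"
  by (simp add: norm_eq_sqrt_inner inner_axis_axis)

lemma continuous_on_vector_smult [continuous_intros]: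
  fixes f :: "'a::topological_space \<Rightarrow> complex" and g :: "'a \<Rightarrow> complex^'n"
  assumes "continuous_on S f" "continuous_on S g"
  shows "continuous_on S (\<lambda>x. f x *s g x)"
  unfolding vector_scalar_mult_def by (intro continuous_intros assms)

lemma has_derivative_vec_lambda:
  fixes f :: "'a::real_normed_vector \<Rightarrow> complex^'n"
  assumes "\<And>i. ((\<lambda>x. f x $ i) has_derivative (\<lambda>v. f' v $ i)) (at z)"
  shows "(f has_derivative f') (at z)"
  by (subst has_derivative_componentwise_within)
    (auto simp: Basis_vec_def inner_axis intro!: has_derivative_inner_left[OF assms])

lemma has_derivative_line:
  "((\<lambda>t. z + t *s v) has_derivative (\<lambda>h. h *s v)) (at t)" for v :: "complex^'n"
  by (rule has_derivative_vec_lambda) (auto intro!: derivative_eq_intros)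

lemma isCont_line: "isCont (\<lambda>t. z + t *s v) s" for v :: "complex^'n"
  using has_derivative_line by (rule has_derivative_continuous)

lemma cholomorphic_onD:
  assumes "cholomorphic_on f U" "z \<in> U"
  shows cholomorphic_on_has_derivative: "(f has_derivative frechet_derivative f (at z)) (at z)"
    and cholomorphic_on_derivative_smult:
      "frechet_derivative f (at z) (a *s v) = a * frechet_derivative f (at z) v"
  using assms unfolding cholomorphic_on_def by (metis frechet_derivative_at)+

lemma cholomorphic_onI:
  assumes "\<And>z. z \<in> U \<Longrightarrow> (f has_derivative f' z) (at z)" "\<And>z a v. z \<in> U \<Longrightarrow> f' z (a *s v) = a * f' z v"
  shows "cholomorphic_on f U"
  using assms unfolding cholomorphic_on_def by blast

lemma cholomorphic_on_subset: "cholomorphic_on f U \<Longrightarrow> V \<subseteq> U \<Longrightarrow> cholomorphic_on f V"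
  unfolding cholomorphic_on_def by blast

lemma cholomorphic_map_on_subset:
  "cholomorphic_map_on f U \<Longrightarrow> V \<subseteq> U \<Longrightarrow> cholomorphic_map_on f V"
  unfolding cholomorphic_map_on_def using cholomorphic_on_subset by blast

lemma cholomorphic_on_cong:
  assumes "open U" "cholomorphic_on f U" "\<And>z. z \<in> U \<Longrightarrow> f z = g z"
  shows "cholomorphic_on g U"
  using assms unfolding cholomorphic_on_def by (meson has_derivative_transform_within_open)

lemma cholomorphic_map_on_cong:
  assumes "open U" "cholomorphic_map_on f U" "\<And>z. z \<in> U \<Longrightarrow> f z = g z"
  shows "cholomorphic_map_on g U"
  using assms cholomorphic_on_cong[of U "\<lambda>z. f z $ i" "\<lambda>z. g z $ i" for i]
  unfolding cholomorphic_map_on_def by simp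

lemma cholomorphic_on_local:
  assumes "\<And>z. z \<in> U \<Longrightarrow> \<exists>V. z \<in> V \<and> cholomorphic_on f V"
  shows "cholomorphic_on f U"
  using assms unfolding cholomorphic_on_def by blast

lemma cholomorphic_on_imp_continuous_on: "cholomorphic_on f U \<Longrightarrow> continuous_on U f"
  unfolding cholomorphic_on_def
  by (meson continuous_at_imp_continuous_on has_derivative_continuous)

lemma cholomorphic_map_on_imp_continuous_on:
  assumes "cholomorphic_map_on f U"
  shows "continuous_on U f"
proof -
  have "continuous_on U (\<lambda>z. \<chi> i. f z $ i)"
    using assms unfolding cholomorphic_map_on_def
    by (intro continuous_on_vec_lambda cholomorphic_on_imp_continuous_on) auto
  then show ?thesis by simp
qed

section \<open>Closure properties of holomorphic functions and maps\<close>

named_theorems cholomorphic_intros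

lemma cholomorphic_on_const [cholomorphic_intros]: "cholomorphic_on (\<lambda>z. c) U"
  by (rule cholomorphic_onI) (auto intro!: derivative_eq_intros)

lemma cholomorphic_on_nth [cholomorphic_intros]: "cholomorphic_on (\<lambda>z. z $ i) U"
  by (rule cholomorphic_onI[where f' = "\<lambda>_ v. v $ i"])
    (simp_all add: bounded_linear_imp_has_derivative bounded_linear_vec_nth)

lemma cholomorphic_on_add [cholomorphic_intros]:
  "cholomorphic_on f U \<Longrightarrow> cholomorphic_on g U \<Longrightarrow> cholomorphic_on (\<lambda>z. f z + g z) U"
  by (rule cholomorphic_onI[OF has_derivative_add[OF cholomorphic_onD(1) cholomorphic_onD(1)]])
    (auto simp: cholomorphic_onD(2) algebra_simps)

lemma cholomorphic_on_diff [cholomorphic_intros]: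
  "cholomorphic_on f U \<Longrightarrow> cholomorphic_on g U \<Longrightarrow> cholomorphic_on (\<lambda>z. f z - g z) U"
  by (rule cholomorphic_onI[OF has_derivative_diff[OF cholomorphic_onD(1) cholomorphic_onD(1)]])
    (auto simp: cholomorphic_onD(2) algebra_simps)

lemma cholomorphic_on_mult [cholomorphic_intros]:
  "cholomorphic_on f U \<Longrightarrow> cholomorphic_on g U \<Longrightarrow> cholomorphic_on (\<lambda>z. f z * g z) U"
  by (rule cholomorphic_onI[OF has_derivative_mult[OF cholomorphic_onD(1) cholomorphic_onD(1)]])
    (auto simp: cholomorphic_onD(2) algebra_simps)

lemma cholomorphic_on_sum [cholomorphic_intros]:
  "(\<And>i. i \<in> I \<Longrightarrow> cholomorphic_on (f i) U) \<Longrightarrow> cholomorphic_on (\<lambda>z. \<Sum>i\<in>I. f i z) U"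
  by (induction I rule: infinite_finite_induct) (auto intro: cholomorphic_intros)

lemma cholomorphic_on_inverse [cholomorphic_intros]:
  assumes "cholomorphic_on f U" "\<And>z. z \<in> U \<Longrightarrow> f z \<noteq> 0"
  shows "cholomorphic_on (\<lambda>z. inverse (f z)) U"
  by (rule cholomorphic_onI[OF Deriv.has_derivative_inverse[OF _ cholomorphic_onD(1)[OF assms(1)]]])
    (use assms in \<open>auto simp: cholomorphic_onD(2)[OF assms(1)] algebra_simps\<close>)

lemma cholomorphic_on_divide [cholomorphic_intros]:
  assumes "cholomorphic_on f U" "cholomorphic_on g U" "\<And>z. z \<in> U \<Longrightarrow> g z \<noteq> 0"
  shows "cholomorphic_on (\<lambda>z. f z / g z) U"
  unfolding divide_inverse by (intro cholomorphic_intros assms)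

lemma cholomorphic_map_onD:
  assumes "cholomorphic_map_on f U" "z \<in> U"
  shows cholomorphic_map_on_has_derivative:
      "(f has_derivative frechet_derivative f (at z)) (at z)"
    and cholomorphic_map_on_derivative_smult:
      "frechet_derivative f (at z) (a *s v) = a *s frechet_derivative f (at z) v"
    and cholomorphic_map_on_derivative_nth:
      "frechet_derivative f (at z) v $ i = frechet_derivative (\<lambda>z. f z $ i) (at z) v"
proof -
  have *: "cholomorphic_on (\<lambda>z. f z $ i) U" for i
    using assms unfolding cholomorphic_map_on_def by blast
  let ?f' = "\<lambda>v. \<chi> i. frechet_derivative (\<lambda>z. f z $ i) (at z) v"
  have "(f has_derivative ?f') (at z)"
    by (rule has_derivative_vec_lambda) (simp add: cholomorphic_onD[OF * assms(2)])
  then have eq: "frechet_derivative f (at z) = ?f'" and d: "(f has_derivative ?f') (at z)"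
    by (simp_all add: frechet_derivative_at[symmetric])
  show "(f has_derivative frechet_derivative f (at z)) (at z)" using d eq by simp
  show "frechet_derivative f (at z) (a *s v) = a *s frechet_derivative f (at z) v"
    unfolding eq using cholomorphic_onD(2)[OF * assms(2)] by (simp add: vec_eq_iff)
  show "frechet_derivative f (at z) v $ i = frechet_derivative (\<lambda>z. f z $ i) (at z) v"
    unfolding eq by simp
qed

lemma cholomorphic_on_compose:
  assumes "cholomorphic_on f V" "cholomorphic_map_on g U" "g ` U \<subseteq> V"
  shows "cholomorphic_on (\<lambda>z. f (g z)) U"
proof (rule cholomorphic_onI)
  fix z assume z: "z \<in> U"
  then have gz: "g z \<in> V" using assms(3) by blast
  show "((\<lambda>z. f (g z)) has_derivative
      (frechet_derivative f (at (g z)) \<circ> frechet_derivative g (at z))) (at z)"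
    using diff_chain_at[OF cholomorphic_map_onD(1)[OF assms(2) z] cholomorphic_onD(1)[OF assms(1) gz]]
    by (simp add: o_def)
  fix a v
  show "(frechet_derivative f (at (g z)) \<circ> frechet_derivative g (at z)) (a *s v) =
      a * (frechet_derivative f (at (g z)) \<circ> frechet_derivative g (at z)) v"
    by (simp add: cholomorphic_map_onD(2)[OF assms(2) z] cholomorphic_onD(2)[OF assms(1) gz])
qed

lemma cholomorphic_map_on_compose:
  assumes "cholomorphic_map_on f V" "cholomorphic_map_on g U" "g ` U \<subseteq> V"
  shows "cholomorphic_map_on (\<lambda>z. f (g z)) U"
  using assms cholomorphic_on_compose[OF _ assms(2,3)] unfolding cholomorphic_map_on_def by blast

lemma cholomorphic_map_onI [cholomorphic_intros]:
  "(\<And>i. cholomorphic_on (\<lambda>z. f z $ i) U) \<Longrightarrow> cholomorphic_map_on f U"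
  unfolding cholomorphic_map_on_def by blast

lemma cholomorphic_on_component:
  "cholomorphic_map_on f U \<Longrightarrow> cholomorphic_on (\<lambda>z. f z $ i) U"
  unfolding cholomorphic_map_on_def by blast

lemma cholomorphic_on_has_field_derivative_line:
  assumes "cholomorphic_on f U" "z + t *s v \<in> U"
  shows "((\<lambda>t. f (z + t *s v)) has_field_derivative
    frechet_derivative f (at (z + t *s v)) v) (at t)"
proof -
  have "(f \<circ> (\<lambda>t. z + t *s v) has_derivative
      frechet_derivative f (at (z + t *s v)) \<circ> (\<lambda>h. h *s v)) (at t)"
    by (rule diff_chain_at[OF has_derivative_line cholomorphic_onD(1)[OF assms]])
  moreover have "frechet_derivative f (at (z + t *s v)) \<circ> (\<lambda>h. h *s v) =
      (*) (frechet_derivative f (at (z + t *s v)) v)"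
    by (simp add: fun_eq_iff cholomorphic_onD(2)[OF assms] mult.commute)
  ultimately show ?thesis by (simp add: has_field_derivative_def o_def)
qed

lemma cholomorphic_on_holomorphic_line:
  assumes "cholomorphic_on f U" "\<And>t. t \<in> T \<Longrightarrow> z + t *s v \<in> U"
  shows "(\<lambda>t. f (z + t *s v)) holomorphic_on T"
  using cholomorphic_on_has_field_derivative_line[OF assms(1)] assms(2)
  by (meson DERIV_subset field_differentiable_def holomorphic_on_def subset_UNIV)

section \<open>Dependence on parameters: Osgood's lemma, integrals and derivatives\<close>

lemma continuous_on_deriv_param:
  fixes G :: "'a::topological_space \<Rightarrow> complex \<Rightarrow> complex"
  assumes r: "r > 0" and cont: "continuous_on (X \<times> cball 0 r) (\<lambda>(x,t). G x t)"
    and hol: "\<And>x. x \<in> X \<Longrightarrow> G x holomorphic_on ball 0 r"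
  shows "continuous_on X (\<lambda>x. deriv (G x) 0)"
  unfolding continuous_on_def
proof (intro ballI tendstoI)
  fix x0 e assume x0: "x0 \<in> X" and e: "e > (0::real)"
  \<comment> \<open>Closeness within \<open>e * r / 2\<close> on the whole disc of radius
    \<open>r\<close> bounds the difference of the derivatives at 0 by \<open>e / 2\<close>, by
    Cauchy's inequality.\<close>
  have "e * r / 2 > 0" using r e by simp
  then obtain X0 where "x0 \<in> X0" "open X0" "\<forall>x\<in>X0 \<inter> X. \<forall>t\<in>cball 0 r.
      dist ((\<lambda>(x,t). G x t) (x, t)) ((\<lambda>(x,t). G x t) (x0, t)) \<le> e * r / 2"
    by (rule continuous_on_prod_compactE[OF cont compact_cball x0])
  then have X0: "x0 \<in> X0" "open X0"
    "\<forall>x\<in>X0 \<inter> X. \<forall>t\<in>cball 0 r. dist (G x t) (G x0 t) \<le> e * r / 2" by simp_all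
  have "dist (deriv (G x) 0) (deriv (G x0) 0) < e" if x: "x \<in> X0 \<inter> X" for x
  proof -
    have c: "continuous_on (cball 0 r) (G y)" if "y \<in> X" for y
      by (rule continuous_on_compose2[OF cont, where f = "\<lambda>t. (y, t)", simplified])
        (use that in \<open>auto intro!: continuous_intros\<close>)
    have d: "G y field_differentiable (at 0)" if "y \<in> X" for y
      using hol[OF that] r by (meson centre_in_ball holomorphic_on_imp_differentiable_at open_ball)
    have "norm ((deriv ^^ 1) (\<lambda>t. G x t - G x0 t) 0) \<le> fact 1 * (e * r / 2) / r ^ 1"
      by (rule Cauchy_inequality)
        (use x x0 r X0 in \<open>auto intro!: holomorphic_intros continuous_intros hol c simp: dist_norm\<close>)
    moreover have "deriv (\<lambda>t. G x t - G x0 t) 0 = deriv (G x) 0 - deriv (G x0) 0"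
      using d x x0 by (intro deriv_diff) auto
    ultimately show ?thesis using e r by (simp add: dist_norm)
  qed
  then show "\<forall>\<^sub>F x in at x0 within X. dist (deriv (G x) 0) (deriv (G x0) 0) < e"
    using X0(1,2) unfolding eventually_at_topological by blast
qed


text \<open>Joint continuity makes the partial derivatives continuous, by Cauchy's inequality on
  discs, and continuous complex partial derivatives add up to a complex linear total derivative.
  Integrals and uniform limits are shown to be holomorphic in this way below.\<close>

lemma Osgood:
  fixes f :: "complex^'n \<Rightarrow> complex"
  assumes U: "open U" and cont: "continuous_on U f"
    and sep: "\<And>z i. z \<in> U \<Longrightarrow> (\<lambda>t. f (z + t *s axis i 1)) field_differentiable (at 0)"
  shows "cholomorphic_on f U"
proof (rule cholomorphic_onI)
  define p where "p i z = deriv (\<lambda>t. f (z + t *s axis i 1)) 0" for i z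
  have der: "((\<lambda>t. f (z + t *s axis i 1)) has_field_derivative p i (z + t *s axis i 1)) (at t)"
    if "z + t *s axis i 1 \<in> U" for z t i
  proof -
    have "((\<lambda>s. f ((z + t *s axis i 1) + s *s axis i 1)) has_field_derivative p i (z + t *s axis i 1)) (at 0)"
      using sep[OF that] unfolding p_def by (simp add: DERIV_deriv_iff_field_differentiable)
    then show ?thesis
      using DERIV_shift[of "\<lambda>s. f (z + s *s axis i 1)" "p i (z + t *s axis i 1)" 0 t]
      by (simp add: algebra_simps vector_sadd_rdistrib)
  qed
  have pcont: "isCont (p i) z" if z: "z \<in> U" for z i
  proof -
    obtain r where r: "r > 0" "cball z (2 * r) \<subseteq> U"
      by (metis U field_sum_of_halves mult_2 open_contains_cball z half_gt_zero)
    have sub: "x + t *s axis i 1 \<in> U" if "x \<in> ball z r" "t \<in> cball 0 r" for x and t :: complex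
    proof -
      have "dist z (x + t *s axis i 1) \<le> dist z x + norm (t *s (axis i 1 :: complex^'n))"
        by (metis add.commute dist_norm dist_triangle_le norm_minus_commute add_diff_cancel_left' order_refl)
      then show ?thesis using that r by (intro subsetD[OF r(2)]) (simp add: norm_vector_smult norm_axis_complex)
    qed
    have "continuous_on (ball z r) (p i)"
      unfolding p_def
    proof (rule continuous_on_deriv_param[OF r(1)])
      show "continuous_on (ball z r \<times> cball 0 r) (\<lambda>(x, t). f (x + t *s axis i 1))"
        unfolding case_prod_unfold
        by (rule continuous_on_compose2[OF cont]) (use sub in \<open>auto intro!: continuous_intros\<close>)
      show "(\<lambda>t. f (x + t *s axis i 1)) holomorphic_on ball 0 r" if "x \<in> ball z r" for x
        using der sub[OF that]
        by (meson DERIV_subset ball_subset_cball field_differentiable_def holomorphic_on_def subset_UNIV subsetD)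
    qed
    then show ?thesis using r(1) by (simp add: continuous_on_eq_continuous_at)
  qed
  fix z assume z: "z \<in> U"
  let ?f' = "\<lambda>v. \<Sum>i\<in>UNIV. v $ i * p i z"
  \<comment> \<open>\<open>R K v\<close> keeps only the coordinates of \<open>v\<close> in
    \<open>K\<close>; the increment is built up one coordinate at a time by induction on
    \<open>K\<close>.\<close>
  define R where "R K v = (\<chi> i. if i \<in> K then v $ i else 0)" for K and v :: "complex^'n"
  have Rn: "norm (R K v) \<le> norm v" for K v
    unfolding R_def norm_vec_def by (rule L2_set_mono) auto
  have main: "\<forall>e>0. \<exists>d>0. \<forall>v. norm v < d \<longrightarrow>
      norm (f (z + R K v) - f z - (\<Sum>i\<in>K. v $ i * p i z)) \<le> e * norm v" if "finite K" for K
    using that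
  proof (induction K)
    case empty
    have "R {} v = 0" for v by (simp add: R_def vec_eq_iff)
    then show ?case by (auto intro: exI[of _ 1])
  next
    case (insert j K)
    show ?case
    proof (intro allI impI)
      fix e :: real assume e: "e > 0"
      obtain d1 where d1: "d1 > 0" "\<And>v. norm v < d1 \<Longrightarrow>
          norm (f (z + R K v) - f z - (\<Sum>i\<in>K. v $ i * p i z)) \<le> e / 2 * norm v"
        using insert.IH e by (meson half_gt_zero)
      obtain d2 where d2: "d2 > 0" "\<And>w. dist w z < d2 \<Longrightarrow> dist (p j w) (p j z) < e / 2"
        using pcont[OF z, of j] e unfolding continuous_at_eps_delta by (meson half_gt_zero)
      obtain d3 where d3: "d3 > 0" "ball z d3 \<subseteq> U" using U z openE by blast
      \<comment> \<open>The points met below are within \<open>2 * norm v\<close> of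
        \<open>z\<close>, hence the halves.\<close>
      define d where "d = min d1 (min (d2 / 2) (d3 / 2))"
      have "norm (f (z + R (insert j K) v) - f z - (\<Sum>i\<in>insert j K. v $ i * p i z)) \<le> e * norm v"
        if v: "norm v < d" for v
      proof -
        \<comment> \<open>With the linear term subtracted, the derivative along the new coordinate
          is \<open>p j\<close> at a nearby point minus \<open>p j z\<close>, which is at most
          \<open>e / 2\<close> in norm.\<close>
        let ?g = "\<lambda>t. f (z + R K v + t *s axis j 1) - t * p j z"
        have near: "dist (z + R K v + t *s axis j 1) z < min d2 d3" if "norm t \<le> norm (v $ j)" for t :: complex
        proof -
          have "dist (z + R K v + t *s axis j 1) z \<le> norm (R K v) + norm (t *s (axis j 1 :: complex^'n))"
            unfolding dist_norm by (metis add.assoc add_diff_cancel_left' norm_triangle_ineq)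
          also have "\<dots> \<le> norm v + norm v"
            using Rn[of K v] that Finite_Cartesian_Product.norm_nth_le[of v j] by (simp add: norm_vector_smult norm_axis_complex)
          also have "\<dots> < min d2 d3" using v by (simp add: d_def)
          finally show ?thesis .
        qed
        have "norm (?g (v $ j) - ?g 0) \<le> e / 2 * norm (v $ j - 0)"
        proof (rule field_differentiable_bound[where S = "cball 0 (norm (v $ j))" and f' = "\<lambda>t. p j (z + R K v + t *s axis j 1) - p j z"])
          fix t assume t: "t \<in> cball (0::complex) (norm (v $ j))"
          then have nt: "dist (z + R K v + t *s axis j 1) z < min d2 d3" by (intro near) simp
          then have "z + R K v + t *s axis j 1 \<in> U" using d3(2) by (auto simp: dist_commute)
          then show "(?g has_field_derivative p j (z + R K v + t *s axis j 1) - p j z) (at t within cball 0 (norm (v $ j)))"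
            by (intro DERIV_diff DERIV_subset[OF der] DERIV_cmult_right DERIV_ident derivative_eq_intros) auto
          show "norm (p j (z + R K v + t *s axis j 1) - p j z) \<le> e / 2"
            using d2(2) nt by (auto simp: dist_norm intro: less_imp_le)
        qed auto
        also have "\<dots> \<le> e / 2 * norm v"
          using e Finite_Cartesian_Product.norm_nth_le[of v j] by simp
        finally have A: "norm (?g (v $ j) - ?g 0) \<le> e / 2 * norm v" .
        have eq: "R (insert j K) v = R K v + (v $ j) *s axis j 1"
          using insert.hyps by (auto simp: R_def vec_eq_iff axis_def)
        have B: "norm (f (z + R K v) - f z - (\<Sum>i\<in>K. v $ i * p i z)) \<le> e / 2 * norm v"
          using d1(2) v by (simp add: d_def)
        have "f (z + R (insert j K) v) - f z - (\<Sum>i\<in>insert j K. v $ i * p i z) =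
          (?g (v $ j) - ?g 0) + (f (z + R K v) - f z - (\<Sum>i\<in>K. v $ i * p i z))"
          using insert.hyps by (simp add: eq add.assoc)
        then show ?thesis using A B norm_triangle_ineq by (smt (verit) field_sum_of_halves distrib_right)
      qed
      moreover have "d > 0" using d1 d2 d3 by (simp add: d_def)
      ultimately show "\<exists>d>0. \<forall>v. norm v < d \<longrightarrow>
          norm (f (z + R (insert j K) v) - f z - (\<Sum>i\<in>insert j K. v $ i * p i z)) \<le> e * norm v"
        by blast
    qed
  qed
  have R: "R UNIV v = v" for v by (simp add: R_def)
  have "bounded_linear ?f'"
    by (intro bounded_linear_sum bounded_linear_mult_left[THEN bounded_linear_compose] bounded_linear_vec_nth)
  moreover have "\<exists>d>0. \<forall>y. norm (y - z) < d \<longrightarrow> norm (f y - f z - ?f' (y - z)) \<le> e * norm (y - z)"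
    if "e > 0" for e
  proof -
    obtain d where "d > 0" "\<And>v. norm v < d \<Longrightarrow> norm (f (z + v) - f z - ?f' v) \<le> e * norm v"
      using main[of UNIV] \<open>e > 0\<close> unfolding R by auto
    then have "norm (y - z) < d \<longrightarrow> norm (f y - f z - ?f' (y - z)) \<le> e * norm (y - z)" for y
      using \<open>\<And>v. norm v < d \<Longrightarrow> _\<close>[of "y - z"] by simp
    then show ?thesis using \<open>d > 0\<close> by blast
  qed
  ultimately show "(f has_derivative ?f') (at z)" by (simp add: has_derivative_at_alt)
qed (simp add: sum_distrib_left mult.assoc)

text \<open>Osgood's lemma reduces this to one coordinate at a time, where the Leibniz rule applies;
  the joint continuity of the differentiated integrand comes from Cauchy's inequality.\<close>

lemma cholomorphic_on_integral:
  fixes g :: "complex^'n \<Rightarrow> real \<Rightarrow> complex"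
  assumes U: "open U" and cont: "continuous_on (U \<times> cbox a b) (\<lambda>(x,s). g x s)"
    and hol: "\<And>s. s \<in> cbox a b \<Longrightarrow> cholomorphic_on (\<lambda>x. g x s) U"
  shows "cholomorphic_on (\<lambda>x. integral (cbox a b) (g x)) U"
proof (rule Osgood[OF U integral_continuous_on_param[OF cont]])
  fix z i assume z: "z \<in> U"
  obtain r where r: "r > 0" "cball z (2 * r) \<subseteq> U"
    by (metis U field_sum_of_halves mult_2 open_contains_cball z half_gt_zero)
  have sub: "z + t *s axis i 1 \<in> U" if "norm t \<le> 2 * r" for t :: complex
    using that by (intro subsetD[OF r(2)]) (simp add: dist_norm norm_vector_smult norm_axis_complex)
  have nt: "norm (t + u) \<le> 2 * r" if "norm t < r" "norm u \<le> r" for t u :: complex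
    using that norm_triangle_ineq[of t u] by linarith
  let ?f = "\<lambda>t. g (z + t *s axis i 1)"
  \<comment> \<open>The derivative at \<open>t\<close> is written as the derivative at 0 of the
    shifted function, the form that \<open>continuous_on_deriv_param\<close> handles.\<close>
  let ?f' = "\<lambda>t s. deriv (\<lambda>u. ?f (t + u) s) 0"
  have "((\<lambda>t. integral (cbox a b) (?f t)) has_field_derivative integral (cbox a b) (?f' 0)) (at 0 within ball 0 r)"
  proof (rule leibniz_rule_field_derivative[where f = ?f and fx = ?f'])
    fix t s assume t: "t \<in> ball (0::complex) r" and s: "s \<in> cbox a b"
    have "((\<lambda>u. ?f u s) has_field_derivative frechet_derivative (\<lambda>x. g x s) (at (z + t *s axis i 1)) (axis i 1)) (at t)"
      using t r by (intro cholomorphic_on_has_field_derivative_line[OF hol[OF s] sub]) auto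
    then have D: "((\<lambda>u. ?f u s) has_field_derivative deriv (\<lambda>u. ?f u s) t) (at t)"
      by (simp add: DERIV_imp_deriv)
    then have "((\<lambda>u. ?f (t + u) s) has_field_derivative deriv (\<lambda>u. ?f u s) t) (at 0)"
      using DERIV_shift[of "\<lambda>u. ?f u s" "deriv (\<lambda>u. ?f u s) t" 0 t] by (simp add: add.commute)
    then show "((\<lambda>u. ?f u s) has_field_derivative ?f' t s) (at t within ball 0 r)"
      using D DERIV_subset by (metis DERIV_imp_deriv subset_UNIV)
  next
    fix t assume t: "t \<in> ball (0::complex) r"
    have "continuous_on (cbox a b) (?f t)"
      by (rule continuous_on_compose2[OF cont, where f = "\<lambda>s. (z + t *s axis i 1, s)", simplified])
        (use t r sub[of t] in \<open>auto intro!: continuous_intros\<close>)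
    then show "?f t integrable_on cbox a b" by (rule integrable_continuous)
  next
    have "continuous_on (ball 0 r \<times> cbox a b) (\<lambda>x. deriv (\<lambda>u. ?f (fst x + u) (snd x)) 0)"
    proof (rule continuous_on_deriv_param[OF r(1)])
      show "continuous_on ((ball 0 r \<times> cbox a b) \<times> cball 0 r) (\<lambda>(x, t). ?f (fst x + t) (snd x))"
      proof -
        let ?q = "\<lambda>x. (z + (fst (fst x) + snd x) *s axis i 1, snd (fst x))"
        have "continuous_on ((ball 0 r \<times> cbox a b) \<times> cball 0 r) (\<lambda>x. (\<lambda>(x,s). g x s) (?q x))"
          by (rule continuous_on_compose2[OF cont]) (auto intro!: continuous_intros sub nt simp flip: vector_sadd_rdistrib)
        then show ?thesis by (simp add: case_prod_unfold)
      qed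
      fix x assume x: "x \<in> ball (0::complex) r \<times> cbox a b"
      have "(\<lambda>u. g ((z + fst x *s axis i 1) + u *s axis i 1) (snd x)) holomorphic_on ball 0 r"
      proof (rule cholomorphic_on_holomorphic_line[OF hol])
        fix t :: complex assume "t \<in> ball 0 r"
        then show "z + fst x *s axis i 1 + t *s axis i 1 \<in> U"
          using sub[OF nt[of "fst x" t]] x by (auto simp: vector_sadd_rdistrib add.assoc)
      qed (use x in auto)
      then show "(\<lambda>u. ?f (fst x + u) (snd x)) holomorphic_on ball 0 r"
        by (simp add: vector_sadd_rdistrib add.assoc)
    qed
    then show "continuous_on (ball 0 r \<times> cbox a b) (\<lambda>(t, s). ?f' t s)"
      by (simp add: case_prod_unfold)
  qed (use r in auto)
  then show "(\<lambda>t. integral (cbox a b) (g (z + t *s axis i 1))) field_differentiable at 0"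
    using r(1) at_within_open[of "0::complex" "ball 0 r"] unfolding field_differentiable_def by auto
qed

lemma cholomorphic_on_circle_integral:
  fixes g :: "complex^'n \<Rightarrow> complex \<Rightarrow> complex"
  assumes U: "open U" and r: "r > 0" and cont: "continuous_on (U \<times> sphere c r) (\<lambda>(x,s). g x s)"
    and hol: "\<And>s. s \<in> sphere c r \<Longrightarrow> cholomorphic_on (\<lambda>x. g x s) U"
  shows "cholomorphic_on (\<lambda>x. contour_integral (circlepath c r) (g x)) U"
proof -
  have cp: "circlepath c r s \<in> sphere c r" for s
    using r by (auto simp: circlepath dist_norm norm_mult)
  have cc: "continuous_on S (circlepath c r)" for S
    unfolding circlepath by (intro continuous_intros)
  have "cholomorphic_on (\<lambda>x. integral (cbox 0 1)
      (\<lambda>s. g x (circlepath c r s) * (2 * pi * \<i> * r * exp (2 * of_real pi * \<i> * s)))) U"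
  proof (rule cholomorphic_on_integral[OF U])
    have "continuous_on (U \<times> cbox 0 1) (\<lambda>x. g (fst x) (circlepath c r (snd x)))"
      by (rule continuous_on_compose2[OF cont, where f = "\<lambda>x. (fst x, circlepath c r (snd x))", simplified])
        (use cp in \<open>auto intro!: continuous_intros continuous_on_compose2[OF cc[of UNIV]]\<close>)
    then show "continuous_on (U \<times> cbox 0 1) (\<lambda>(x, s). g x (circlepath c r s) *
        (2 * pi * \<i> * r * exp (2 * of_real pi * \<i> * s)))"
      unfolding case_prod_unfold by (intro continuous_intros) auto
  qed (intro cholomorphic_intros hol cp)
  then show ?thesis
    by (simp add: contour_integral_integral vector_derivative_circlepath)
qed

text \<open>The directional derivative is Cauchy's integral for the derivative of
  \<open>f (x + t *s v)\<close> at \<open>t = 0\<close>, and its integrand depends holomorphically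
  on \<open>x\<close>.\<close>

lemma cholomorphic_on_frechet_derivative [cholomorphic_intros]:
  assumes U: "open U" and hol: "cholomorphic_on f U"
  shows "cholomorphic_on (\<lambda>z. frechet_derivative f (at z) v) U"
proof (cases "v = 0")
  case True
  have "frechet_derivative f (at z) v = 0" if "z \<in> U" for z
    using cholomorphic_onD(2)[OF hol that, of 0 v] True by simp
  then show ?thesis
    using cholomorphic_on_cong[OF U cholomorphic_on_const[of 0]] by metis
next
  case False
  show ?thesis
  proof (rule cholomorphic_on_local)
    fix z assume "z \<in> U"
    then obtain d where d: "d > 0" "ball z (2 * d) \<subseteq> U"
      by (metis U field_sum_of_halves mult_2 openE half_gt_zero)
    \<comment> \<open>The discs in direction \<open>v\<close> then reach only \<open>d / 2\<close>
      from their centres, so those centred in \<open>ball z d\<close> stay in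
      \<open>ball z (2 * d)\<close>.\<close>
    define r where "r = d / (2 * norm v)"
    have r: "r > 0" using d False by (simp add: r_def)
    have sub: "x + t *s v \<in> U" if "x \<in> ball z d" "t \<in> cball 0 r" for x and t :: complex
    proof -
      have "dist z (x + t *s v) \<le> dist z x + norm (t *s v)"
        by (metis add.commute dist_norm dist_triangle_le norm_minus_commute add_diff_cancel_left' order_refl)
      moreover have "norm (t *s v) \<le> r * norm v"
        using that by (simp add: norm_vector_smult mult_right_mono)
      moreover have "r * norm v = d / 2" using False by (simp add: r_def)
      ultimately show ?thesis using that d by (intro subsetD[OF d(2)]) simp
    qed
    let ?g = "\<lambda>x t. f (x + t *s v)"
    have cont: "continuous_on (ball z d \<times> cball 0 r) (\<lambda>x. ?g (fst x) (snd x))"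
      by (rule continuous_on_compose2[OF cholomorphic_on_imp_continuous_on[OF hol]])
        (use sub in \<open>auto intro!: continuous_intros\<close>)
    have "cholomorphic_on (\<lambda>x. contour_integral (circlepath 0 r) (\<lambda>t. ?g x t / (t - 0)^2)) (ball z d)"
    proof (rule cholomorphic_on_circle_integral[OF open_ball r])
      show "continuous_on (ball z d \<times> sphere 0 r) (\<lambda>(x, t). ?g x t / (t - 0)^2)"
        unfolding case_prod_unfold
        by (intro continuous_intros continuous_on_subset[OF cont]) (use r in auto)
      fix t :: complex assume "t \<in> sphere 0 r"
      then show "cholomorphic_on (\<lambda>x. ?g x t / (t - 0)^2) (ball z d)"
        unfolding power2_eq_square
        by (intro cholomorphic_intros cholomorphic_on_compose[OF hol]) (use r sub in \<open>auto intro!: cholomorphic_intros\<close>)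
    qed
    then have "cholomorphic_on (\<lambda>x. 1 / (2 * of_real pi * \<i>) *
        contour_integral (circlepath 0 r) (\<lambda>t. ?g x t / (t - 0)^2)) (ball z d)"
      by (intro cholomorphic_intros)
    moreover have "1 / (2 * of_real pi * \<i>) *
        contour_integral (circlepath 0 r) (\<lambda>t. ?g x t / (t - 0)^2) = frechet_derivative f (at x) v"
      if x: "x \<in> ball z d" for x
    proof -
      have "(?g x has_field_derivative frechet_derivative f (at (x + 0 *s v)) v) (at 0)"
        using x sub[OF x, of 0] r by (intro cholomorphic_on_has_field_derivative_line[OF hol]) auto
      moreover have "(?g x has_field_derivative 1 / (2 * of_real pi * \<i>) *
        contour_integral (circlepath 0 r) (\<lambda>t. ?g x t / (t - 0)^2)) (at 0)"
      proof (rule Cauchy_derivative_integral_circlepath(2))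
        show "continuous_on (cball 0 r) (?g x)"
          by (rule continuous_on_compose2[OF cont, where f = "\<lambda>t. (x, t)", simplified])
            (use x in \<open>auto intro!: continuous_intros\<close>)
        show "?g x holomorphic_on ball 0 r"
          by (rule cholomorphic_on_holomorphic_line[OF hol]) (use sub[OF x] in auto)
      qed (use r in auto)
      ultimately show ?thesis using DERIV_unique by fastforce
    qed
    ultimately have "cholomorphic_on (\<lambda>z. frechet_derivative f (at z) v) (ball z d)"
      by (rule cholomorphic_on_cong[OF open_ball])
    then show "\<exists>V. z \<in> V \<and> cholomorphic_on (\<lambda>z. frechet_derivative f (at z) v) V"
      using d(1) by (intro exI[of _ "ball z d"]) auto
  qed
qed

subsection \<open>Local inverses\<close>

definition biholomorphic_on :: "(complex^'n \<Rightarrow> complex^'n) \<Rightarrow> (complex^'n) set \<Rightarrow> bool" where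
  "biholomorphic_on \<Phi> V \<longleftrightarrow> open V \<and> inj_on \<Phi> V \<and> open (\<Phi> ` V) \<and>
     cholomorphic_map_on \<Phi> V \<and> cholomorphic_map_on (inv_into V \<Phi>) (\<Phi> ` V)"

lemma cholomorphic_map_on_has_derivativeI:
  assumes "\<And>z. z \<in> U \<Longrightarrow> (f has_derivative f' z) (at z)"
    and "\<And>z a v. z \<in> U \<Longrightarrow> f' z (a *s v) = a *s f' z v"
  shows "cholomorphic_map_on f U"
proof (rule cholomorphic_map_onI)
  fix i
  show "cholomorphic_on (\<lambda>z. f z $ i) U"
    by (rule cholomorphic_onI[where f' = "\<lambda>z v. f' z v $ i"])
      (use assms in \<open>auto intro: bounded_linear.has_derivative[OF bounded_linear_vec_nth]\<close>)
qed

lemma biholomorphic_on_subset: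
  assumes "biholomorphic_on \<Phi> V" "open W" "W \<subseteq> V"
  shows "biholomorphic_on \<Phi> W"
proof -
  note b = assms(1)[unfolded biholomorphic_on_def]
  have inj: "inj_on \<Phi> W" using b assms(3) inj_on_subset by blast
  have eq: "\<Phi> ` W = \<Phi> ` V \<inter> inv_into V \<Phi> -` W"
    using b assms(3) by (auto simp: inv_into_f_f subset_iff)
  have op: "open (\<Phi> ` W)"
    unfolding eq using b assms(2) cholomorphic_map_on_imp_continuous_on
    by (intro continuous_open_preimage) auto
  have "cholomorphic_map_on (inv_into W \<Phi>) (\<Phi> ` W)"
  proof (rule cholomorphic_map_on_cong[OF op])
    show "cholomorphic_map_on (inv_into V \<Phi>) (\<Phi> ` W)"
      using b assms(3) cholomorphic_map_on_subset by (metis image_mono)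
    show "inv_into V \<Phi> z = inv_into W \<Phi> z" if "z \<in> \<Phi> ` W" for z
      using that b inj assms(3) by (auto simp: inv_into_f_f subset_iff)
  qed
  then show ?thesis
    unfolding biholomorphic_on_def
    using b inj op assms cholomorphic_map_on_subset by blast
qed

text \<open>The form in which the derivative enters the inverse function theorem and the Lipschitz
  estimate of the Picard iteration. In finite dimension, continuity into the operators may be tested
  on each vector.\<close>

lemma cholomorphic_map_on_blinfun_derivative:
  fixes \<Phi> :: "complex^'n \<Rightarrow> complex^'n"
  assumes U: "open U" and hol: "cholomorphic_map_on \<Phi> U"
  defines "f' \<equiv> \<lambda>x. Blinfun (frechet_derivative \<Phi> (at x))"
  shows "\<And>x. x \<in> U \<Longrightarrow> blinfun_apply (f' x) = frechet_derivative \<Phi> (at x)"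
    and "continuous_on U f'"
proof -
  show f': "blinfun_apply (f' x) = frechet_derivative \<Phi> (at x)" if "x \<in> U" for x
    unfolding f'_def
    by (rule bounded_linear_Blinfun_apply)
      (rule has_derivative_bounded_linear[OF cholomorphic_map_onD(1)[OF hol that]])
  show "continuous_on U f'"
  proof (rule continuous_on_blinfun_componentwise)
    fix i :: "complex^'n"
    have "continuous_on U (\<lambda>x. \<chi> k. frechet_derivative (\<lambda>z. \<Phi> z $ k) (at x) i)"
      by (intro continuous_on_vec_lambda cholomorphic_on_imp_continuous_on
          cholomorphic_on_frechet_derivative U cholomorphic_on_component hol)
    then show "continuous_on U (\<lambda>x. blinfun_apply (f' x) i)"
      by (rule continuous_on_eq) (simp add: f' vec_eq_iff cholomorphic_map_onD(3)[OF hol])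
  qed
qed

text \<open>The inverse supplied by the real inverse function theorem has as derivative the inverse
  of a complex linear bijection, which is again complex linear.\<close>

lemma local_biholomorphism:
  fixes \<Phi> :: "complex^'n \<Rightarrow> complex^'n"
  assumes U: "open U" "q \<in> U" and hol: "cholomorphic_map_on \<Phi> U"
    and der: "(\<Phi> has_derivative \<Phi>') (at q)" and inj: "\<And>v. \<Phi>' v = 0 \<Longrightarrow> v = 0"
  obtains V where "q \<in> V" "V \<subseteq> U" "biholomorphic_on \<Phi> V"
proof -
  let ?d = "\<lambda>x. frechet_derivative \<Phi> (at x)"
  have d: "(\<Phi> has_derivative ?d x) (at x)" if "x \<in> U" for x
    by (rule cholomorphic_map_onD(1)[OF hol that])
  have bl: "bounded_linear (?d x)" if "x \<in> U" for x
    using d[OF that] by (rule has_derivative_bounded_linear)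
  have eq: "?d q = \<Phi>'" using der frechet_derivative_at by metis
  obtain g' where g': "linear g'" "g' \<circ> \<Phi>' = id"
    using linear_injective_left_inverse[of \<Phi>'] inj bl[OF U(2)] eq
    by (metis bounded_linear.linear linear_injective_0)
  define f' where "f' x = Blinfun (?d x)" for x
  note f' = cholomorphic_map_on_blinfun_derivative(1)[OF U(1) hol, folded f'_def]
  have cont: "continuous_on U f'"
    using cholomorphic_map_on_blinfun_derivative(2)[OF U(1) hol] by (simp add: f'_def[abs_def])
  have "bounded_linear g'" using g'(1) linear_conv_bounded_linear by blast
  then have "Blinfun g' o\<^sub>L f' q = id_blinfun"
    using g'(2) by (intro blinfun_eqI)
      (simp add: bounded_linear_Blinfun_apply f' U eq fun_eq_iff)
  then obtain V W \<Psi> \<Psi>' where V: "open V" "V \<subseteq> U" "q \<in> V" "open W" "homeomorphism V W \<Phi> \<Psi>"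
    and \<Psi>: "\<And>y. y \<in> W \<Longrightarrow> (\<Psi> has_derivative \<Psi>' y) (at y)"
      "\<And>y. y \<in> W \<Longrightarrow> \<Psi>' y = inv (blinfun_apply (f' (\<Psi> y)))"
      "\<And>y. y \<in> W \<Longrightarrow> bij (blinfun_apply (f' (\<Psi> y)))"
    using inverse_function_theorem[OF U(1) _ cont U(2), of \<Phi> "Blinfun g'"] d f' by metis
  have W: "\<Phi> ` V = W" and inv: "\<And>y. y \<in> W \<Longrightarrow> \<Psi> y \<in> V \<and> \<Phi> (\<Psi> y) = y"
    and inv': "\<And>x. x \<in> V \<Longrightarrow> \<Psi> (\<Phi> x) = x"
    using V(5) unfolding homeomorphism_def by auto
  have injV: "inj_on \<Phi> V" using inv' by (metis inj_on_inverseI)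
  have "cholomorphic_map_on \<Psi> W"
  proof (rule cholomorphic_map_on_has_derivativeI[OF \<Psi>(1)])
    fix y a v assume y: "y \<in> W"
    then have U': "\<Psi> y \<in> U" using inv V(2) by blast
    have b: "bij (?d (\<Psi> y))" and e: "\<Psi>' y = inv (?d (\<Psi> y))"
      using \<Psi>(2,3)[OF y] f'[OF U'] by auto
    have "?d (\<Psi> y) (a *s \<Psi>' y v) = a *s v"
      unfolding cholomorphic_map_onD(2)[OF hol U'] e using b by (simp add: bij_is_surj surj_f_inv_f)
    then show "\<Psi>' y (a *s v) = a *s \<Psi>' y v" using b e by (metis bij_inv_eq_iff)
  qed
  then have "cholomorphic_map_on (inv_into V \<Phi>) W"
    by (rule cholomorphic_map_on_cong[OF V(4)]) (use inv inv' injV W in \<open>metis inv_into_f_f\<close>)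
  then have "biholomorphic_on \<Phi> V"
    unfolding biholomorphic_on_def using V(1,2,4) injV W cholomorphic_map_on_subset[OF hol] by blast
  then show ?thesis using that V(2,3) by blast
qed

section \<open>Extension across analytic sets of codimension two\<close>

text \<open>The extension is the Cauchy integral over circles of fixed radius in direction
  \<open>k\<close>. They avoid the hyperplane and therefore \<open>T\<close>, so the integral is
  holomorphic even at points of \<open>T\<close>. It agrees with \<open>f\<close> first over a gap
  of \<open>T\<close> in the hyperplane, where whole discs avoid \<open>T\<close>, then off the
  hyperplane by the identity theorem, then at the remaining points by continuity.\<close>

lemma Hartogs_hyperplane:
  fixes f :: "complex^'n \<Rightarrow> complex"
  assumes V: "open V" "q \<in> V" "open (V - T)" and qk: "q $ k = 0"
    and hol: "cholomorphic_on f (V - T)" and T: "\<And>w. w \<in> T \<Longrightarrow> w $ k = 0"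
    and gap: "\<And>e. e > 0 \<Longrightarrow> \<exists>w. dist w q < e \<and> w $ k = 0 \<and> w \<notin> T"
  shows "\<exists>r>0. \<exists>F. ball q r \<subseteq> V \<and> cholomorphic_on F (ball q r) \<and> (\<forall>w\<in>ball q r - T. F w = f w)"
proof -
  define P where "P w = w - (w $ k) *s axis k 1" for w :: "complex^'n"
  define ek where "ek = (axis k 1 :: complex^'n)"
  have [simp]: "ek $ k = 1" "norm ek = 1" by (simp_all add: ek_def norm_axis_complex)
  have Pk [simp]: "P w $ k = 0" for w by (simp add: P_def)
  have Pw: "w = P w + (w $ k) *s ek" for w by (simp add: P_def ek_def)
  have Pid: "P w = w" if "w $ k = 0" for w using that by (simp add: P_def vec_eq_iff)
  have Padd: "P (w + t *s ek) = P w" for w t by (simp add: P_def ek_def vec_eq_iff axis_def)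
  have Pdiff: "P (a + t *s (b - a)) = P a + t *s (P b - P a)" for a b t
    by (simp add: P_def vec_eq_iff algebra_simps)
  have Pconv: "P ((1 - u) *\<^sub>R a + u *\<^sub>R b) = (1 - u) *\<^sub>R P a + u *\<^sub>R P b" for a b u
    by (simp add: P_def vec_eq_iff algebra_simps)
  have Pcont: "continuous_on S P" for S unfolding P_def by (intro continuous_intros)
  obtain R0 where R0: "R0 > 0" "ball q R0 \<subseteq> V" using V openE by blast
  define R where "R = R0 / 3"
  have R: "R > 0" "ball q (3 * R) \<subseteq> V" using R0 by (simp_all add: R_def)
  \<comment> \<open>A ball in the hyperplane times a disc. Circles over it stay within
    \<open>2 * R\<close> of \<open>q\<close>, hence in \<open>V\<close>, and its convexity makes its
    slices by complex lines connected.\<close>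
  define D where "D = P -` ball q R \<inter> (\<lambda>w. w $ k) -` ball 0 R"
  have opD: "open D"
    unfolding D_def by (intro open_Int open_vimage Pcont open_ball continuous_intros)
  have convD: "convex D"
  proof -
    have "convex (P -` ball q R)"
      unfolding convex_alt using convex_ball[of q R, unfolded convex_alt] by (auto simp: Pconv)
    moreover have "convex ((\<lambda>w::complex^'n. w $ k) -` ball 0 R)"
      unfolding convex_alt using convex_ball[of "0::complex" R, unfolded convex_alt] by auto
    ultimately show ?thesis unfolding D_def by (rule convex_Int)
  qed
  have qD: "q \<in> D" using R qk by (simp add: D_def Pid)
  have inV: "P w + t *s ek \<in> V" if "P w \<in> ball q R" "norm t \<le> R" for w t
  proof (rule subsetD[OF R(2)])
    have "dist (P w + t *s ek) q \<le> dist (P w) q + norm (t *s ek)"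
      unfolding dist_norm by (metis diff_add_eq norm_triangle_ineq)
    then show "P w + t *s ek \<in> ball q (3 * R)"
      using that R by (simp add: norm_vector_smult dist_commute)
  qed
  have DV: "w \<in> V" if "w \<in> D" for w
    using inV[of w "w $ k"] that Pw[of w] by (simp add: D_def)
  have notT: "P w + t *s ek \<notin> T" if "t \<noteq> 0" for w t
    using T[of "P w + t *s ek"] that by auto
  let ?g = "\<lambda>w t. f (P w + t *s ek) / (t - w $ k)"
  define F where "F w = 1 / (2 * of_real pi * \<i>) * contour_integral (circlepath 0 R) (?g w)" for w
  have "cholomorphic_on (\<lambda>w. contour_integral (circlepath 0 R) (?g w)) D"
  proof (rule cholomorphic_on_circle_integral[OF opD R(1)])
    have c: "continuous_on (D \<times> sphere 0 R) (\<lambda>x. f (P (fst x) + snd x *s ek))"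
      by (rule continuous_on_compose2[OF cholomorphic_on_imp_continuous_on[OF hol]])
        (use inV notT R in \<open>auto intro!: continuous_intros continuous_on_compose2[OF Pcont] simp: D_def\<close>)
    show "continuous_on (D \<times> sphere 0 R) (\<lambda>(w, t). ?g w t)"
      unfolding case_prod_unfold by (intro continuous_intros c) (auto simp: D_def)
    fix t :: complex assume t: "t \<in> sphere 0 R"
    have "cholomorphic_map_on (\<lambda>w. P w + t *s ek) D"
      unfolding P_def by (auto intro!: cholomorphic_intros)
    then have "cholomorphic_on (\<lambda>w. f (P w + t *s ek)) D"
      by (rule cholomorphic_on_compose[OF hol]) (use inV notT R t in \<open>auto simp: D_def\<close>)
    then show "cholomorphic_on (\<lambda>w. ?g w t) D"
      by (intro cholomorphic_intros) (use t in \<open>auto simp: D_def\<close>)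
  qed
  then have holF: "cholomorphic_on F D" unfolding F_def by (intro cholomorphic_intros)
  obtain w0 where w0: "dist w0 q < R" "w0 $ k = 0" "w0 \<notin> T" using gap R(1) by blast
  have "w0 \<in> V - T" using w0 inV[of w0 0] R(1) by (auto simp: Pid dist_commute)
  then obtain \<delta> where \<delta>: "\<delta> > 0" "ball w0 \<delta> \<subseteq> V - T" using V(3) openE by blast
  have near: "F w = f w" if w: "w \<in> D" "P w \<in> ball w0 \<delta>" for w
  proof -
    have sub: "P w + t *s ek \<in> V - T" if "t \<in> cball 0 R" for t
      using that w inV[of w t] notT[of t w] \<delta>(2) by (cases "t = 0") (auto simp: D_def)
    have c: "continuous_on (cball 0 R) (\<lambda>t. f (P w + t *s ek))"
      by (rule continuous_on_compose2[OF cholomorphic_on_imp_continuous_on[OF hol]])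
        (use sub in \<open>auto intro!: continuous_intros\<close>)
    have h: "(\<lambda>t. f (P w + t *s ek)) holomorphic_on ball 0 R"
      by (rule cholomorphic_on_holomorphic_line[OF hol sub]) auto
    have "((\<lambda>t. ?g w t) has_contour_integral (2 * of_real pi * \<i> * f (P w + (w $ k) *s ek))) (circlepath 0 R)"
      by (rule Cauchy_integral_circlepath[OF c h]) (use w in \<open>simp add: D_def\<close>)
    then show ?thesis
      unfolding F_def using contour_integral_unique Pw[of w] by fastforce
  qed
  have off: "F w = f w" if w: "w \<in> D" "w $ k \<noteq> 0" for w
  proof -
    \<comment> \<open>At the same height \<open>w $ k\<close> as \<open>w\<close>, but over the gap
      \<open>w0\<close>. The complex line through \<open>a\<close> and \<open>w\<close> stays at
      this nonzero height, hence off \<open>T\<close>.\<close>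
    define a where "a = w0 + (w $ k) *s ek"
    have ak: "a $ k = w $ k" and Pa: "P a = w0" by (simp_all add: a_def w0 Padd Pid)
    have aD: "a \<in> D" using w w0 by (simp add: D_def ak Pa dist_commute)
    let ?l = "\<lambda>t. a + t *s (w - a)"
    let ?S = "?l -` D"
    have lk: "?l t $ k = w $ k" for t by (simp add: ak)
    have lc: "continuous_on UNIV ?l" by (intro continuous_intros)
    have opS: "open ?S" by (rule open_vimage[OF opD lc])
    have "?l ((1 - u) *\<^sub>R x + u *\<^sub>R y) = (1 - u) *\<^sub>R ?l x + u *\<^sub>R ?l y" for x y u
      by (simp add: vec_eq_iff algebra_simps)
    then have "convex ?S" using convD unfolding convex_alt by simp
    then have conS: "connected ?S" by (rule convex_connected)
    let ?s = "?S \<inter> (\<lambda>t. P (?l t)) -` ball w0 \<delta>"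
    have "F (?l 1) = f (?l 1)"
    proof (rule analytic_continuation_open[of ?s ?S "\<lambda>t. F (?l t)" "\<lambda>t. f (?l t)"])
      show "open ?s" by (intro open_Int opS open_vimage open_ball continuous_on_compose2[OF Pcont[of UNIV] lc]) auto
      have "0 \<in> ?s" using aD \<delta>(1) by (simp add: Pa)
      then show "?s \<noteq> {}" by blast
      show "(\<lambda>t. F (?l t)) holomorphic_on ?S" by (rule cholomorphic_on_holomorphic_line[OF holF]) auto
      show "(\<lambda>t. f (?l t)) holomorphic_on ?S"
        by (rule cholomorphic_on_holomorphic_line[OF hol]) (use T DV lk w in force)
    qed (use conS opS near w in auto)
    then show ?thesis by simp
  qed
  have agree: "F w = f w" if w: "w \<in> D - T" for w
  proof (cases "w $ k = 0")
    case False then show ?thesis using off w by blast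
  next
    case True
    have l: "((\<lambda>t. w + t *s ek) \<longlongrightarrow> w) (at 0)"
      using isCont_line[where z = w and v = ek and s = 0] unfolding isCont_def by simp
    have "isCont F w" "isCont f w"
      using w DV cholomorphic_on_imp_continuous_on[OF holF] cholomorphic_on_imp_continuous_on[OF hol]
        V(3) opD by (auto simp: continuous_on_eq_continuous_at)
    then have lim: "((\<lambda>t. F (w + t *s ek)) \<longlongrightarrow> F w) (at 0)" "((\<lambda>t. f (w + t *s ek)) \<longlongrightarrow> f w) (at 0)"
      using l isCont_tendsto_compose by blast+
    have "\<forall>\<^sub>F t in at 0. w + t *s ek \<in> D"
      using topological_tendstoD[OF l opD] w by blast
    then have ev: "\<forall>\<^sub>F t in at 0. F (w + t *s ek) = f (w + t *s ek)"
      using eventually_neq_at_within[of "0::complex" 0 UNIV]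
      by eventually_elim (use True in \<open>auto intro!: off\<close>)
    have "((\<lambda>t. f (w + t *s ek)) \<longlongrightarrow> F w) (at 0)"
      using tendsto_cong[OF ev] lim(1) by blast
    then show ?thesis using tendsto_unique[OF trivial_limit_at _ lim(2)] by blast
  qed
  obtain r where "r > 0" "ball q r \<subseteq> D" using opD qD openE by blast
  then show ?thesis using agree DV cholomorphic_on_subset[OF holF] by blast
qed


text \<open>The last two conditions say that \<open>Z\<close> has no regular points of codimension 0 or 1 in \<open>W\<close>.\<close>

definition codim_two_germ :: "(complex^'n) set \<Rightarrow> (complex^'n) set \<Rightarrow> bool" where
  "codim_two_germ Z W \<longleftrightarrow>
     open W \<and>
     (\<exists>Fs. finite Fs \<and> (\<forall>g\<in>Fs. cholomorphic_on g W) \<and> Z \<inter> W = {q\<in>W. \<forall>g\<in>Fs. g q = 0}) \<and>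
     (\<forall>V. open V \<and> V \<subseteq> W \<and> V \<subseteq> Z \<longrightarrow> V = {}) \<and>
     (\<forall>V \<Phi> k. biholomorphic_on \<Phi> V \<and> V \<subseteq> W \<and> Z \<inter> V = {z\<in>V. \<Phi> z $ k = 0} \<longrightarrow> Z \<inter> V = {})"

text \<open>The set where \<open>F\<close> and \<open>G\<close> differ is open and would lie in
  \<open>Z\<close>.\<close>

lemma continuous_on_eq_off_nowhere_dense:
  assumes "continuous_on W F" "continuous_on W G" "open W"
    and "\<And>V. open V \<Longrightarrow> V \<subseteq> W \<Longrightarrow> V \<subseteq> Z \<Longrightarrow> V = {}"
    and "\<And>w. w \<in> W - Z \<Longrightarrow> F w = G w" "w \<in> W"
  shows "F w = (G w :: complex)"
proof (rule ccontr)
  assume ne: "F w \<noteq> G w"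
  let ?V = "W \<inter> (\<lambda>w. F w - G w) -` (- {0})"
  have "open ?V"
    by (intro continuous_open_preimage continuous_intros assms)
  moreover have "?V \<subseteq> Z" using assms(5) by auto
  ultimately have "?V = {}" using assms(4) by blast
  then show False using ne assms(6) by auto
qed

text \<open>Two local extensions at the same centre agree off \<open>T\<close> on a common ball,
  hence at the centre because \<open>T\<close> has no interior; so the value picked by
  \<open>SOME\<close> does not depend on the extension.\<close>

lemma local_extensions_glue:
  fixes f :: "complex^'n \<Rightarrow> complex"
  assumes thin: "\<And>U. open U \<Longrightarrow> U \<subseteq> V \<Longrightarrow> U \<subseteq> T \<Longrightarrow> U = {}"
    and loc: "\<And>p. p \<in> V \<Longrightarrow> \<exists>r>0. \<exists>F. ball p r \<subseteq> V \<and> cholomorphic_on F (ball p r) \<and> (\<forall>w\<in>ball p r - T. F w = f w)"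
  shows "\<exists>G. cholomorphic_on G V \<and> (\<forall>z\<in>V - T. G z = f z)"
proof -
  define E where "E x r F \<longleftrightarrow> r > 0 \<and> ball x r \<subseteq> V \<and> cholomorphic_on F (ball x r) \<and>
    (\<forall>w\<in>ball x r - T. F w = f w)" for x r F
  have ex: "\<exists>r F. E x r F" if "x \<in> V" for x using loc[OF that] unfolding E_def by blast
  define G where "G x = (SOME y. \<exists>r F. E x r F \<and> F x = y)" for x
  have E_inner: "\<exists>r'. E y r' F" if E: "E x r F" and y: "y \<in> ball x r" for x y r F
  proof -
    obtain r' where "r' > 0" "ball y r' \<subseteq> ball x r" using y open_ball openE by metis
    then have "E y r' F" using E cholomorphic_on_subset unfolding E_def by blast
    then show ?thesis ..
  qed
  have E_unique: "F x = G x" if E1: "E x r F" and E2: "E x s G" for x r s F G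
  proof (rule continuous_on_eq_off_nowhere_dense[where W = "ball x (min r s)" and Z = T])
    show "continuous_on (ball x (min r s)) F" "continuous_on (ball x (min r s)) G"
      using that cholomorphic_on_imp_continuous_on cholomorphic_on_subset unfolding E_def
      by (metis ball_subset_ball_iff dist_self add_0 min.cobounded1 min.cobounded2)+
    show "U = {}" if "open U" "U \<subseteq> ball x (min r s)" "U \<subseteq> T" for U
    proof -
      have "ball x (min r s) \<subseteq> ball x r" by (simp add: subset_ball)
      then have "U \<subseteq> V" using that(2) E1 unfolding E_def by blast
      then show ?thesis using thin that by blast
    qed
  qed (use that in \<open>auto simp: E_def\<close>)
  have G_eq: "G y = F y" if "E x r F" "y \<in> ball x r" for x y r F
    unfolding G_def using E_inner[OF that] E_unique by (intro some_equality) blast+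
  have "cholomorphic_on G V"
  proof (rule cholomorphic_on_local)
    fix x assume "x \<in> V"
    then obtain r F where F: "E x r F" using ex by blast
    have "cholomorphic_on G (ball x r)"
      by (rule cholomorphic_on_cong[of _ F]) (use F G_eq[OF F] in \<open>auto simp: E_def\<close>)
    moreover have "x \<in> ball x r" using F unfolding E_def by simp
    ultimately show "\<exists>V. x \<in> V \<and> cholomorphic_on G V" by blast
  qed
  moreover have "G z = f z" if z: "z \<in> V - T" for z
  proof -
    obtain r F where F: "E z r F" using ex z by blast
    then have "z \<in> ball z r - T" using z unfolding E_def by auto
    then show ?thesis using G_eq[OF F] F unfolding E_def by auto
  qed
  ultimately show ?thesis by blast
qed

text \<open>That \<open>p\<close> is not in \<open>T\<close>, the set of points without a local
  extension, is shown by contradiction at a nearby point \<open>q\<close> of \<open>T\<close> rather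
  than at \<open>p\<close> itself, where the vanishing order may exceed its minimum on
  \<open>T\<close>. The codimension enters only through \<open>thin\<close> and
  \<open>noreg\<close>.\<close>

lemma codim_two_removable:
  fixes f :: "complex^'n \<Rightarrow> complex"
  assumes Z: "codim_two_germ Z W" and p: "p \<in> W" and hol: "cholomorphic_on f (W - Z)"
  shows "\<exists>r>0. \<exists>F. ball p r \<subseteq> W \<and> cholomorphic_on F (ball p r) \<and> (\<forall>w\<in>ball p r - Z. F w = f w)"
proof -
  have W: "open W" using Z unfolding codim_two_germ_def by blast
  note Zs = Z[unfolded codim_two_germ_def]
  obtain Fs where Fs0: "finite Fs \<and> (\<forall>g\<in>Fs. cholomorphic_on g W) \<and> Z \<inter> W = {q\<in>W. \<forall>g\<in>Fs. g q = 0}"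
    using conjunct1[OF conjunct2[OF Zs]] by (elim exE) (rule that)
  then have Fs: "finite Fs" "\<And>g. g \<in> Fs \<Longrightarrow> cholomorphic_on g W"
      and ZW: "Z \<inter> W = {q\<in>W. \<forall>g\<in>Fs. g q = 0}" by auto
  have thin: "V = {}" if "open V" "V \<subseteq> W" "V \<subseteq> Z" for V
    using conjunct1[OF conjunct2[OF conjunct2[OF Zs]]] that by blast
  have noreg: "Z \<inter> V = {}" if "biholomorphic_on \<Phi> V" "V \<subseteq> W" "Z \<inter> V = {z\<in>V. \<Phi> z $ k = 0}" for \<Phi> V k
    using conjunct2[OF conjunct2[OF conjunct2[OF Zs]]] that by simp
  define E where "E x r F \<longleftrightarrow> r > 0 \<and> ball x r \<subseteq> W \<and> cholomorphic_on F (ball x r) \<and>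
    (\<forall>w\<in>ball x r - Z. F w = f w)" for x r F
  define T where "T = {x\<in>W. \<not> (\<exists>r F. E x r F)}"
  have mem: "x \<in> Z \<longleftrightarrow> (\<forall>g\<in>Fs. g x = 0)" if "x \<in> W" for x
    using ZW that by blast
  have opWZ: "open (W - Z)"
  proof -
    have "W - Z = W \<inter> (\<Union>g\<in>Fs. W \<inter> g -` (- {0}))"
      using mem by auto
    moreover have "open (\<Union>g\<in>Fs. W \<inter> g -` (- {0}))"
      using Fs(2) W cholomorphic_on_imp_continuous_on
      by (intro open_UN ballI continuous_open_preimage) auto
    ultimately show ?thesis using open_Int[OF W] by metis
  qed
  have E_inner: "\<exists>r'. E y r' F" if E: "E x r F" and y: "y \<in> ball x r" for x y r F
  proof -
    obtain r' where "r' > 0" "ball y r' \<subseteq> ball x r" using y open_ball openE by metis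
    then have "E y r' F" using E cholomorphic_on_subset unfolding E_def by blast
    then show ?thesis ..
  qed
  have E_open: "ball x r \<inter> T = {}" if "E x r F" for x r F
    using E_inner[OF that] unfolding T_def by blast
  have T_sub: "T \<subseteq> Z"
  proof
    fix x assume x: "x \<in> T"
    show "x \<in> Z"
    proof (rule ccontr)
      assume "x \<notin> Z"
      then have "x \<in> W - Z" using x by (simp add: T_def)
      then obtain r where "r > 0" "ball x r \<subseteq> W - Z" using opWZ openE by blast
      then have "E x r f" using hol cholomorphic_on_subset unfolding E_def by blast
      then show False using x by (auto simp: T_def)
    qed
  qed
  have opWT: "open (W - T)"
    unfolding open_contains_ball
  proof
    fix x assume "x \<in> W - T"
    then obtain r F where "E x r F" by (auto simp: T_def)
    then show "\<exists>e>0. ball x e \<subseteq> W - T" using E_open unfolding E_def by blast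
  qed
  \<comment> \<open>By definition of \<open>T\<close>, \<open>f\<close> extends over
    \<open>Z - T\<close>; from here on \<open>T\<close> takes the place of \<open>Z\<close> as the
    singular set.\<close>
  have "\<exists>G. cholomorphic_on G (W - T) \<and> (\<forall>z\<in>W - T - Z. G z = f z)"
  proof (rule local_extensions_glue)
    show "U = {}" if "open U" "U \<subseteq> W - T" "U \<subseteq> Z" for U using thin that by blast
    fix x assume "x \<in> W - T"
    then obtain r F where F: "E x r F" unfolding T_def by blast
    then have "ball x r \<subseteq> W - T" using E_open[OF F] unfolding E_def by blast
    then show "\<exists>r>0. \<exists>F. ball x r \<subseteq> W - T \<and> cholomorphic_on F (ball x r) \<and> (\<forall>w\<in>ball x r - Z. F w = f w)"
      using F unfolding E_def by blast
  qed
  then obtain fx where holfx: "cholomorphic_on fx (W - T)"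
    and fxf': "\<And>z. z \<in> W - T - Z \<Longrightarrow> fx z = f z" by blast
  have fxf: "fx w = f w" if "w \<in> W - Z" for w using fxf' T_sub that by blast
  have "p \<notin> T"
  proof
    assume pT: "p \<in> T"
    \<comment> \<open>If every equation vanished identically near \<open>p\<close>, finitely many
      neighbourhoods would intersect in a nonempty open subset of \<open>Z\<close>.\<close>
    have "\<exists>g\<in>Fs. \<forall>V. open V \<and> p \<in> V \<and> V \<subseteq> W \<longrightarrow> (\<exists>x\<in>V. g x \<noteq> 0)"
    proof (rule ccontr)
      assume "\<not> ?thesis"
      then have "\<forall>g\<in>Fs. \<exists>V. open V \<and> p \<in> V \<and> V \<subseteq> W \<and> (\<forall>x\<in>V. g x = 0)" by simp
      from bchoice[OF this] obtain V where
        V: "\<forall>g\<in>Fs. open (V g) \<and> p \<in> V g \<and> V g \<subseteq> W \<and> (\<forall>x\<in>V g. g x = 0)" ..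
      have "open (W \<inter> (\<Inter>g\<in>Fs. V g))" using V by (intro open_Int W open_INT Fs(1)) auto
      moreover have "W \<inter> (\<Inter>g\<in>Fs. V g) \<subseteq> Z" using V mem by auto
      ultimately have "W \<inter> (\<Inter>g\<in>Fs. V g) = {}" using thin by blast
      then show False using V p by blast
    qed
    then obtain f1 where f1: "f1 \<in> Fs" "\<And>V. open V \<Longrightarrow> p \<in> V \<Longrightarrow> V \<subseteq> W \<Longrightarrow> \<exists>x\<in>V. f1 x \<noteq> 0"
      by meson
    have hol1: "cholomorphic_on f1 W" by (rule Fs(2)[OF f1(1)])
    obtain \<rho> where \<rho>: "\<rho> > 0" "ball p \<rho> \<subseteq> W" using W p openE by blast
    obtain p1 where p1: "p1 \<in> ball p \<rho>" "f1 p1 \<noteq> 0" using f1(2)[of "ball p \<rho>"] \<rho> by auto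
    \<comment> \<open>The direction of all derivatives below. It leads from each point near
      \<open>p\<close> to a point near \<open>p1\<close>, where \<open>f1\<close> does not vanish,
      so that \<open>f1\<close> has finite order along \<open>e\<close> at each point near
      \<open>p\<close>.\<close>
    define e where "e = p1 - p"
    have "f1 p = 0" using pT T_sub ZW p f1(1) by blast
    then have "e \<noteq> 0" using p1 by (auto simp: e_def)
    then obtain k where k: "e $ k \<noteq> 0" by (auto simp: vec_eq_iff)
    define D where "D g z = frechet_derivative g (at z) e" for g :: "complex^'n \<Rightarrow> complex" and z
    define d where "d m = (D ^^ m) f1" for m
    have d0: "d 0 = f1" by (simp add: d_def)
    have dSuc: "d (Suc m) z = frechet_derivative (d m) (at z) e" for m z by (simp add: d_def D_def)
    have hold: "cholomorphic_on (d m) W" for m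
      by (induction m) (simp_all add: d0 hol1 dSuc[abs_def] cholomorphic_on_frechet_derivative W)
    have dline: "((\<lambda>t. d m (z + t *s e)) has_field_derivative d (Suc m) (z + t *s e)) (at t)"
      if "z + t *s e \<in> W" for m z t
      unfolding dSuc by (rule cholomorphic_on_has_field_derivative_line[OF hold that])
    have "open (ball p \<rho> \<inter> f1 -` (- {0}))"
      using hol1 \<rho> cholomorphic_on_imp_continuous_on cholomorphic_on_subset
      by (intro continuous_open_preimage) (blast | simp)+
    then obtain \<delta>' where \<delta>': "\<delta>' > 0" "ball p1 \<delta>' \<subseteq> ball p \<rho> \<inter> f1 -` (- {0})"
      using p1 openE by blast
    define \<delta> where "\<delta> = min \<delta>' \<rho>"
    have \<delta>: "\<delta> > 0" "ball p \<delta> \<subseteq> W" using \<delta>' \<rho> by (auto simp: \<delta>_def)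
    have fin: "\<exists>m. d m z \<noteq> 0" if z: "z \<in> ball p \<delta>" for z
    proof (rule ccontr)
      assume "\<nexists>m. d m z \<noteq> 0"
      then have dz: "d m z = 0" for m by blast
      let ?l = "\<lambda>t. z + t *s e"
      let ?S = "?l -` ball p \<rho>"
      have lc: "continuous_on UNIV ?l" by (intro continuous_intros)
      have opS: "open ?S" by (rule open_vimage[OF open_ball lc])
      have "?l ((1 - u) *\<^sub>R x + u *\<^sub>R y) = (1 - u) *\<^sub>R ?l x + u *\<^sub>R ?l y" for x y u
        by (simp add: vec_eq_iff algebra_simps)
      then have "convex ?S" using convex_ball[of p \<rho>] unfolding convex_alt by simp
      then have conS: "connected ?S" by (rule convex_connected)
      have sub: "?l t \<in> W" if "t \<in> ?S" for t using that \<rho>(2) by auto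
      have der: "(deriv ^^ m) (\<lambda>t. f1 (?l t)) t = d m (?l t)" if "t \<in> ?S" for m t
        using that
      proof (induction m arbitrary: t)
        case 0 then show ?case by (simp add: d0)
      next
        case (Suc m)
        have "\<forall>\<^sub>F s in nhds t. (deriv ^^ m) (\<lambda>t. f1 (?l t)) s = d m (?l s)"
          using Suc.IH eventually_nhds_in_open[OF opS Suc.prems] by (auto elim: eventually_mono)
        then have "(deriv ^^ Suc m) (\<lambda>t. f1 (?l t)) t = deriv (\<lambda>s. d m (?l s)) t"
          by (simp add: deriv_cong_ev)
        then show ?case using dline[OF sub[OF Suc.prems]] by (simp add: DERIV_imp_deriv)
      qed
      have z0: "0 \<in> ?S" and zp1: "z + e \<in> ball p1 \<delta>'"
        using z by (auto simp: \<delta>_def e_def dist_norm algebra_simps)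
      have "f1 (?l 1) = 0"
      proof (rule holomorphic_fun_eq_0_on_connected[OF _ opS conS _ z0, where f = "\<lambda>t. f1 (?l t)" and w = 1])
        show "(\<lambda>t. f1 (?l t)) holomorphic_on ?S"
          by (rule cholomorphic_on_holomorphic_line[OF hol1 sub])
        show "(deriv ^^ n) (\<lambda>t. f1 (?l t)) 0 = 0" for n using der[OF z0] dz by simp
        show "1 \<in> ?S" using zp1 \<delta>'(2) by auto
      qed
      then show False using zp1 \<delta>'(2) by auto
    qed
    \<comment> \<open>\<open>m\<close> becomes the least vanishing order of \<open>f1\<close> along
      \<open>e\<close> on \<open>T\<close> near \<open>p\<close>, attained at \<open>q\<close>; so
      all derivatives of lower order vanish on the whole of \<open>T\<close> near \<open>p\<close>.
      It is positive because \<open>f1\<close> vanishes on \<open>T\<close>.\<close>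
    define Q where "Q m \<longleftrightarrow> (\<exists>q\<in>T \<inter> ball p \<delta>. d m q \<noteq> 0)" for m
    define m where "m = (LEAST m. Q m)"
    have "\<exists>m. Q m" using fin[of p] pT \<delta>(1) unfolding Q_def by (metis IntI centre_in_ball)
    then have "Q m" unfolding m_def by (rule LeastI_ex)
    then obtain q where q: "q \<in> T" "q \<in> ball p \<delta>" "d m q \<noteq> 0" unfolding Q_def by blast
    have low: "d j x = 0" if "x \<in> T" "x \<in> ball p \<delta>" "j < m" for x j
      using not_less_Least[of j Q] that unfolding m_def Q_def by blast
    have "d 0 q = 0" using q(1) T_sub ZW f1(1) unfolding d0 T_def by blast
    then obtain n where m: "m = Suc n" using q(3) by (metis not0_implies_Suc)
    define h where "h = d n"
    have holh: "cholomorphic_on h W" unfolding h_def by (rule hold)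
    \<comment> \<open>A coordinate change that moves points along \<open>e\<close> only and makes
      \<open>h\<close> the \<open>k\<close>-th coordinate. Its derivative at \<open>q\<close> is
      injective because \<open>h\<close> has the derivative \<open>d m q\<close> along
      \<open>e\<close>, which is not 0.\<close>
    define \<Phi> where "\<Phi> z = z + ((h z - z $ k) / e $ k) *s e" for z
    have \<Phi>k: "\<Phi> z $ k = h z" for z using k by (simp add: \<Phi>_def)
    have qW: "q \<in> W" using q \<delta> by blast
    have hol\<Phi>: "cholomorphic_map_on \<Phi> (ball p \<delta>)"
      unfolding \<Phi>_def by (auto intro!: cholomorphic_intros cholomorphic_on_subset[OF holh] \<delta>(2) simp: k)
    let ?dh = "frechet_derivative h (at q)"
    let ?\<Phi>' = "\<lambda>v. v + ((?dh v - v $ k) / e $ k) *s e"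
    have "(\<Phi> has_derivative ?\<Phi>') (at q)"
    proof (rule has_derivative_vec_lambda)
      fix i
      note [derivative_intros] = cholomorphic_onD(1)[OF holh qW]
        bounded_linear_imp_has_derivative[OF bounded_linear_vec_nth]
      show "((\<lambda>z. \<Phi> z $ i) has_derivative (\<lambda>v. ?\<Phi>' v $ i)) (at q)"
        unfolding \<Phi>_def using k by (auto intro!: derivative_eq_intros simp: fun_eq_iff field_simps)
    qed
    moreover have "v = 0" if v: "?\<Phi>' v = 0" for v
    proof -
      define s where "s = - ((?dh v - v $ k) / e $ k)"
      have vs: "v = s *s e" using v by (simp add: s_def vec_eq_iff add_eq_0_iff)
      have "?dh v = s * d m q" unfolding vs m dSuc h_def by (simp add: cholomorphic_onD(2)[OF hold qW])
      moreover have "v $ k = s * e $ k" using vs by simp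
      moreover have "s * e $ k = v $ k - ?dh v" using k by (simp add: s_def)
      ultimately have "s * d m q = 0" by simp
      then show ?thesis using q(3) vs by simp
    qed
    ultimately obtain V where V: "q \<in> V" "V \<subseteq> ball p \<delta>" "biholomorphic_on \<Phi> V"
      using local_biholomorphism[OF open_ball q(2) hol\<Phi>] by blast
    note bV = V(3)[unfolded biholomorphic_on_def]
    let ?\<Psi> = "inv_into V \<Phi>"
    have \<Psi>\<Phi>: "?\<Psi> (\<Phi> x) = x" if "x \<in> V" for x using bV that by (simp add: inv_into_f_f)
    have cont\<Psi>: "continuous_on (\<Phi> ` V) ?\<Psi>" using bV cholomorphic_map_on_imp_continuous_on by blast
    have h0: "h x = 0" if "x \<in> T \<inter> V" for x
      using low[of x n] that V(2) unfolding h_def m by blast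
    define T' where "T' = \<Phi> ` (T \<inter> V)"
    have VW: "V \<subseteq> W" using V(2) \<delta>(2) by blast
    have diff: "\<Phi> ` V - T' = \<Phi> ` (V - T)" using bV unfolding T'_def inj_on_def by blast
    have "open (V - T)" using opWT bV VW by (metis Diff_Int_distrib Int_Diff inf.absorb_iff1 open_Int)
    then have opT': "open (\<Phi> ` V - T')"
      unfolding diff using biholomorphic_on_subset[OF V(3), of "V - T"] unfolding biholomorphic_on_def by blast
    show False
    proof (cases "\<forall>\<epsilon>>0. \<exists>w. dist w (\<Phi> q) < \<epsilon> \<and> w $ k = 0 \<and> w \<notin> T'")
      case True
      have "\<exists>r>0. \<exists>F. ball (\<Phi> q) r \<subseteq> \<Phi> ` V \<and> cholomorphic_on F (ball (\<Phi> q) r) \<and>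
          (\<forall>w\<in>ball (\<Phi> q) r - T'. F w = fx (?\<Psi> w))"
      proof (rule Hartogs_hyperplane[OF _ _ opT'])
        show "cholomorphic_on (\<lambda>w. fx (?\<Psi> w)) (\<Phi> ` V - T')"
          unfolding diff
        proof (rule cholomorphic_on_compose[OF holfx])
          show "cholomorphic_map_on ?\<Psi> (\<Phi> ` (V - T))"
            by (rule cholomorphic_map_on_subset[of _ "\<Phi> ` V"]) (use bV in auto)
          show "?\<Psi> ` \<Phi> ` (V - T) \<subseteq> W - T" using \<Psi>\<Phi> VW by auto
        qed
        show "w $ k = 0" if "w \<in> T'" for w using that h0 \<Phi>k unfolding T'_def by auto
        show "\<Phi> q $ k = 0" using h0 \<Phi>k q(1) V(1) by auto
      qed (use bV V(1) True in auto)
      then obtain r F where F: "r > 0" "ball (\<Phi> q) r \<subseteq> \<Phi> ` V" "cholomorphic_on F (ball (\<Phi> q) r)"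
        "\<And>w. w \<in> ball (\<Phi> q) r - T' \<Longrightarrow> F w = fx (?\<Psi> w)" by blast
      have "open (V \<inter> \<Phi> -` ball (\<Phi> q) r)"
        using bV cholomorphic_map_on_imp_continuous_on by (intro continuous_open_preimage) auto
      then obtain s where s: "s > 0" "ball q s \<subseteq> V \<inter> \<Phi> -` ball (\<Phi> q) r"
        using V(1) F(1) openE by (metis IntI centre_in_ball vimageI)
      have "E q s (\<lambda>x. F (\<Phi> x))"
        unfolding E_def
      proof (intro conjI ballI)
        show "cholomorphic_on (\<lambda>x. F (\<Phi> x)) (ball q s)"
        proof (rule cholomorphic_on_compose[OF F(3)])
          show "cholomorphic_map_on \<Phi> (ball q s)"
            by (rule cholomorphic_map_on_subset[of _ V]) (use s bV in auto)
          show "\<Phi> ` ball q s \<subseteq> ball (\<Phi> q) r" using s by auto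
        qed
        fix w assume w: "w \<in> ball q s - Z"
        then have "\<Phi> w \<in> ball (\<Phi> q) r - T'" using s diff T_sub by blast
        moreover have "w \<in> V" using w s by auto
        ultimately show "F (\<Phi> w) = f w" using F(4) \<Psi>\<Phi> fxf w VW by auto
      qed (use s VW in auto)
      then show False using q(1) by (auto simp: T_def)
    next
      case False
      then obtain \<epsilon> where \<epsilon>: "\<epsilon> > 0" "\<And>w. dist w (\<Phi> q) < \<epsilon> \<Longrightarrow> w $ k = 0 \<Longrightarrow> w \<in> T'" by blast
      \<comment> \<open>Near \<open>q\<close>, \<open>c\<close> bounds \<open>d m\<close> from below
        and \<open>B\<close> bounds \<open>d (Suc m)\<close> from above.\<close>
      define c where "c = norm (d m q) / 2"
      define B where "B = norm (d (Suc m) q) + 1"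
      have cB: "c > 0" "B > 0" using q(3) norm_ge_zero[of "d (Suc m) q"] by (simp_all add: c_def B_def add_nonneg_pos)
      have opV: "open V" using bV by blast
      have cont: "continuous_on V (d j)" for j
        using cholomorphic_on_imp_continuous_on[OF hold] VW continuous_on_subset by blast
      define O1 where "O1 = (V \<inter> (\<lambda>x. norm (d m x)) -` {c<..}) \<inter> (V \<inter> (\<lambda>x. norm (d (Suc m) x)) -` {..<B})"
      have "open O1" unfolding O1_def
        by (intro open_Int continuous_open_preimage continuous_intros cont opV open_greaterThan open_lessThan)
      moreover have "q \<in> O1"
        using V(1) q(3) by (simp add: O1_def c_def B_def)
      ultimately obtain \<eta>' where \<eta>': "\<eta>' > 0" "ball q \<eta>' \<subseteq> O1" by (rule openE)
      have \<eta>'V: "ball q \<eta>' \<subseteq> V" using \<eta>'(2) unfolding O1_def by blast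
      have \<eta>'cB: "c < norm (d m x) \<and> norm (d (Suc m) x) < B" if "x \<in> ball q \<eta>'" for x
        using subsetD[OF \<eta>'(2) that] by (simp add: O1_def)
      \<comment> \<open>Two points of \<open>ball q \<eta>\<close> that differ by
        \<open>s *s e\<close> satisfy \<open>B * norm s < c\<close>; this contradicts the Taylor
        estimate below unless \<open>s = 0\<close>.\<close>
      define \<eta> where "\<eta> = min \<eta>' (c * norm e / (2 * B))"
      have "\<eta> \<le> \<eta>'" "\<eta> \<le> c * norm e / (2 * B)" by (simp_all add: \<eta>_def)
      then have "ball q \<eta> \<subseteq> ball q \<eta>'" "2 * \<eta> * B \<le> c * norm e"
        using cB by (auto simp: subset_ball pos_le_divide_eq algebra_simps)
      moreover have "\<eta> > 0" using \<eta>'(1) cB \<open>e \<noteq> 0\<close> by (simp add: \<eta>_def)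
      ultimately have \<eta>: "\<eta> > 0" "ball q \<eta> \<subseteq> ball q \<eta>'" "2 * \<eta> * B \<le> c * norm e" by blast+
      \<comment> \<open>\<open>\<Phi> z\<close> pushed along \<open>e\<close> into the hyperplane.
        For \<open>z\<close> close to \<open>q\<close> it lands in \<open>T'\<close>, so
        \<open>z\<close> can be compared with a point \<open>z0\<close> of \<open>T\<close> on its
        own line in direction \<open>e\<close>.\<close>
      define \<pi> where "\<pi> z = \<Phi> z - (h z / e $ k) *s e" for z
      have \<pi>k: "\<pi> z $ k = 0" for z using k by (simp add: \<pi>_def \<Phi>k)
      have \<pi>q: "\<pi> q = \<Phi> q" using h0 q(1) V(1) by (simp add: \<pi>_def)
      have c\<Phi>: "continuous_on V \<Phi>" and ch: "continuous_on V h"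
        using bV cholomorphic_map_on_imp_continuous_on cont by (auto simp: h_def)
      have c\<pi>: "continuous_on V \<pi>" unfolding \<pi>_def by (intro continuous_intros c\<Phi> ch) (use k in auto)
      define N0 where "N0 = \<Phi> ` V \<inter> ball (\<Phi> q) \<epsilon> \<inter> (\<Phi> ` V \<inter> ?\<Psi> -` ball q \<eta>)"
      have opN0: "open N0" unfolding N0_def
        using bV by (intro open_Int open_ball continuous_open_preimage[OF cont\<Psi>]) auto
      have qN0: "\<Phi> q \<in> N0" using V(1) \<epsilon>(1) \<eta>(1) by (simp add: N0_def \<Psi>\<Phi>)
      define N where "N = (V \<inter> \<pi> -` N0) \<inter> (V \<inter> \<Phi> -` N0) \<inter> ball q \<eta>"
      have opN: "open N" unfolding N_def
        by (intro open_Int open_ball continuous_open_preimage c\<pi> c\<Phi> opV opN0)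
      have qN: "q \<in> N" using V(1) qN0 \<eta>(1) by (simp add: N_def \<pi>q)
      have NV: "N \<subseteq> V" by (auto simp: N_def)
      have "Z \<inter> N = {z\<in>N. \<Phi> z $ k = 0}"
      proof (intro equalityI subsetI)
        fix z assume z: "z \<in> {z\<in>N. \<Phi> z $ k = 0}"
        then have "\<Phi> z \<in> T'" by (intro \<epsilon>(2)) (auto simp: N_def N0_def dist_commute)
        then have "z \<in> T" using z NV bV unfolding T'_def inj_on_def by blast
        then show "z \<in> Z \<inter> N" using T_sub z by blast
      next
        fix z assume z: "z \<in> Z \<inter> N"
        have "\<pi> z \<in> T'" using z \<pi>k by (intro \<epsilon>(2)) (auto simp: N_def N0_def dist_commute)
        then obtain z0 where z0: "z0 \<in> T" "z0 \<in> V" "\<pi> z = \<Phi> z0" unfolding T'_def by blast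
        then have z0\<eta>: "z0 \<in> ball q \<eta>" using z \<Psi>\<Phi> by (auto simp: N_def N0_def)
        obtain s where s: "z = z0 + s *s e"
        proof
          show "z = z0 + ((h z0 - z0 $ k) / e $ k - (h z - z $ k) / e $ k + h z / e $ k) *s e"
            using z0(3) unfolding \<pi>_def \<Phi>_def
            by (simp add: vec_eq_iff algebra_simps)
        qed
        have f1z: "f1 z = 0" using z NV VW ZW f1(1) by blast
        let ?S = "(\<lambda>t. z0 + t *s e) -` ball q \<eta>"
        have lin: "z0 + ((1 - u) *\<^sub>R x + u *\<^sub>R y) *s e = (1 - u) *\<^sub>R (z0 + x *s e) + u *\<^sub>R (z0 + y *s e)" for x y u
          by (simp add: vec_eq_iff algebra_simps)
        have convS: "convex ?S"
          using convex_ball[of q \<eta>] unfolding convex_alt vimage_def mem_Collect_eq lin by blast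
        \<comment> \<open>Taylor expansion of \<open>f1\<close> from \<open>z0\<close> to
          \<open>z\<close> along \<open>e\<close>. The terms of order below \<open>m\<close> vanish
          because \<open>z0\<close> lies in \<open>T\<close>, so the zero of \<open>f1\<close> at
          \<open>z\<close> bounds the term of order \<open>m\<close> by the remainder.\<close>
        have "norm (d 0 (z0 + s *s e) - (\<Sum>i\<le>m. d i (z0 + 0 *s e) * (s - 0) ^ i / fact i))
            \<le> B * norm (s - 0) ^ Suc m / fact m"
        proof (rule complex_Taylor[OF convS, where f = "\<lambda>i t. d i (z0 + t *s e)"])
          show "((\<lambda>t. d i (z0 + t *s e)) has_field_derivative d (Suc i) (z0 + x *s e)) (at x within ?S)"
            if "x \<in> ?S" for i x
          proof (rule DERIV_subset[OF dline])
            show "z0 + x *s e \<in> W" using that \<eta>(2) \<eta>'V VW by blast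
          qed simp
          show "norm (d (Suc m) (z0 + x *s e)) \<le> B" if "x \<in> ?S" for x
            using that \<eta>(2) \<eta>'cB less_imp_le by blast
          show "s \<in> ?S" using z by (simp add: N_def s)
          show "0 \<in> ?S" using z0\<eta> by simp
        qed
        moreover have "(\<Sum>i\<le>m. d i (z0 + 0 *s e) * (s - 0) ^ i / fact i) = d m z0 * s ^ m / fact m"
        proof -
          have "(\<Sum>i\<le>m. d i (z0 + 0 *s e) * (s - 0) ^ i / fact i) =
              (\<Sum>i\<in>{m}. d i (z0 + 0 *s e) * (s - 0) ^ i / fact i)"
            by (rule sum.mono_neutral_right) (use low[OF z0(1)] z0(2) V(2) in auto)
          then show ?thesis by simp
        qed
        ultimately have T: "norm (d m z0) * norm s ^ m / fact m \<le> B * norm s ^ Suc m / fact m"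
          using f1z unfolding d0 s by (simp add: norm_mult norm_divide norm_power)
        have "s = 0"
        proof (rule ccontr)
          assume s0: "s \<noteq> 0"
          have "norm (d m z0) \<le> B * norm s"
            using T s0 by (simp add: divide_le_cancel field_simps)
          moreover have "c < norm (d m z0)" using \<eta>'cB z0\<eta> \<eta>(2) by blast
          moreover have "norm s * norm e < 2 * \<eta>"
          proof -
            have "norm s * norm e = dist z z0" by (simp add: s dist_norm norm_vector_smult)
            also have "\<dots> < 2 * \<eta>" using z z0\<eta> dist_triangle_half_r[of q z "2 * \<eta>" z0] by (simp add: N_def)
            finally show ?thesis .
          qed
          then have "B * (norm s * norm e) < c * norm e" using \<eta>(3) cB by (smt (verit) mult.commute mult_strict_left_mono)
          then have "B * norm s < c" using \<open>e \<noteq> 0\<close> by (simp add: mult.assoc[symmetric])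
          ultimately show False by linarith
        qed
        then have "z = z0" using s by simp
        then show "z \<in> {z\<in>N. \<Phi> z $ k = 0}" using h0 z0 z \<Phi>k by auto
      qed
      moreover have "biholomorphic_on \<Phi> N" by (rule biholomorphic_on_subset[OF V(3) opN NV])
      ultimately have "Z \<inter> N = {}" using noreg NV VW by blast
      then show False using qN q(1) T_sub by blast
    qed
  qed
  then show ?thesis using p unfolding T_def E_def by blast
qed

section \<open>Rectification of holomorphic vector fields\<close>

text \<open>By Osgood's lemma it suffices to look at each coordinate line, where this is the theorem
  of Weierstrass.\<close>

lemma cholomorphic_on_uniform_limit:
  fixes f :: "nat \<Rightarrow> complex^'n \<Rightarrow> complex"
  assumes U: "open U" and hol: "\<And>n. cholomorphic_on (f n) U"
    and lim: "uniform_limit U f g sequentially"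
  shows "cholomorphic_on g U"
proof (rule Osgood[OF U])
  show "continuous_on U g"
    by (rule uniform_limit_theorem[OF _ lim])
      (auto intro!: always_eventually cholomorphic_on_imp_continuous_on hol)
  fix z i assume z: "z \<in> U"
  obtain r where r: "r > 0" "cball z r \<subseteq> U" using U z open_contains_cball by blast
  have sub: "z + t *s axis i 1 \<in> U" if "t \<in> cball 0 r" for t
    using that by (intro subsetD[OF r(2)]) (simp add: dist_norm norm_vector_smult norm_axis_complex)
  have "(\<lambda>t. g (z + t *s axis i 1)) holomorphic_on ball 0 r"
  proof (rule holomorphic_uniform_limit[where z = 0 and r = r and f = "\<lambda>n t. f n (z + t *s axis i 1)" and g = "\<lambda>t. g (z + t *s axis i 1)" and F = sequentially])
    show "\<forall>\<^sub>F n in sequentially. continuous_on (cball 0 r) (\<lambda>t. f n (z + t *s axis i 1)) \<and>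
        (\<lambda>t. f n (z + t *s axis i 1)) holomorphic_on ball 0 r"
    proof (intro always_eventually allI conjI)
      fix n
      have "(\<lambda>t. f n (z + t *s axis i 1)) holomorphic_on cball 0 r"
        by (rule cholomorphic_on_holomorphic_line[OF hol sub])
      then show "continuous_on (cball 0 r) (\<lambda>t. f n (z + t *s axis i 1))"
        "(\<lambda>t. f n (z + t *s axis i 1)) holomorphic_on ball 0 r"
        using holomorphic_on_imp_continuous_on holomorphic_on_subset ball_subset_cball by blast+
    qed
    show "uniform_limit (cball 0 r) (\<lambda>n t. f n (z + t *s axis i 1)) (\<lambda>t. g (z + t *s axis i 1)) sequentially"
      by (rule uniform_limit_compose'[OF lim]) (use sub in auto)
  qed auto
  then show "(\<lambda>t. g (z + t *s axis i 1)) field_differentiable at 0"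
    using r(1) by (meson centre_in_ball holomorphic_on_imp_differentiable_at open_ball)
qed

text \<open>The primitive of \<open>g\<close> along the \<open>j\<close>-th coordinate that vanishes where this coordinate does.\<close>

definition line_primitive :: "'n \<Rightarrow> (complex^'n \<Rightarrow> complex^'n) \<Rightarrow> complex^'n \<Rightarrow> complex^'n" where
  "line_primitive j g w = (w $ j) *s integral {0..1} (\<lambda>s. g (w + ((of_real s - 1) * w $ j) *s axis j 1))"

text \<open>The path only multiplies the \<open>j\<close>-th coordinate by \<open>s\<close>, so no
  coordinate grows in modulus.\<close>

lemma line_primitive_segment:
  fixes w :: "complex^'n"
  assumes "w \<in> ball 0 \<delta>" "s \<in> {0..1}"
  shows "w + ((of_real s - 1) * w $ j) *s axis j 1 \<in> ball 0 \<delta>"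
proof -
  have "norm ((w + ((of_real s - 1) * w $ j) *s axis j 1) $ i) \<le> norm (w $ i)" for i
  proof (cases "i = j")
    case True
    have "(w + ((of_real s - 1) * w $ j) *s axis j 1) $ i = of_real s * w $ i"
      using True by (simp add: algebra_simps)
    then show ?thesis using assms(2) by (simp add: norm_mult mult_left_le_one_le)
  qed (simp add: axis_def)
  then have "norm (w + ((of_real s - 1) * w $ j) *s axis j 1) \<le> norm w"
    unfolding norm_vec_def by (intro L2_set_mono) auto
  then show ?thesis using assms(1) by simp
qed

lemma line_primitive_continuous_segment:
  fixes g :: "complex^'n \<Rightarrow> 'b::topological_space"
  assumes "continuous_on (ball 0 \<delta>) g" "w \<in> ball 0 \<delta>"
  shows "continuous_on {0..1} (\<lambda>s. g (w + ((of_real s - 1) * w $ j) *s axis j 1))"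
  by (rule continuous_on_compose2[OF assms(1)])
    (use line_primitive_segment[OF assms(2)] in \<open>auto intro!: continuous_intros\<close>)

lemma line_primitive_nth:
  fixes g :: "complex^'n \<Rightarrow> complex^'n"
  assumes "continuous_on (ball 0 \<delta>) g" "w \<in> ball 0 \<delta>"
  shows "line_primitive j g w $ i =
    w $ j * integral {0..1} (\<lambda>s. g (w + ((of_real s - 1) * w $ j) *s axis j 1) $ i)"
proof -
  have "(\<lambda>s. g (w + ((of_real s - 1) * w $ j) *s axis j 1)) integrable_on {0..1}"
    using line_primitive_continuous_segment[OF assms] by (rule integrable_continuous_real)
  from integral_linear[OF this bounded_linear_vec_nth]
  show ?thesis unfolding line_primitive_def by (simp add: o_def)
qed

lemma cholomorphic_map_on_line_primitive:
  fixes g :: "complex^'n \<Rightarrow> complex^'n"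
  assumes g: "cholomorphic_map_on g (ball 0 \<delta>)"
  shows "cholomorphic_map_on (line_primitive j g) (ball 0 \<delta>)"
proof (rule cholomorphic_map_onI)
  fix i
  have c: "continuous_on (ball 0 \<delta>) g" by (rule cholomorphic_map_on_imp_continuous_on[OF g])
  have "cholomorphic_on (\<lambda>w. integral (cbox 0 1) (\<lambda>s. g (w + ((of_real s - 1) * w $ j) *s axis j 1) $ i)) (ball 0 \<delta>)"
  proof (rule cholomorphic_on_integral[OF open_ball])
    have "continuous_on (ball 0 \<delta> \<times> cbox 0 1) (\<lambda>x. g (fst x + ((of_real (snd x) - 1) * fst x $ j) *s axis j 1))"
      by (rule continuous_on_compose2[OF c])
        (use line_primitive_segment[where 'n = 'n] in \<open>auto intro!: continuous_intros\<close>)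
    then show "continuous_on (ball 0 \<delta> \<times> cbox 0 1) (\<lambda>(w, s). g (w + ((of_real s - 1) * w $ j) *s axis j 1) $ i)"
      unfolding case_prod_unfold by (rule continuous_on_component)
    fix s :: real assume "s \<in> cbox 0 1"
    then show "cholomorphic_on (\<lambda>w. g (w + ((of_real s - 1) * w $ j) *s axis j 1) $ i) (ball 0 \<delta>)"
      by (intro cholomorphic_on_compose[OF cholomorphic_on_component[OF g]])
        (use line_primitive_segment[of _ \<delta> s] in \<open>auto intro!: cholomorphic_intros\<close>)
  qed
  then have *: "cholomorphic_on (\<lambda>w. w $ j * integral {0..1} (\<lambda>s. g (w + ((of_real s - 1) * w $ j) *s axis j 1) $ i)) (ball 0 \<delta>)"
    by (auto intro!: cholomorphic_intros)
  show "cholomorphic_on (\<lambda>w. line_primitive j g w $ i) (ball 0 \<delta>)"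
    by (rule cholomorphic_on_cong[OF open_ball *]) (simp add: line_primitive_nth[OF c])
qed

text \<open>The factor \<open>norm w\<close> is what makes the Picard iteration contract on a small
  ball.\<close>

lemma norm_line_primitive_le:
  fixes g :: "complex^'n \<Rightarrow> complex^'n"
  assumes c: "continuous_on (ball 0 \<delta>) g" and w: "w \<in> ball 0 \<delta>"
    and B: "\<And>u. u \<in> ball 0 \<delta> \<Longrightarrow> norm (g u) \<le> B"
  shows "norm (line_primitive j g w) \<le> norm w * B"
proof -
  have "norm (integral {0..1} (\<lambda>s. g (w + ((of_real s - 1) * w $ j) *s axis j 1))) \<le> B * (1 - 0)"
    by (rule integral_bound[OF _ line_primitive_continuous_segment[OF c w]])
      (use B line_primitive_segment[OF w] in auto)
  moreover have "norm (w $ j) \<le> norm w" by (rule Finite_Cartesian_Product.norm_nth_le)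
  ultimately show ?thesis unfolding line_primitive_def norm_vector_smult
    by (intro mult_mono) auto
qed

lemma line_primitive_diff:
  fixes g :: "complex^'n \<Rightarrow> complex^'n"
  assumes "continuous_on (ball 0 \<delta>) g" "continuous_on (ball 0 \<delta>) h" and w: "w \<in> ball 0 \<delta>"
  shows "line_primitive j (\<lambda>u. g u - h u) w = line_primitive j g w - line_primitive j h w"
proof -
  note int = integrable_continuous_real[OF line_primitive_continuous_segment[OF _ w, of _ j]]
  show ?thesis
    unfolding line_primitive_def integral_diff[OF int[OF assms(1)] int[OF assms(2)]]
    by (simp add: vec_eq_iff algebra_simps)
qed

text \<open>On a line in direction \<open>j\<close> the integral is a contour integral over a
  segment starting at height 0, that is, a difference of values of a holomorphic primitive
  \<open>\<Gamma>\<close>.\<close>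

lemma line_primitive_derivative:
  fixes g :: "complex^'n \<Rightarrow> complex^'n"
  assumes g: "cholomorphic_map_on g (ball 0 \<delta>)" and w: "w \<in> ball 0 \<delta>"
  shows "frechet_derivative (line_primitive j g) (at w) (axis j 1) = g w"
proof -
  let ?e = "axis j 1 :: complex^'n"
  have c: "continuous_on (ball 0 \<delta>) g" by (rule cholomorphic_map_on_imp_continuous_on[OF g])
  have I: "cholomorphic_map_on (line_primitive j g) (ball 0 \<delta>)"
    by (rule cholomorphic_map_on_line_primitive[OF g])
  have "frechet_derivative (line_primitive j g) (at w) ?e $ i = g w $ i" for i
  proof -
    define w' where "w' = w - (w $ j) *s ?e"
    have w'j: "w' $ j = 0" by (simp add: w'_def)
    have ww': "w = w' + (w $ j) *s ?e" by (simp add: w'_def)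
    let ?S = "(\<lambda>t. w' + t *s ?e) -` ball 0 \<delta>"
    have lin: "w' + ((1 - u) *\<^sub>R x + u *\<^sub>R y) *s ?e = (1 - u) *\<^sub>R (w' + x *s ?e) + u *\<^sub>R (w' + y *s ?e)" for x y u
      by (simp add: vec_eq_iff algebra_simps)
    have convS: "convex ?S"
      using convex_ball[of 0 \<delta>] unfolding convex_alt vimage_def mem_Collect_eq lin by blast
    have opS: "open ?S" by (intro open_vimage open_ball continuous_intros)
    have wS: "w $ j \<in> ?S" using w ww' by simp
    have 0: "0 \<in> ?S" using line_primitive_segment[OF w, of 0 j] by (simp add: w'_def)
    let ?\<gamma> = "\<lambda>t. g (w' + t *s ?e) $ i"
    have hol\<gamma>: "?\<gamma> holomorphic_on ?S"
      by (rule cholomorphic_on_holomorphic_line[OF cholomorphic_on_component[OF g]]) auto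
    obtain \<Gamma> where \<Gamma>': "\<And>t. t \<in> ?S \<Longrightarrow> (\<Gamma> has_field_derivative ?\<gamma> t) (at t within ?S)"
      using holomorphic_convex_primitive'[OF convS opS hol\<gamma>] by blast
    have \<Gamma>: "(\<Gamma> has_field_derivative ?\<gamma> t) (at t)" if "t \<in> ?S" for t
      using \<Gamma>'[OF that] at_within_open[OF that opS] by simp
    have eq: "line_primitive j g (w' + t *s ?e) $ i = \<Gamma> t - \<Gamma> 0" if t: "t \<in> ?S" for t
    proof -
      have seg: "closed_segment 0 t \<subseteq> ?S" using convS 0 t by (rule closed_segment_subset[rotated 2])
      have "(?\<gamma> has_contour_integral (\<Gamma> t - \<Gamma> 0)) (linepath 0 t)"
        using contour_integral_primitive[of ?S \<Gamma> ?\<gamma> "linepath 0 t"] \<Gamma> seg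
        by (simp add: has_field_derivative_at_within)
      then have "((\<lambda>s. ?\<gamma> (linepath 0 t s) * (t - 0)) has_integral (\<Gamma> t - \<Gamma> 0)) {0..1}"
        by (simp only: has_contour_integral_linepath)
      then have "integral {0..1} (\<lambda>s. t * ?\<gamma> (of_real s * t)) = \<Gamma> t - \<Gamma> 0"
        by (intro integral_unique) (simp add: linepath_def scaleR_conv_of_real mult.commute)
      then have "t * integral {0..1} (\<lambda>s. ?\<gamma> (of_real s * t)) = \<Gamma> t - \<Gamma> 0" by simp
      moreover have *: "w' + t *s ?e + ((of_real s - 1) * (w' + t *s ?e) $ j) *s ?e = w' + (of_real s * t) *s ?e" for s
        by (simp add: vec_eq_iff w'j algebra_simps)
      moreover have "(w' + t *s ?e) $ j = t" by (simp add: w'j)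
      moreover have "w' + t *s ?e \<in> ball 0 \<delta>" using t by simp
      ultimately show ?thesis
        using line_primitive_nth[OF c, of "w' + t *s ?e" j i] by (simp only: *)
    qed
    have A: "((\<lambda>t. line_primitive j g (w' + t *s ?e) $ i) has_field_derivative
        frechet_derivative (\<lambda>w. line_primitive j g w $ i) (at (w' + (w $ j) *s ?e)) ?e) (at (w $ j))"
      by (rule cholomorphic_on_has_field_derivative_line[OF cholomorphic_on_component[OF I]])
        (use wS in auto)
    have "((\<lambda>t. \<Gamma> t - \<Gamma> 0) has_field_derivative ?\<gamma> (w $ j)) (at (w $ j))"
      by (auto intro!: derivative_eq_intros \<Gamma>[OF wS])
    then have "((\<lambda>t. line_primitive j g (w' + t *s ?e) $ i) has_field_derivative ?\<gamma> (w $ j)) (at (w $ j))"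
      by (rule has_field_derivative_transform_within_open[OF _ opS wS]) (simp add: eq)
    from DERIV_unique[OF A this] show ?thesis
      using ww' cholomorphic_map_onD(3)[OF I w] by simp
  qed
  then show ?thesis by (simp add: vec_eq_iff)
qed

text \<open>The integral equation of the flow of \<open>X\<close>, with the \<open>j\<close>-th
  coordinate as complex time; in the application \<open>N\<close> kills the \<open>j\<close>-th
  axis, and \<open>p + N w\<close> is the initial value. All iterates are holomorphic in all
  variables, so their uniform limit is holomorphic in time and initial value together.\<close>

lemma picard_fixed_point:
  fixes X :: "complex^'n \<Rightarrow> complex^'n" and N :: "complex^'n \<Rightarrow> complex^'n"
  assumes U: "open U" "p \<in> U" and X: "cholomorphic_map_on X U"
    and N: "bounded_linear N" "\<And>a v. N (a *s v) = a *s N v"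
  obtains \<delta> G where "\<delta> > 0" "cholomorphic_map_on G (ball 0 \<delta>)" "G ` ball 0 \<delta> \<subseteq> U"
    "\<And>w. w \<in> ball 0 \<delta> \<Longrightarrow> G w = p + N w + line_primitive j (\<lambda>u. X (G u)) w"
proof -
  obtain r where r: "r > 0" "cball p r \<subseteq> U" using U open_contains_cball by blast
  define X' where "X' x = Blinfun (frechet_derivative X (at x))" for x
  have X': "blinfun_apply (X' x) = frechet_derivative X (at x)" if "x \<in> U" for x
    unfolding X'_def by (rule cholomorphic_map_on_blinfun_derivative(1)[OF U(1) X that])
  have contX': "continuous_on U X'"
    using cholomorphic_map_on_blinfun_derivative(2)[OF U(1) X] by (simp add: X'_def[abs_def])
  have contX: "continuous_on U X" by (rule cholomorphic_map_on_imp_continuous_on[OF X])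
  obtain L where L: "\<And>x. x \<in> cball p r \<Longrightarrow> norm (X' x) \<le> L"
    using continuous_on_compact_bound[OF compact_cball continuous_on_subset[OF contX' r(2)]] by blast
  obtain K where K: "\<And>x. x \<in> cball p r \<Longrightarrow> norm (X x) \<le> K"
    using continuous_on_compact_bound[OF compact_cball continuous_on_subset[OF contX r(2)]] by blast
  have L0: "0 \<le> L" and K0: "0 \<le> K"
    using L[of p] K[of p] r(1) norm_ge_zero order_trans by (metis centre_in_cball less_imp_le)+
  have lip: "norm (X x - X y) \<le> L * norm (x - y)" if "x \<in> cball p r" "y \<in> cball p r" for x y
  proof (rule differentiable_bound[OF convex_cball _ _ that])
    fix z assume z: "z \<in> cball p r"
    then show "(X has_derivative frechet_derivative X (at z)) (at z within cball p r)"
      using cholomorphic_map_onD(1)[OF X] r(2) by (meson has_derivative_at_withinI subsetD)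
    show "onorm (frechet_derivative X (at z)) \<le> L"
      using L[OF z] X' z r(2) by (metis norm_blinfun.rep_eq subsetD)
  qed
  obtain C where C: "C > 0" "\<And>v. norm (N v) \<le> norm v * C"
    using bounded_linear.pos_bounded[OF N(1)] by blast
  \<comment> \<open>The first bound keeps the iterates in \<open>cball p r\<close>, as
    \<open>norm (N w) + norm w * K\<close> is at most \<open>\<delta> * (C + K)\<close>; the second
    makes every step contract by the factor 1/2.\<close>
  define \<delta> where "\<delta> = min (r / (C + K)) (1 / (2 * (L + 1)))"
  have \<delta>: "\<delta> > 0" "\<delta> * (C + K) \<le> r" "\<delta> * L \<le> 1 / 2"
  proof -
    show "\<delta> > 0" using r C(1) K0 L0 by (simp add: \<delta>_def)
    have "\<delta> \<le> r / (C + K)" "\<delta> \<le> 1 / (2 * (L + 1))" by (simp_all add: \<delta>_def)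
    then show "\<delta> * (C + K) \<le> r" using C(1) K0 by (simp add: pos_le_divide_eq)
    have "\<delta> * (2 * (L + 1)) \<le> 1" using \<open>\<delta> \<le> 1 / (2 * (L + 1))\<close> L0 by (simp add: pos_le_divide_eq)
    then show "\<delta> * L \<le> 1 / 2" using \<open>\<delta> > 0\<close> by (simp add: algebra_simps)
  qed
  let ?D = "ball (0::complex^'n) \<delta>"
  define step where "step G w = p + N w + line_primitive j (\<lambda>u. X (G u)) w" for G w
  define G where "G n = (step ^^ n) (\<lambda>_. p)" for n
  have G0: "G 0 w = p" and GSuc: "G (Suc n) w = p + N w + line_primitive j (\<lambda>u. X (G n u)) w" for n w
    by (simp_all add: G_def step_def)
  have holN: "cholomorphic_map_on N S" for S
    by (rule cholomorphic_map_on_has_derivativeI[OF bounded_linear_imp_has_derivative[OF N(1)]]) (rule N(2))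
  have inv: "cholomorphic_map_on (G n) ?D \<and> G n ` ?D \<subseteq> cball p r" for n
  proof (induction n)
    case 0 then show ?case using r by (auto simp: G0[abs_def] intro!: cholomorphic_intros)
  next
    case (Suc n)
    have XG: "cholomorphic_map_on (\<lambda>u. X (G n u)) ?D"
      by (rule cholomorphic_map_on_compose[OF X]) (use Suc r(2) in auto)
    have "cholomorphic_map_on (G (Suc n)) ?D"
      unfolding GSuc[abs_def]
      using cholomorphic_on_component[OF holN]
        cholomorphic_on_component[OF cholomorphic_map_on_line_primitive[OF XG, of j]]
      by (intro cholomorphic_map_onI)
        (simp only: vector_add_component, intro cholomorphic_on_add cholomorphic_on_const)
    moreover have "G (Suc n) w \<in> cball p r" if w: "w \<in> ?D" for w
    proof -
      have "norm (line_primitive j (\<lambda>u. X (G n u)) w) \<le> norm w * K"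
        by (rule norm_line_primitive_le[OF cholomorphic_map_on_imp_continuous_on[OF XG] w])
          (use Suc K in blast)
      then have "norm (N w + line_primitive j (\<lambda>u. X (G n u)) w) \<le> norm w * (C + K)"
        using C(2)[of w] by (intro norm_triangle_le) (simp add: algebra_simps)
      also have "\<dots> \<le> r"
        using w C(1) K0 \<delta>(2) by (intro order_trans[OF mult_right_mono \<delta>(2)]) auto
      finally have "dist (G (Suc n) w) p \<le> r" by (simp add: GSuc dist_norm add.assoc)
      then show ?thesis by (simp add: dist_commute)
    qed
    ultimately show ?case by blast
  qed
  have hG: "cholomorphic_map_on (G n) ?D" and GU: "\<And>w. w \<in> ?D \<Longrightarrow> G n w \<in> cball p r" for n
    using inv[of n] by blast+
  have hXG: "cholomorphic_map_on (\<lambda>u. X (G n u)) ?D" for n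
    by (rule cholomorphic_map_on_compose[OF X hG]) (use GU r(2) in auto)
  have cXG: "continuous_on ?D (\<lambda>u. X (G n u))" for n
    by (rule cholomorphic_map_on_imp_continuous_on[OF hXG])
  have contr: "norm (line_primitive j (\<lambda>u. X (F u)) w - line_primitive j (\<lambda>u. X (H u)) w) \<le> B / 2"
    if "continuous_on ?D (\<lambda>u. X (F u))" "continuous_on ?D (\<lambda>u. X (H u))" "w \<in> ?D"
      and F: "\<And>u. u \<in> ?D \<Longrightarrow> F u \<in> cball p r" and H: "\<And>u. u \<in> ?D \<Longrightarrow> H u \<in> cball p r"
      and B: "\<And>u. u \<in> ?D \<Longrightarrow> norm (F u - H u) \<le> B" for F H w B
  proof -
    have B0: "0 \<le> B" using B[of w] that(3) norm_ge_zero order_trans by blast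
    have "norm (line_primitive j (\<lambda>u. X (F u) - X (H u)) w) \<le> norm w * (L * B)"
    proof (rule norm_line_primitive_le[OF _ that(3)])
      show "continuous_on ?D (\<lambda>u. X (F u) - X (H u))" by (intro continuous_intros that(1,2))
      show "norm (X (F u) - X (H u)) \<le> L * B" if "u \<in> ?D" for u
        using lip[OF F[OF that] H[OF that]] mult_left_mono[OF B[OF that] L0] by linarith
    qed
    also have "\<dots> \<le> \<delta> * (L * B)" using that(3) L0 B0 by (intro mult_right_mono) auto
    also have "\<dots> \<le> 1 / 2 * B" using mult_right_mono[OF \<delta>(3) B0] by (simp add: mult.assoc)
    finally show ?thesis by (simp add: line_primitive_diff[OF that(1,2,3)])
  qed
  have dG: "norm (G (Suc n) w - G n w) \<le> r * (1 / 2) ^ n" if "w \<in> ?D" for n w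
    using that
  proof (induction n arbitrary: w)
    case 0 then show ?case using GU[of w "Suc 0"] by (simp add: G0 dist_norm norm_minus_commute)
  next
    case (Suc n)
    have "G (Suc (Suc n)) w - G (Suc n) w =
        line_primitive j (\<lambda>u. X (G (Suc n) u)) w - line_primitive j (\<lambda>u. X (G n u)) w"
      by (simp add: GSuc)
    also have "norm \<dots> \<le> r * (1 / 2) ^ n / 2"
      by (rule contr[OF cXG cXG Suc.prems]) (use Suc.IH GU in auto)
    finally show ?case by simp
  qed
  \<comment> \<open>The limit of the iterates as a telescoping series, which converges uniformly by
    \<open>dG\<close>.\<close>
  define H where "H w = p + (\<Sum>n. G (Suc n) w - G n w)" for w
  have "uniform_limit ?D (\<lambda>n w. \<Sum>i<n. G (Suc i) w - G i w) (\<lambda>w. \<Sum>n. G (Suc n) w - G n w) sequentially"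
    by (rule Weierstrass_m_test[OF dG]) (auto intro!: summable_mult summable_geometric)
  then have "uniform_limit ?D (\<lambda>n w. p + (\<Sum>i<n. G (Suc i) w - G i w)) H sequentially"
    unfolding H_def by (intro uniform_limit_intros)
  moreover have "p + (\<Sum>i<n. G (Suc i) w - G i w) = G n w" for n w
    by (simp add: sum_lessThan_telescope[of "\<lambda>i. G i w"] G0)
  ultimately have lim: "uniform_limit ?D G H sequentially" by simp
  have lim_i: "uniform_limit ?D (\<lambda>n w. G n w $ i) (\<lambda>w. H w $ i) sequentially" for i
    using bounded_linear.uniform_limit[OF bounded_linear_vec_nth lim] .
  have holH: "cholomorphic_map_on H ?D"
    by (rule cholomorphic_map_onI[OF cholomorphic_on_uniform_limit[OF open_ball cholomorphic_on_component[OF hG] lim_i]])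
  have limw: "(\<lambda>n. G n w) \<longlonglongrightarrow> H w" if "w \<in> ?D" for w
    using tendsto_uniform_limitI[OF lim that] .
  have HU: "H w \<in> cball p r" if "w \<in> ?D" for w
    using closed_sequentially[OF closed_cball _ limw[OF that]] GU[OF that] by blast
  have cXH: "continuous_on ?D (\<lambda>u. X (H u))"
    by (rule cholomorphic_map_on_imp_continuous_on[OF cholomorphic_map_on_compose[OF X holH]])
      (use HU r(2) in auto)
  have "H w = p + N w + line_primitive j (\<lambda>u. X (H u)) w" if w: "w \<in> ?D" for w
  proof -
    have "(\<lambda>n. line_primitive j (\<lambda>u. X (G n u)) w) \<longlonglongrightarrow> line_primitive j (\<lambda>u. X (H u)) w"
      unfolding LIMSEQ_iff
    proof (intro allI impI)
      fix e :: real assume e: "e > 0"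
      obtain n0 where n0: "\<And>n u. n \<ge> n0 \<Longrightarrow> u \<in> ?D \<Longrightarrow> dist (G n u) (H u) < e"
        using uniform_limitD[OF lim e] unfolding eventually_sequentially by blast
      have "norm (line_primitive j (\<lambda>u. X (G n u)) w - line_primitive j (\<lambda>u. X (H u)) w) < e" if "n \<ge> n0" for n
      proof -
        have "norm (line_primitive j (\<lambda>u. X (G n u)) w - line_primitive j (\<lambda>u. X (H u)) w) \<le> e / 2"
          by (rule contr[OF cXG cXH w GU HU]) (use n0[OF that] in \<open>auto simp: dist_norm intro: less_imp_le\<close>)
        then show ?thesis using e by linarith
      qed
      then show "\<exists>no. \<forall>n\<ge>no. norm (line_primitive j (\<lambda>u. X (G n u)) w - line_primitive j (\<lambda>u. X (H u)) w) < e"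
        by blast
    qed
    then have "(\<lambda>n. G (Suc n) w) \<longlonglongrightarrow> p + N w + line_primitive j (\<lambda>u. X (H u)) w"
      unfolding GSuc by (intro tendsto_intros)
    then show ?thesis using LIMSEQ_unique LIMSEQ_Suc[OF limw[OF w]] by blast
  qed
  then show ?thesis using that[OF \<delta>(1) holH] HU r(2) by blast
qed

text \<open>\<open>G\<close> follows the flow of \<open>X\<close> from a hyperplane through
  \<open>p\<close> transverse to \<open>X p\<close>. Its derivative at 0 sends the
  \<open>j\<close>-th axis to \<open>X p\<close> and the complementary hyperplane isomorphically
  onto the directions of the transversal, so it is injective.\<close>

lemma flow_box:
  fixes X :: "complex^'n \<Rightarrow> complex^'n" and j :: 'n
  assumes U: "open U" "p \<in> U" and X: "cholomorphic_map_on X U" and nz: "X p \<noteq> 0"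
  obtains W G where "0 \<in> W" "biholomorphic_on G W" "G ` W \<subseteq> U" "G 0 = p"
    "\<And>w. w \<in> W \<Longrightarrow> frechet_derivative G (at w) (axis j 1) = X (G w)"
proof -
  obtain k where k: "X p $ k \<noteq> 0" using nz by (auto simp: vec_eq_iff)
  \<comment> \<open>Kills the \<open>j\<close>-th axis and carries the hyperplane
    \<open>v $ j = 0\<close> onto \<open>v $ k = 0\<close>, by exchanging the indices
    \<open>j\<close> and \<open>k\<close>; the image is transverse to \<open>X p\<close> because
    \<open>X p $ k\<close> is not 0.\<close>
  define N :: "complex^'n \<Rightarrow> complex^'n" where
    "N v = (\<chi> i. if i = k then 0 else v $ Transposition.transpose j k i)" for v
  have Nlin: "bounded_linear N"
    unfolding N_def by (rule linear_conv_bounded_linear[THEN iffD1]) (auto intro!: linearI simp: vec_eq_iff)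
  have Nsm: "N (a *s v) = a *s N v" for a v by (simp add: N_def vec_eq_iff)
  obtain \<delta> G where \<delta>: "\<delta> > 0" and hG: "cholomorphic_map_on G (ball 0 \<delta>)" and GU: "G ` ball 0 \<delta> \<subseteq> U"
    and G: "\<And>w. w \<in> ball 0 \<delta> \<Longrightarrow> G w = p + N w + line_primitive j (\<lambda>u. X (G u)) w"
    using picard_fixed_point[OF U X Nlin Nsm, where j = j] by blast
  have z: "(0::complex^'n) \<in> ball 0 \<delta>" using \<delta> by simp
  have G0: "G 0 = p" using G[OF z] by (simp add: N_def line_primitive_def vec_eq_iff)
  have XG: "cholomorphic_map_on (\<lambda>u. X (G u)) (ball 0 \<delta>)"
    by (rule cholomorphic_map_on_compose[OF X hG GU])
  have holI: "cholomorphic_map_on (line_primitive j (\<lambda>u. X (G u))) (ball 0 \<delta>)"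
    by (rule cholomorphic_map_on_line_primitive[OF XG])
  have dG: "frechet_derivative G (at w) v = N v + frechet_derivative (line_primitive j (\<lambda>u. X (G u))) (at w) v"
    if w: "w \<in> ball 0 \<delta>" for w v
  proof -
    have "((\<lambda>w. p + N w + line_primitive j (\<lambda>u. X (G u)) w) has_derivative
       (\<lambda>v. 0 + N v + frechet_derivative (line_primitive j (\<lambda>u. X (G u))) (at w) v)) (at w)"
      by (intro has_derivative_add has_derivative_const bounded_linear_imp_has_derivative[OF Nlin]
          cholomorphic_map_onD(1)[OF holI w])
    then have "(G has_derivative
       (\<lambda>v. 0 + N v + frechet_derivative (line_primitive j (\<lambda>u. X (G u))) (at w) v)) (at w)"
      by (rule has_derivative_transform_within_open[OF _ open_ball w]) (simp add: G)
    then show ?thesis by (simp add: frechet_derivative_at[symmetric])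
  qed
  have Ne: "N (axis j 1) = 0" by (auto simp: N_def vec_eq_iff axis_def Transposition.transpose_def)
  have flow: "frechet_derivative G (at w) (axis j 1) = X (G w)" if "w \<in> ball 0 \<delta>" for w
    unfolding dG[OF that] Ne line_primitive_derivative[OF XG that] by simp
  \<comment> \<open>The primitive vanishes identically on the hyperplane \<open>v $ j = 0\<close>,
    hence so do its derivatives at 0 in these directions.\<close>
  have d0: "frechet_derivative G (at 0) v = N v" if v: "v $ j = 0" for v
  proof -
    have "frechet_derivative (line_primitive j (\<lambda>u. X (G u))) (at 0) v $ i = 0" for i
    proof -
      have "((\<lambda>t. line_primitive j (\<lambda>u. X (G u)) (0 + t *s v) $ i) has_field_derivative
          frechet_derivative (\<lambda>w. line_primitive j (\<lambda>u. X (G u)) w $ i) (at (0 + 0 *s v)) v) (at 0)"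
        by (rule cholomorphic_on_has_field_derivative_line[OF cholomorphic_on_component[OF holI]]) (use \<delta> in simp)
      moreover have "line_primitive j (\<lambda>u. X (G u)) (0 + t *s v) $ i = 0" for t
        by (simp add: line_primitive_def v)
      ultimately have "((\<lambda>t::complex. 0) has_field_derivative
          frechet_derivative (\<lambda>w. line_primitive j (\<lambda>u. X (G u)) w $ i) (at 0) v) (at 0)"
        by simp
      then show ?thesis
        using DERIV_unique DERIV_const cholomorphic_map_onD(3)[OF holI z] by metis
    qed
    then show ?thesis using dG[OF z, of v] by (simp add: vec_eq_iff)
  qed
  have inj: "v = 0" if v: "frechet_derivative G (at 0) v = 0" for v
  proof -
    let ?u = "v - (v $ j) *s axis j 1"
    have "linear (frechet_derivative G (at 0))"
      using cholomorphic_map_onD(1)[OF hG z] has_derivative_linear by blast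
    then have "frechet_derivative G (at 0) (?u + (v $ j) *s axis j 1) =
        frechet_derivative G (at 0) ?u + frechet_derivative G (at 0) ((v $ j) *s axis j 1)"
      by (rule linear_add)
    then have e: "0 = N ?u + (v $ j) *s X p"
      using v d0[of ?u] cholomorphic_map_onD(2)[OF hG z] flow[OF z] G0 by simp
    then have "0 = (N ?u + (v $ j) *s X p) $ k" by simp
    then have vj: "v $ j = 0" using k by (simp add: N_def)
    then have Nv: "N v = 0" using e by simp
    have "v $ i = 0" for i
    proof (cases "i = j")
      case False
      then have "Transposition.transpose j k i \<noteq> k" by (auto simp: Transposition.transpose_def split: if_splits)
      then have "N v $ Transposition.transpose j k i = v $ i" by (simp add: N_def)
      then show ?thesis using Nv by simp
    qed (simp add: vj)
    then show ?thesis by (simp add: vec_eq_iff)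
  qed
  obtain W where "0 \<in> W" "W \<subseteq> ball 0 \<delta>" "biholomorphic_on G W"
    using local_biholomorphism[OF open_ball z hG cholomorphic_map_onD(1)[OF hG z] inj] by blast
  then show ?thesis using that[of W G] G0 GU flow by blast
qed

section \<open>Contact forms and pairs of line fields in three variables\<close>

text \<open>Bilinear, without conjugation: it pairs the coefficients of a 1-form with a vector and
  preserves holomorphy.\<close>

definition cdot :: "complex^'n \<Rightarrow> complex^'n \<Rightarrow> complex" where
  "cdot x y = (\<Sum>i\<in>UNIV. x $ i * y $ i)"

definition ccross :: "complex^3 \<Rightarrow> complex^3 \<Rightarrow> complex^3" where
  "ccross x y = vector [x$2 * y$3 - x$3 * y$2, x$3 * y$1 - x$1 * y$3, x$1 * y$2 - x$2 * y$1]"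

text \<open>The components of \<open>d\<alpha>\<close>: by \<open>ext_deriv_eq\<close> its value on
  \<open>v\<close> and \<open>w\<close> is the determinant of \<open>curl a\<close>,
  \<open>v\<close> and \<open>w\<close>.\<close>

definition curl :: "(complex^3 \<Rightarrow> complex^3) \<Rightarrow> complex^3 \<Rightarrow> complex^3" where
  "curl a z = (let D = \<lambda>i j. frechet_derivative (\<lambda>y. a y $ j) (at z) (axis i 1)
     in vector [D 2 3 - D 3 2, D 3 1 - D 1 3, D 1 2 - D 2 1])"

text \<open>With \<open>\<alpha> = coord_form a\<close>, \<open>\<alpha> \<and> d\<alpha>\<close> is this function times \<open>dz\<^sub>1 \<and> dz\<^sub>2 \<and> dz\<^sub>3\<close>.\<close>

definition contact_density :: "(complex^3 \<Rightarrow> complex^3) \<Rightarrow> complex^3 \<Rightarrow> complex" where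
  "contact_density a z = cdot (a z) (curl a z)"

lemma coord_form_eq_cdot: "coord_form a z v = cdot (a z) v"
  by (simp add: coord_form_def cdot_def)

lemma cdot_3: "cdot x y = x$1 * y$1 + x$2 * y$2 + x$3 * y$3" for x y :: "complex^3"
  by (simp add: cdot_def sum_3)

lemma cdot_diff_right: "cdot x (y - z) = cdot x y - cdot x z"
  and cdot_smult_right: "cdot x (a *s y) = a * cdot x y"
  and cdot_axis: "cdot x (axis i 1) = x $ i"
  by (simp_all add: cdot_def axis_def algebra_simps sum_subtractf sum_distrib_left
      if_distrib[of "\<lambda>c. _ * c"] cong: if_cong)

lemma ccross_nth [simp]:
  "ccross x y $ 1 = x$2 * y$3 - x$3 * y$2"
  "ccross x y $ 2 = x$3 * y$1 - x$1 * y$3"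
  "ccross x y $ 3 = x$1 * y$2 - x$2 * y$1"
  by (simp_all add: ccross_def vector_3)

lemma curl_nth:
  "curl a z $ 1 = frechet_derivative (\<lambda>y. a y $ 3) (at z) (axis 2 1) - frechet_derivative (\<lambda>y. a y $ 2) (at z) (axis 3 1)"
  "curl a z $ 2 = frechet_derivative (\<lambda>y. a y $ 1) (at z) (axis 3 1) - frechet_derivative (\<lambda>y. a y $ 3) (at z) (axis 1 1)"
  "curl a z $ 3 = frechet_derivative (\<lambda>y. a y $ 2) (at z) (axis 1 1) - frechet_derivative (\<lambda>y. a y $ 1) (at z) (axis 2 1)"
  by (simp_all add: curl_def Let_def vector_3)

lemma vec_eq_3_iff: "x = y \<longleftrightarrow> x$1 = y$1 \<and> x$2 = y$2 \<and> x$3 = y$3" for x y :: "complex^3"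
  by (simp add: vec_eq_iff forall_3)

lemma cholomorphic_derivative_3:
  fixes f :: "complex^3 \<Rightarrow> complex"
  assumes "cholomorphic_on f U" "z \<in> U"
  shows "frechet_derivative f (at z) v = v$1 * frechet_derivative f (at z) (axis 1 1)
    + v$2 * frechet_derivative f (at z) (axis 2 1) + v$3 * frechet_derivative f (at z) (axis 3 1)"
proof -
  have lin: "linear (frechet_derivative f (at z))"
    using cholomorphic_onD(1)[OF assms] has_derivative_linear by blast
  have "v = (v$1) *s axis 1 1 + (v$2) *s axis 2 1 + (v$3) *s axis 3 1"
    by (simp add: vec_eq_3_iff axis_def)
  then have "frechet_derivative f (at z) v =
      frechet_derivative f (at z) ((v$1) *s axis 1 1 + (v$2) *s axis 2 1 + (v$3) *s axis 3 1)"
    by simp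
  then show ?thesis by (simp add: linear_add[OF lin] cholomorphic_onD(2)[OF assms])
qed

lemma ext_deriv_eq:
  fixes a :: "complex^3 \<Rightarrow> complex^3"
  assumes a: "cholomorphic_map_on a U" and z: "z \<in> U"
  shows "ext_deriv (coord_form a) z v w = cdot (curl a z) (ccross v w)"
proof -
  note h = cholomorphic_on_component[OF a]
  note d = cholomorphic_onD(1)[OF h z]
  have "frechet_derivative (\<lambda>y. coord_form a y w) (at z) v =
      frechet_derivative (\<lambda>y. a y $ 1) (at z) v * w$1 + frechet_derivative (\<lambda>y. a y $ 2) (at z) v * w$2
      + frechet_derivative (\<lambda>y. a y $ 3) (at z) v * w$3" for v w
  proof -
    have "((\<lambda>y. coord_form a y w) has_derivative (\<lambda>v. frechet_derivative (\<lambda>y. a y $ 1) (at z) v * w$1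
      + frechet_derivative (\<lambda>y. a y $ 2) (at z) v * w$2
      + frechet_derivative (\<lambda>y. a y $ 3) (at z) v * w$3)) (at z)"
      unfolding coord_form_eq_cdot cdot_3
      by (intro has_derivative_add has_derivative_mult_left d)
    then show ?thesis by (simp add: frechet_derivative_at[symmetric])
  qed
  then show ?thesis
    unfolding ext_deriv_def cdot_3 curl_nth ccross_nth
    using cholomorphic_derivative_3[OF h z, of 1 v] cholomorphic_derivative_3[OF h z, of 2 v]
      cholomorphic_derivative_3[OF h z, of 3 v] cholomorphic_derivative_3[OF h z, of 1 w]
      cholomorphic_derivative_3[OF h z, of 2 w] cholomorphic_derivative_3[OF h z, of 3 w]
    by (simp add: algebra_simps)
qed

lemma wedge_eq_contact_density:
  fixes a :: "complex^3 \<Rightarrow> complex^3"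
  assumes a: "cholomorphic_map_on a U" and z: "z \<in> U"
  shows "wedge12 (coord_form a z) (ext_deriv (coord_form a) z) u v w =
    contact_density a z * cdot u (ccross v w)"
  unfolding wedge12_def ext_deriv_eq[OF a z] coord_form_eq_cdot contact_density_def cdot_3 ccross_nth
  by (simp add: algebra_simps)

lemma wedge_nonzero_iff:
  fixes a :: "complex^3 \<Rightarrow> complex^3"
  assumes a: "cholomorphic_map_on a U" and z: "z \<in> U"
  shows "(\<exists>u v w. wedge12 (coord_form a z) (ext_deriv (coord_form a) z) u v w \<noteq> 0) \<longleftrightarrow>
    contact_density a z \<noteq> 0"
proof -
  have "cdot (axis 1 1) (ccross (axis 2 1) (axis 3 1)) = 1"
    by (simp add: cdot_3 axis_def)
  then show ?thesis unfolding wedge_eq_contact_density[OF a z]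
    by (metis mult_eq_0_iff mult.right_neutral)
qed

text \<open>The other term of the product rule is the cross product of the gradient of
  \<open>g\<close> with \<open>b\<close>, which is orthogonal to \<open>b\<close>.\<close>

lemma curl_smult:
  fixes b :: "complex^3 \<Rightarrow> complex^3"
  assumes g: "cholomorphic_on g U" and b: "cholomorphic_map_on b U" and z: "z \<in> U"
  shows "cdot (b z) (curl (\<lambda>z. g z *s b z) z) = g z * contact_density b z"
proof -
  have "frechet_derivative (\<lambda>y. (g y *s b y) $ i) (at z) v =
      g z * frechet_derivative (\<lambda>y. b y $ i) (at z) v + frechet_derivative g (at z) v * b z $ i" for i v
  proof -
    have "((\<lambda>y. (g y *s b y) $ i) has_derivative (\<lambda>v. g z * frechet_derivative (\<lambda>y. b y $ i) (at z) v
        + frechet_derivative g (at z) v * b z $ i)) (at z)"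
      using has_derivative_mult[OF cholomorphic_onD(1)[OF g z] cholomorphic_onD(1)[OF cholomorphic_on_component[OF b] z], of i]
      by simp
    then show ?thesis by (simp add: frechet_derivative_at[symmetric])
  qed
  then show ?thesis
    unfolding contact_density_def cdot_3 curl_nth by (simp add: algebra_simps)
qed

lemma curl_cong:
  assumes "open U" "z \<in> U" "\<And>y. y \<in> U \<Longrightarrow> a y = b y"
    and a: "cholomorphic_map_on a U"
  shows "curl a z = curl b z"
proof -
  have "frechet_derivative (\<lambda>y. a y $ i) (at z) v = frechet_derivative (\<lambda>y. b y $ i) (at z) v" for i v
  proof -
    have "((\<lambda>y. b y $ i) has_derivative frechet_derivative (\<lambda>y. a y $ i) (at z)) (at z)"
      by (rule has_derivative_transform_within_open[OF cholomorphic_onD(1)[OF cholomorphic_on_component[OF a] assms(2)] assms(1,2)])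
        (simp add: assms(3))
    from frechet_derivative_at[OF this] show ?thesis by simp
  qed
  then show ?thesis by (simp add: vec_eq_3_iff curl_nth)
qed

lemma cholomorphic_map_on_curl:
  assumes "open U" "cholomorphic_map_on a U"
  shows "cholomorphic_map_on (curl a) U"
proof (rule cholomorphic_map_onI)
  fix i :: 3
  have h: "cholomorphic_on (\<lambda>z. frechet_derivative (\<lambda>y. a y $ j) (at z) v) U" for j v
    by (intro cholomorphic_on_frechet_derivative cholomorphic_on_component assms)
  have "i = 1 \<or> i = 2 \<or> i = 3" by (rule exhaust_3)
  then show "cholomorphic_on (\<lambda>z. curl a z $ i) U"
    by (elim disjE) (simp_all only: curl_nth, (intro cholomorphic_on_diff h)+)
qed

lemma cholomorphic_on_cdot:
  "cholomorphic_map_on a U \<Longrightarrow> cholomorphic_map_on b U \<Longrightarrow> cholomorphic_on (\<lambda>z. cdot (a z) (b z)) U"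
  unfolding cdot_def by (intro cholomorphic_on_sum cholomorphic_on_mult) (rule cholomorphic_on_component; assumption)+

lemma cholomorphic_on_contact_density:
  "open U \<Longrightarrow> cholomorphic_map_on a U \<Longrightarrow> cholomorphic_on (contact_density a) U"
  unfolding contact_density_def[abs_def] by (intro cholomorphic_on_cdot cholomorphic_map_on_curl)

lemma contact_density_smult:
  fixes b :: "complex^3 \<Rightarrow> complex^3"
  assumes U: "open U" "z \<in> U" and g: "cholomorphic_on g U" and b: "cholomorphic_map_on b U"
    and eq: "\<And>y. y \<in> U \<Longrightarrow> a y = g y *s b y"
  shows "contact_density a z = (g z)\<^sup>2 * contact_density b z"
proof -
  have gb: "cholomorphic_map_on (\<lambda>y. g y *s b y) U"
    using g cholomorphic_on_component[OF b] by (auto intro!: cholomorphic_intros)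
  have "curl a z = curl (\<lambda>y. g y *s b y) z"
    using curl_cong[OF U _ gb, of a] eq by simp
  then have "contact_density a z = g z * cdot (b z) (curl (\<lambda>y. g y *s b y) z)"
    unfolding contact_density_def eq[OF U(2)] by (simp add: cdot_3 algebra_simps)
  then show ?thesis using curl_smult[OF g b U(2)] by (simp add: power2_eq_square)
qed

text \<open>The vectors \<open>(b $ k) *s axis i 1 - (b $ i) *s axis k 1\<close> lie in the kernel
  of \<open>b\<close>, and evaluating \<open>a\<close> on them gives the proportionality. The factor
  is a quotient of components, so it is holomorphic when \<open>a\<close> and \<open>b\<close> vary
  holomorphically.\<close>

lemma kernel_eq_imp_smult:
  fixes a b :: "complex^'n"
  assumes "{v. cdot a v = 0} = {v. cdot b v = 0}" and k: "b $ k \<noteq> 0"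
  shows "a = (a $ k / b $ k) *s b"
proof -
  have c: "cdot x ((b $ k) *s axis i 1 - (b $ i) *s axis k 1) = b $ k * x $ i - b $ i * x $ k" for i x
    by (simp add: cdot_diff_right cdot_smult_right cdot_axis)
  have "b $ k * a $ i = b $ i * a $ k" for i
  proof -
    have "(b $ k) *s axis i 1 - (b $ i) *s axis k 1 \<in> {v. cdot b v = 0}" by (simp add: c)
    then have "(b $ k) *s axis i 1 - (b $ i) *s axis k 1 \<in> {v. cdot a v = 0}"
      by (simp only: assms(1))
    then show ?thesis by (simp add: c)
  qed
  then show ?thesis using k by (simp add: vec_eq_iff field_simps)
qed

lemma contact_density_kernel:
  fixes a b :: "complex^3 \<Rightarrow> complex^3"
  assumes U: "open U" "z \<in> U" and a: "cholomorphic_map_on a U" and b: "cholomorphic_map_on b U"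
    and ker: "\<And>y. y \<in> U \<Longrightarrow> {v. cdot (a y) v = 0} = {v. cdot (b y) v = 0}"
    and bz: "b z \<noteq> 0"
  obtains l where "a z = l *s b z" "contact_density a z = l\<^sup>2 * contact_density b z"
proof -
  obtain k where k: "b z $ k \<noteq> 0" using bz by (auto simp: vec_eq_iff)
  let ?U = "U \<inter> (\<lambda>y. b y $ k) -` (- {0})"
  have opU: "open ?U"
    by (intro continuous_open_preimage U cholomorphic_on_imp_continuous_on cholomorphic_on_component b) auto
  have zU: "z \<in> ?U" using U k by simp
  let ?g = "\<lambda>y. a y $ k / b y $ k"
  have g: "cholomorphic_on ?g ?U"
    by (intro cholomorphic_intros cholomorphic_on_subset[OF cholomorphic_on_component[OF a]]
        cholomorphic_on_subset[OF cholomorphic_on_component[OF b]]) auto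
  have eq: "a y = ?g y *s b y" if "y \<in> ?U" for y
    using kernel_eq_imp_smult[OF ker] that by blast
  show ?thesis
    using that[OF eq[OF zU]] contact_density_smult[OF opU zU g cholomorphic_map_on_subset[OF b] eq] by blast
qed

lemma contact_density_nonzero_imp: "contact_density a z \<noteq> 0 \<Longrightarrow> a z \<noteq> 0"
  by (auto simp: contact_density_def cdot_def)

subsection \<open>Removable sets\<close>

text \<open>What the geometric arguments use of a set of codimension two: absence of interior makes
  extensions unique and identities persist, and the last condition makes extensions exist.
  Quantifying over all open \<open>V\<close> lets the property pass to open subsets.\<close>

definition removable_in :: "(complex^'n) set \<Rightarrow> (complex^'n) set \<Rightarrow> bool" where
  "removable_in T \<Omega> \<longleftrightarrow> open \<Omega> \<and> open (\<Omega> - T) \<and>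
     (\<forall>V. open V \<and> V \<subseteq> \<Omega> \<and> V \<subseteq> T \<longrightarrow> V = {}) \<and>
     (\<forall>V f. open V \<and> V \<subseteq> \<Omega> \<and> cholomorphic_on f (V - T) \<longrightarrow>
        (\<exists>F. cholomorphic_on F V \<and> (\<forall>z\<in>V - T. F z = f z)))"

lemma removable_inD:
  assumes "removable_in T \<Omega>"
  shows removable_in_open: "open \<Omega>" "open (\<Omega> - T)"
    and removable_in_thin: "open V \<Longrightarrow> V \<subseteq> \<Omega> \<Longrightarrow> V \<subseteq> T \<Longrightarrow> V = {}"
    and removable_in_extend: "open V \<Longrightarrow> V \<subseteq> \<Omega> \<Longrightarrow> cholomorphic_on f (V - T) \<Longrightarrow>
      \<exists>F. cholomorphic_on F V \<and> (\<forall>z\<in>V - T. F z = f z)"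
proof -
  note a = assms[unfolded removable_in_def]
  show "open \<Omega>" "open (\<Omega> - T)" using a by simp_all
  show "open V \<Longrightarrow> V \<subseteq> \<Omega> \<Longrightarrow> V \<subseteq> T \<Longrightarrow> V = {}"
    using a[THEN conjunct2, THEN conjunct2, THEN conjunct1] by simp
  show "open V \<Longrightarrow> V \<subseteq> \<Omega> \<Longrightarrow> cholomorphic_on f (V - T) \<Longrightarrow>
      \<exists>F. cholomorphic_on F V \<and> (\<forall>z\<in>V - T. F z = f z)"
    using a[THEN conjunct2, THEN conjunct2, THEN conjunct2] by simp
qed

lemma removable_in_subset:
  assumes "removable_in T \<Omega>" "open V" "V \<subseteq> \<Omega>"
  shows "removable_in T V"
proof -
  have "V - T = V \<inter> (\<Omega> - T)" using assms(3) by blast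
  then have "open (V - T)" using assms(2) removable_in_open(2)[OF assms(1)] by (simp add: open_Int)
  then show ?thesis
    unfolding removable_in_def
    using assms(2,3) removable_in_thin[OF assms(1)] removable_in_extend[OF assms(1)]
    by (metis subset_trans)
qed

lemma removable_in_identity:
  assumes T: "removable_in T \<Omega>" and "cholomorphic_on F \<Omega>" "cholomorphic_on G \<Omega>"
    and "\<And>w. w \<in> \<Omega> - T \<Longrightarrow> F w = G w" "w \<in> \<Omega>"
  shows "F w = G w"
  by (rule continuous_on_eq_off_nowhere_dense[OF _ _ removable_in_open(1)[OF T] removable_in_thin[OF T]])
    (use assms cholomorphic_on_imp_continuous_on in auto)

lemma removable_in_extend_matrix:
  assumes T: "removable_in T \<Omega>" and f: "\<And>i j. cholomorphic_on (f i j) (\<Omega> - T)"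
  obtains F where "\<And>i j. cholomorphic_on (F i j) \<Omega>" "\<And>i j z. z \<in> \<Omega> - T \<Longrightarrow> F i j z = f i j z"
proof -
  have "\<forall>i j. \<exists>G. cholomorphic_on G \<Omega> \<and> (\<forall>z\<in>\<Omega> - T. G z = f i j z)"
    using removable_in_extend[OF T removable_in_open(1)[OF T] subset_refl f] by blast
  then obtain F where "\<forall>i j. cholomorphic_on (F i j) \<Omega> \<and> (\<forall>z\<in>\<Omega> - T. F i j z = f i j z)"
    by metis
  then show ?thesis using that by blast
qed

subsection \<open>Extension of contact structures\<close>

text \<open>A nonzero diagonal entry gives \<open>a i = A i k / csqrt (A k k)\<close>; if the
  diagonal vanishes, \<open>A i j * A j i = A i i * A j j\<close> kills every entry.\<close>

lemma symmetric_rank_one: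
  fixes A :: "'n \<Rightarrow> 'n \<Rightarrow> complex"
  assumes sym: "\<And>i j. A i j = A j i" and rank: "\<And>i j k l. A i j * A k l = A i l * A k j"
  obtains a where "\<And>i j. A i j = a i * a j"
proof (cases "\<exists>k. A k k \<noteq> 0")
  case True
  then obtain k where k: "A k k \<noteq> 0" by blast
  have "A i j = (A i k / csqrt (A k k)) * (A j k / csqrt (A k k))" for i j
  proof -
    have "csqrt (A k k) * csqrt (A k k) = A k k" by (metis power2_csqrt power2_eq_square)
    then show ?thesis using k rank[of i j k k] sym[of k j] by (simp add: field_simps)
  qed
  then show ?thesis by (rule that)
next
  case False
  have "A i j = 0" for i j
    using rank[of i j j i] sym[of j i] False by simp
  then show ?thesis using that[of "\<lambda>_. 0"] by simp
qed

text \<open>If \<open>A\<close> and \<open>B\<close> are the squares of vectors \<open>a\<close> and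
  \<open>b\<close>, the principal 2 by 2 minors of their sum are the squares of
  \<open>a i * b k - a k * b i\<close>; so rank at most one of the sum makes \<open>a\<close> and
  \<open>b\<close> parallel.\<close>

lemma symmetric_rank_one_exchange:
  fixes A B :: "'n \<Rightarrow> 'n \<Rightarrow> complex"
  assumes A: "\<And>i j. A i j = A j i" "\<And>i j k l. A i j * A k l = A i l * A k j"
    and B: "\<And>i j. B i j = B j i" "\<And>i j k l. B i j * B k l = B i l * B k j"
    and AB: "\<And>i j k l. (A i j + B i j) * (A k l + B k l) = (A i l + B i l) * (A k j + B k j)"
  shows "A l i * B k m = A l k * B i m"
proof -
  obtain a where a: "\<And>i j. A i j = a i * a j" using symmetric_rank_one[of A, OF A] by metis
  obtain b where b: "\<And>i j. B i j = b i * b j" using symmetric_rank_one[of B, OF B] by metis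
  have "(a i * b k - a k * b i)\<^sup>2 = 0"
    using AB[of i i k k] unfolding a b by (simp add: power2_eq_square algebra_simps)
  then have "a i * b k = a k * b i" by simp
  then show ?thesis unfolding a b by (simp add: algebra_simps)
qed

text \<open>At a zero \<open>p\<close> the derivative in direction \<open>v\<close> is the limit of
  \<open>Q i j (p + t *s v) / t\<close>, so it inherits symmetry and rank one for each
  \<open>v\<close>; linearity in \<open>v\<close> then allows
  \<open>symmetric_rank_one_exchange\<close> to compare two directions. The curl identity, divided
  by \<open>t\<close>, expresses \<open>R l m v\<close> in the limit by products of first
  derivatives, which cancel.\<close>

lemma contact_tensor_nonzero:
  fixes Q :: "3 \<Rightarrow> 3 \<Rightarrow> complex^3 \<Rightarrow> complex"
  assumes \<Omega>: "open \<Omega>" "p \<in> \<Omega>" and hol: "\<And>i j. cholomorphic_on (Q i j) \<Omega>"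
    and sym: "\<And>i j z. z \<in> \<Omega> \<Longrightarrow> Q i j z = Q j i z"
    and rank: "\<And>i j k l z. z \<in> \<Omega> \<Longrightarrow> Q i j z * Q k l z = Q i l z * Q k j z"
    and eq: "\<And>l m z. z \<in> \<Omega> \<Longrightarrow> Q l m z = cdot (\<chi> i. Q l i z) (curl (\<lambda>y. \<chi> k. Q k m y) z)"
    and dense: "\<And>N. open N \<Longrightarrow> p \<in> N \<Longrightarrow> N \<subseteq> \<Omega> \<Longrightarrow> \<exists>z\<in>N. \<exists>i j. Q i j z \<noteq> 0"
  shows "\<exists>i j. Q i j p \<noteq> 0"
proof (rule ccontr)
  assume "\<nexists>i j. Q i j p \<noteq> 0"
  then have Q0: "Q i j p = 0" for i j by blast
  define R where "R i j v = frechet_derivative (Q i j) (at p) v" for i j v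
  have lim: "((\<lambda>t. Q i j (p + t *s v) / t) \<longlongrightarrow> R i j v) (at 0)" for i j v
  proof -
    have "((\<lambda>t. Q i j (p + t *s v)) has_field_derivative frechet_derivative (Q i j) (at (p + 0 *s v)) v) (at 0)"
      by (rule cholomorphic_on_has_field_derivative_line[OF hol]) (simp add: \<Omega>)
    then show ?thesis by (simp add: DERIV_def Q0 R_def)
  qed
  have line: "((\<lambda>t. p + t *s v) \<longlongrightarrow> p) (at 0)" for v
    using isCont_line[where z = p and v = v and s = 0] unfolding isCont_def by simp
  have ev: "\<forall>\<^sub>F t in at 0. p + t *s v \<in> \<Omega>" for v
    using topological_tendstoD[OF line \<Omega>] .
  have Rsym: "R i j v = R j i v" for i j v
  proof -
    have ev': "\<forall>\<^sub>F t in at 0. Q i j (p + t *s v) / t = Q j i (p + t *s v) / t"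
      using ev[of v] by eventually_elim (simp add: sym)
    have "((\<lambda>t. Q i j (p + t *s v) / t) \<longlongrightarrow> R j i v) (at 0)"
      using tendsto_cong[OF ev'] lim[of j i v] by blast
    then show ?thesis
      using tendsto_unique[OF trivial_limit_at lim[of i j v]] by blast
  qed
  have Rrank: "R i j v * R k l v = R i l v * R k j v" for i j k l v
  proof -
    have ev': "\<forall>\<^sub>F t in at 0. Q i j (p + t *s v) / t * (Q k l (p + t *s v) / t) =
        Q i l (p + t *s v) / t * (Q k j (p + t *s v) / t)"
      using ev[of v] by eventually_elim (simp add: rank)
    have "((\<lambda>t. Q i j (p + t *s v) / t * (Q k l (p + t *s v) / t)) \<longlongrightarrow> R i l v * R k j v) (at 0)"
      using tendsto_cong[OF ev'] tendsto_mult[OF lim[of i l v] lim[of k j v]] by blast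
    then show ?thesis
      using tendsto_unique[OF trivial_limit_at tendsto_mult[OF lim[of i j v] lim[of k l v]]] by blast
  qed
  have "linear (frechet_derivative (Q i j) (at p))" for i j
    using cholomorphic_onD(1)[OF hol \<Omega>(2)] has_derivative_linear by blast
  then have Radd: "R i j (u + v) = R i j u + R i j v" for i j u v
    unfolding R_def by (rule linear_add)
  have ex: "R l i v * R k m u = R l k v * R i m u" for l i k m u v
  proof (rule symmetric_rank_one_exchange[of "\<lambda>i j. R i j v" "\<lambda>i j. R i j u"])
    show "(R i j v + R i j u) * (R k l v + R k l u) = (R i l v + R i l u) * (R k j v + R k j u)" for i j k l
      using Rrank[where v = "v + u"] by (simp only: Radd)
  qed (rule Rsym Rrank)+
  have holcol: "cholomorphic_map_on (\<lambda>y. \<chi> k. Q k m y) \<Omega>" for m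
    using hol by (intro cholomorphic_map_onI) simp
  define C where "C m = curl (\<lambda>y. \<chi> k. Q k m y)" for m
  have C_nth: "C m p $ 1 = R 3 m (axis 2 1) - R 2 m (axis 3 1)"
    "C m p $ 2 = R 1 m (axis 3 1) - R 3 m (axis 1 1)"
    "C m p $ 3 = R 2 m (axis 1 1) - R 1 m (axis 2 1)" for m
    unfolding C_def by (simp_all add: curl_nth R_def)
  have holC: "cholomorphic_map_on (C m) \<Omega>" for m
    unfolding C_def by (rule cholomorphic_map_on_curl[OF \<Omega>(1) holcol])
  have contC: "isCont (\<lambda>z. C m z $ i) z" if "z \<in> \<Omega>" for m i z
    using cholomorphic_on_imp_continuous_on[OF cholomorphic_on_component[OF holC]] \<Omega>(1) that
    by (simp add: continuous_on_eq_continuous_at)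
  have R0: "R l m v = 0" for l m v
  proof -
    have ev': "\<forall>\<^sub>F t in at 0. Q l m (p + t *s v) / t =
      Q l 1 (p + t *s v) / t * C m (p + t *s v) $ 1 + Q l 2 (p + t *s v) / t * C m (p + t *s v) $ 2
      + Q l 3 (p + t *s v) / t * C m (p + t *s v) $ 3"
      using ev[of v]
    proof eventually_elim
      case (elim t)
      show ?case using eq[OF elim, of l m] unfolding C_def[symmetric] cdot_3
        by (simp add: add_divide_distrib)
    qed
    have lc: "((\<lambda>t. C m (p + t *s v) $ i) \<longlongrightarrow> C m p $ i) (at 0)" for i
      using isCont_tendsto_compose[OF contC[OF \<Omega>(2)] line] .
    have "((\<lambda>t. Q l 1 (p + t *s v) / t * C m (p + t *s v) $ 1 + Q l 2 (p + t *s v) / t * C m (p + t *s v) $ 2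
      + Q l 3 (p + t *s v) / t * C m (p + t *s v) $ 3) \<longlongrightarrow>
      R l 1 v * C m p $ 1 + R l 2 v * C m p $ 2 + R l 3 v * C m p $ 3) (at 0)"
      by (intro tendsto_add tendsto_mult lim lc)
    then have "((\<lambda>t. Q l m (p + t *s v) / t) \<longlongrightarrow>
      R l 1 v * C m p $ 1 + R l 2 v * C m p $ 2 + R l 3 v * C m p $ 3) (at 0)"
      using tendsto_cong[OF ev'] by blast
    then have "R l m v = R l 1 v * C m p $ 1 + R l 2 v * C m p $ 2 + R l 3 v * C m p $ 3"
      using tendsto_unique[OF trivial_limit_at lim] by blast
    \<comment> \<open>The six products cancel in three pairs, matched by \<open>ex\<close>.\<close>
    also have "\<dots> = 0"
      using ex[of l 1 v 3 m "axis 2 1"] ex[of l 1 v 2 m "axis 3 1"] ex[of l 2 v 3 m "axis 1 1"]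
      unfolding C_nth by (simp add: algebra_simps)
    finally show ?thesis .
  qed
  \<comment> \<open>Any positive constant below 1/3 serves as well as 1/10: it bounds each entry of
    row \<open>l\<close> by this constant times the sum \<open>s l\<close> of the moduli of the row,
    and summing the three bounds forces \<open>s l\<close> to vanish.\<close>
  have "\<forall>\<^sub>F z in nhds p. z \<in> \<Omega> \<and> (\<forall>m i. norm (C m z $ i) < 1 / 10)"
  proof (intro eventually_conj eventually_nhds_in_open[OF \<Omega>])
    have "C m p $ i = 0" for m i
      using exhaust_3[of i] C_nth[of m] R0 by auto
    then have "((\<lambda>z. C m z $ i) \<longlongrightarrow> 0) (nhds p)" for m i
      using contC[OF \<Omega>(2), of m i] tendsto_at_iff_tendsto_nhds[of "\<lambda>z. C m z $ i" p]
      unfolding isCont_def by simp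
    then have "\<forall>\<^sub>F z in nhds p. norm (C m z $ i) < 1 / 10" for m i
      using tendstoD[of "\<lambda>z. C m z $ i" 0 "nhds p" "1 / 10"] by simp
    then show "\<forall>\<^sub>F z in nhds p. \<forall>m i. norm (C m z $ i) < 1 / 10"
      by (simp add: eventually_all_finite)
  qed
  then obtain N where N: "open N" "p \<in> N" "\<And>z. z \<in> N \<Longrightarrow> z \<in> \<Omega>"
    "\<And>z m i. z \<in> N \<Longrightarrow> norm (C m z $ i) < 1 / 10"
    unfolding eventually_nhds by blast
  obtain z i j where z: "z \<in> N" "Q i j z \<noteq> 0" using dense[OF N(1,2)] N(3) by blast
  define s where "s l = norm (Q l 1 z) + norm (Q l 2 z) + norm (Q l 3 z)" for l
  have "norm (Q l m z) \<le> s l / 10" for l m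
  proof -
    have b: "norm (Q l i z * C m z $ i) \<le> norm (Q l i z) / 10" for i
      using N(4)[OF z(1), of m i] mult_left_mono[of "norm (C m z $ i)" "1/10" "norm (Q l i z)"]
      by (simp add: norm_mult)
    have "Q l m z = Q l 1 z * C m z $ 1 + Q l 2 z * C m z $ 2 + Q l 3 z * C m z $ 3"
      using eq[OF N(3)[OF z(1)], of l m] unfolding C_def[symmetric] cdot_3 by simp
    then have "norm (Q l m z) \<le> norm (Q l 1 z * C m z $ 1) + norm (Q l 2 z * C m z $ 2) + norm (Q l 3 z * C m z $ 3)"
      by (metis norm_triangle_ineq norm_triangle_mono order_refl)
    then show ?thesis using b[of 1] b[of 2] b[of 3] by (simp add: s_def)
  qed
  note * = this
  have "s i \<le> 0" using *[of i 1] *[of i 2] *[of i 3] s_def[of i] by simp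
  then have "norm (Q i j z) \<le> 0" using *[of i j] by linarith
  then show False using z(2) by simp
qed

definition contact_frame ::
    "(complex^3 \<Rightarrow> (complex^3) set) \<Rightarrow> (complex^3) set \<Rightarrow> (complex^3 \<Rightarrow> complex^3) \<Rightarrow> bool" where
  "contact_frame E V a \<longleftrightarrow> open V \<and> cholomorphic_map_on a V \<and>
     (\<forall>z\<in>V. contact_density a z \<noteq> 0 \<and> E z = {v. cdot (a z) v = 0})"

text \<open>The extended form is a column \<open>j\<close> of \<open>Q\<close> with
  \<open>Q j j p\<close> nonzero. By the curl identity with both indices equal to \<open>j\<close>,
  its density is \<open>Q j j\<close>, so it remains a contact form at the points of
  \<open>T\<close> in \<open>V\<close>.\<close>

lemma contact_extension:
  assumes T: "removable_in T \<Omega>" and p: "p \<in> \<Omega>"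
    and loc: "\<And>z. z \<in> \<Omega> - T \<Longrightarrow> \<exists>V a. z \<in> V \<and> V \<subseteq> \<Omega> - T \<and> contact_frame E V a"
  obtains V a where "p \<in> V" "open V" "V \<subseteq> \<Omega>" "cholomorphic_map_on a V"
    "\<forall>z\<in>V. contact_density a z \<noteq> 0" "\<forall>z\<in>V - T. E z = {v. cdot (a z) v = 0}"
proof -
  note \<Omega> = removable_in_open(1)[OF T]
  \<comment> \<open>An arbitrary choice of a local contact form at each point. By
    \<open>q_eq\<close> the tensor \<open>q\<close> does not depend on it, and is therefore
    holomorphic although the choice is not even continuous.\<close>
  define F where "F z = (SOME (V, a). z \<in> V \<and> V \<subseteq> \<Omega> - T \<and> contact_frame E V a)" for z
  have F: "z \<in> fst (F z) \<and> fst (F z) \<subseteq> \<Omega> - T \<and> contact_frame E (fst (F z)) (snd (F z))" if z: "z \<in> \<Omega> - T" for z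
  proof -
    obtain V a where "z \<in> V \<and> V \<subseteq> \<Omega> - T \<and> contact_frame E V a" using loc[OF z] by blast
    then have "case (V, a) of (V, a) \<Rightarrow> z \<in> V \<and> V \<subseteq> \<Omega> - T \<and> contact_frame E V a" by simp
    then have "case F z of (V, a) \<Rightarrow> z \<in> V \<and> V \<subseteq> \<Omega> - T \<and> contact_frame E V a"
      unfolding F_def by (rule someI)
    then show ?thesis by (simp add: case_prod_unfold)
  qed
  define q where "q i j z = snd (F z) z $ i * snd (F z) z $ j / contact_density (snd (F z)) z" for i j z
  have q_eq: "q i j z = a z $ i * a z $ j / contact_density a z"
    if V: "z \<in> V" "V \<subseteq> \<Omega> - T" "contact_frame E V a" for i j z V a
  proof -
    let ?W = "fst (F z)" and ?b = "snd (F z)"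
    have zF: "z \<in> ?W" "contact_frame E ?W ?b" using F V(1,2) by blast+
    note cV = V(3)[unfolded contact_frame_def] and cW = zF(2)[unfolded contact_frame_def]
    have 1: "open (V \<inter> ?W)" "z \<in> V \<inter> ?W" "cholomorphic_map_on ?b (V \<inter> ?W)" "cholomorphic_map_on a (V \<inter> ?W)"
      using cV cW V(1) zF(1) cholomorphic_map_on_subset by blast+
    have 2: "{v. cdot (?b y) v = 0} = {v. cdot (a y) v = 0}" if "y \<in> V \<inter> ?W" for y
      using cV cW that by auto
    have 3: "contact_density a z \<noteq> 0" "contact_density ?b z \<noteq> 0" using cV cW V(1) zF(1) by blast+
    obtain l where l: "?b z = l *s a z" "contact_density ?b z = l\<^sup>2 * contact_density a z"
      by (rule contact_density_kernel[OF 1 2 contact_density_nonzero_imp[OF 3(1)]])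
    have "l \<noteq> 0" using l(2) 3(2) by auto
    then show ?thesis unfolding q_def l using 3(1)
      by (simp add: field_simps power2_eq_square)
  qed
  have "cholomorphic_on (q i j) (\<Omega> - T)" for i j
  proof (rule cholomorphic_on_local)
    fix z assume "z \<in> \<Omega> - T"
    then obtain V a where V: "z \<in> V" "V \<subseteq> \<Omega> - T" "contact_frame E V a" using loc by blast
    note cV = V(3)[unfolded contact_frame_def]
    have "cholomorphic_on (\<lambda>z. a z $ i * a z $ j / contact_density a z) V"
      using cV by (intro cholomorphic_on_divide cholomorphic_on_mult cholomorphic_on_contact_density
          cholomorphic_on_component) auto
    then have "cholomorphic_on (q i j) V"
      by (rule cholomorphic_on_cong[rotated]) (use cV q_eq[OF _ V(2,3)] in auto)
    then show "\<exists>V. z \<in> V \<and> cholomorphic_on (q i j) V" using V(1) by blast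
  qed
  then obtain Q where Q: "\<And>i j. cholomorphic_on (Q i j) \<Omega>" "\<And>i j z. z \<in> \<Omega> - T \<Longrightarrow> Q i j z = q i j z"
    using removable_in_extend_matrix[OF T] by metis
  define col where "col j y = (\<chi> k. Q k j y)" for j y
  have holcol: "cholomorphic_map_on (col j) \<Omega>" for j
    unfolding col_def using Q(1) by (intro cholomorphic_map_onI) simp
  have loc_col: "\<exists>V a. z \<in> V \<and> open V \<and> V \<subseteq> \<Omega> - T \<and> cholomorphic_map_on a V \<and> contact_density a z \<noteq> 0 \<and>
      E z = {v. cdot (a z) v = 0} \<and> cholomorphic_on (contact_density a) V \<and>
      (\<forall>y\<in>V. contact_density a y \<noteq> 0 \<and> (\<forall>i j. Q i j y = a y $ i * a y $ j / contact_density a y))"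
    if z: "z \<in> \<Omega> - T" for z
  proof -
    obtain V a where V: "z \<in> V" "V \<subseteq> \<Omega> - T" "contact_frame E V a" using loc[OF z] by blast
    note cV = V(3)[unfolded contact_frame_def]
    have "Q i j y = a y $ i * a y $ j / contact_density a y" if "y \<in> V" for y i j
      using q_eq[OF that V(2,3)] Q(2)[of y i j] V(2) that by auto
    then show ?thesis using V cV cholomorphic_on_contact_density by metis
  qed
  have sym: "Q i j z = Q j i z" if "z \<in> \<Omega>" for i j z
    by (rule removable_in_identity[OF T Q(1) Q(1) _ that]) (simp add: Q(2) q_def)
  have rank: "Q i j z * Q k l z = Q i l z * Q k j z" if "z \<in> \<Omega>" for i j k l z
    by (rule removable_in_identity[OF T cholomorphic_on_mult cholomorphic_on_mult _ that])
      (auto simp: Q q_def)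
  have curlQ: "Q l m z = cdot (\<chi> i. Q l i z) (curl (col m) z)" if z: "z \<in> \<Omega>" for l m z
  proof (rule removable_in_identity[OF T Q(1) _ _ z])
    show "cholomorphic_on (\<lambda>z. cdot (\<chi> i. Q l i z) (curl (col m) z)) \<Omega>"
      using Q(1) by (intro cholomorphic_on_cdot cholomorphic_map_on_curl[OF \<Omega> holcol] cholomorphic_map_onI) simp
    fix w assume "w \<in> \<Omega> - T"
    then obtain V a where V: "w \<in> V" "open V" "cholomorphic_map_on a V" "cholomorphic_on (contact_density a) V"
      "\<And>y. y \<in> V \<Longrightarrow> contact_density a y \<noteq> 0" "V \<subseteq> \<Omega> - T"
      "\<And>y i j. y \<in> V \<Longrightarrow> Q i j y = a y $ i * a y $ j / contact_density a y" using loc_col by metis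
    \<comment> \<open>Off \<open>T\<close>, the column \<open>m\<close> of \<open>Q\<close> is
      \<open>?g\<close> times \<open>a\<close>, which brings its curl into the form of
      \<open>curl_smult\<close>.\<close>
    let ?g = "\<lambda>y. a y $ m / contact_density a y"
    have g: "cholomorphic_on ?g V"
      using V(4,5) cholomorphic_on_component[OF V(3)] by (intro cholomorphic_on_divide) auto
    have "curl (col m) w = curl (\<lambda>y. ?g y *s a y) w"
      by (rule curl_cong[OF V(2,1) _ cholomorphic_map_on_subset[OF holcol]])
        (use V(6,7) in \<open>auto simp: col_def vec_eq_iff mult.commute\<close>)
    moreover have "cdot (a w) (curl (\<lambda>y. ?g y *s a y) w) = ?g w * contact_density a w"
      by (rule curl_smult[OF g V(3,1)])
    moreover have "cdot (\<chi> i. Q l i w) x = a w $ l / contact_density a w * cdot (a w) x" for x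
      using V(7)[OF V(1)] by (simp add: cdot_3 algebra_simps add_divide_distrib)
    ultimately show "Q l m w = cdot (\<chi> i. Q l i w) (curl (col m) w)"
      using V(5,7)[OF V(1)] by simp
  qed
  have "\<exists>i j. Q i j p \<noteq> 0"
  proof (rule contact_tensor_nonzero[OF \<Omega> p Q(1) sym rank])
    show "Q l m z = cdot (\<chi> i. Q l i z) (curl (\<lambda>y. \<chi> k. Q k m y) z)" if "z \<in> \<Omega>" for l m z
      using curlQ[OF that, of l m] unfolding col_def .
    fix N assume N: "open N" "p \<in> N" "N \<subseteq> \<Omega>"
    then obtain z where z: "z \<in> N" "z \<notin> T" using removable_in_thin[OF T, of N] by blast
    then obtain a where a: "contact_density a z \<noteq> 0"
      "\<And>i j. Q i j z = a z $ i * a z $ j / contact_density a z" using loc_col[of z] N(3) by blast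
    obtain k where "a z $ k \<noteq> 0" using contact_density_nonzero_imp[OF a(1)] by (auto simp: vec_eq_iff)
    then have "Q k k z \<noteq> 0" using a by simp
    then show "\<exists>z\<in>N. \<exists>i j. Q i j z \<noteq> 0" using z(1) by blast
  qed
  then obtain i j where "Q i j p \<noteq> 0" by blast
  \<comment> \<open>In a symmetric matrix of rank one, a nonzero entry forces the diagonal entries
    of its row and column to be nonzero.\<close>
  moreover have "Q i j p * Q j i p = Q i i p * Q j j p" by (rule rank[OF p])
  ultimately have k: "Q j j p \<noteq> 0" using sym[OF p, of i j] by auto
  define V where "V = \<Omega> \<inter> Q j j -` (- {0})"
  have "open V" unfolding V_def
    by (intro continuous_open_preimage cholomorphic_on_imp_continuous_on Q \<Omega>) auto
  moreover have "contact_density (col j) z \<noteq> 0" if z: "z \<in> V" for z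
  proof -
    have "(\<chi> i. Q j i z) = col j z" using sym z by (simp add: col_def vec_eq_iff V_def)
    then have "contact_density (col j) z = Q j j z"
      using curlQ[of z j j] z unfolding contact_density_def V_def by simp
    then show ?thesis using z by (simp add: V_def)
  qed
  moreover have "E z = {v. cdot (col j z) v = 0}" if z: "z \<in> V - T" for z
  proof -
    obtain a where a: "contact_density a z \<noteq> 0" "E z = {v. cdot (a z) v = 0}"
      "\<And>i j. Q i j z = a z $ i * a z $ j / contact_density a z" using loc_col[of z] z unfolding V_def by blast
    have "a z $ j \<noteq> 0" using z a(3)[of j j] by (auto simp: V_def)
    moreover have "cdot (col j z) v = a z $ j / contact_density a z * cdot (a z) v" for v
      by (simp add: col_def a(3) cdot_3 algebra_simps add_divide_distrib)
    ultimately show ?thesis using a by simp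
  qed
  ultimately show ?thesis
    using that[of V "col j"] p k cholomorphic_map_on_subset[OF holcol[of j]] by (auto simp: V_def)
qed

subsection \<open>Extension of pairs of line fields\<close>

text \<open>The linear relation between the four vectors \<open>u\<close>, \<open>c\<close>,
  \<open>x\<close>, \<open>y\<close> in dimension three, paired with \<open>a\<close>; two of its
  terms drop out. Geometrically, the cross product of two vectors in the kernel of a nonzero
  \<open>a\<close> is a multiple of \<open>a\<close>.\<close>

lemma cdot_cross_exchange:
  assumes "cdot a x = 0" "cdot a y = 0"
  shows "cdot a c * cdot u (ccross x y) = cdot a u * cdot c (ccross x y)"
proof -
  have "cdot a c * cdot u (ccross x y) = cdot a u * cdot c (ccross x y)
      - cdot a x * cdot c (ccross u y) + cdot a y * cdot c (ccross u x)"
    unfolding cdot_3 ccross_nth by (simp add: algebra_simps)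
  then show ?thesis using assms by simp
qed

text \<open>With \<open>c\<close> the curl of a contact form \<open>a\<close>, this is the
  nondegeneracy of \<open>d\<alpha>\<close> on the contact plane; it makes the denominator in the
  tensor of the line pair nonzero.\<close>

lemma cross_pairing_nonzero:
  assumes "cdot a x = 0" "cdot a y = 0" "cdot a c \<noteq> 0" "ccross x y \<noteq> 0"
  shows "cdot c (ccross x y) \<noteq> 0"
proof
  assume "cdot c (ccross x y) = 0"
  then have "cdot u (ccross x y) = 0" for u
    using cdot_cross_exchange[OF assms(1,2), of c u] assms(3) by simp
  from this[of "axis 1 1"] this[of "axis 2 1"] this[of "axis 3 1"] show False
    using assms(4) by (simp add: cdot_3 axis_def vec_eq_3_iff)
qed

lemma range_smult_eqD:
  assumes "range (\<lambda>s. s *s x) = range (\<lambda>s. s *s y)"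
  shows "\<exists>l. y = l *s (x :: complex^'n)"
proof -
  have "1 *s y \<in> range (\<lambda>s. s *s y)" by blast
  then show ?thesis using assms by auto
qed

lemma range_smult_smult:
  "l \<noteq> 0 \<Longrightarrow> range (\<lambda>s. s *s (l *s x)) = range (\<lambda>s. s *s (x :: complex^'n))"
proof (intro equalityI subsetI)
  fix v assume l: "l \<noteq> 0" and "v \<in> range (\<lambda>s. s *s x)"
  then obtain s where "v = s *s x" by blast
  then have "v = (s / l) *s (l *s x)" using l by (simp add: vector_smult_assoc)
  then show "v \<in> range (\<lambda>s. s *s (l *s x))" by blast
qed (auto simp: vector_smult_assoc)

text \<open>The identity \<open>S z = 1\<close>, the contraction of \<open>B\<close> with
  \<open>d\<alpha>\<close>, does two jobs: it keeps \<open>B\<close> from vanishing, and since it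
  sees only the antisymmetric part of \<open>B\<close>, it keeps the two extended lines
  distinct.\<close>

lemma line_pair_extension:
  assumes T: "removable_in T \<Omega>" and p: "p \<in> \<Omega>"
    and a: "cholomorphic_map_on a \<Omega>" "\<And>z. z \<in> \<Omega> \<Longrightarrow> contact_density a z \<noteq> 0"
    and loc: "\<And>z. z \<in> \<Omega> - T \<Longrightarrow> \<exists>V X Y. z \<in> V \<and> open V \<and> V \<subseteq> \<Omega> - T \<and>
      cholomorphic_map_on X V \<and> cholomorphic_map_on Y V \<and>
      (\<forall>w\<in>V. cdot (a w) (X w) = 0 \<and> cdot (a w) (Y w) = 0 \<and> ccross (X w) (Y w) \<noteq> 0 \<and>
        F\<^sub>1 w = range (\<lambda>s. s *s X w) \<and> F\<^sub>2 w = range (\<lambda>s. s *s Y w))"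
  obtains V X Y where "p \<in> V" "open V" "V \<subseteq> \<Omega>" "cholomorphic_map_on X V" "cholomorphic_map_on Y V"
    "\<forall>z\<in>V. cdot (a z) (X z) = 0 \<and> cdot (a z) (Y z) = 0 \<and> ccross (X z) (Y z) \<noteq> 0"
    "\<forall>z\<in>V - T. F\<^sub>1 z = range (\<lambda>s. s *s X z) \<and> F\<^sub>2 z = range (\<lambda>s. s *s Y z)"
proof -
  note \<Omega> = removable_in_open(1)[OF T]
  define \<omega> where "\<omega> z x y = cdot (curl a z) (ccross x y)" for z x y
  \<comment> \<open>Scaling the chosen vectors by \<open>l\<close> and \<open>m\<close> multiplies
    numerator and denominator of \<open>b\<close> by \<open>l * m\<close>, so the choice is
    immaterial.\<close>
  define P where "P z = (SOME xy. F\<^sub>1 z = range (\<lambda>s. s *s fst xy) \<and> F\<^sub>2 z = range (\<lambda>s. s *s snd xy) \<and>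
    ccross (fst xy) (snd xy) \<noteq> 0)" for z
  define b where "b i j z = fst (P z) $ i * snd (P z) $ j / \<omega> z (fst (P z)) (snd (P z))" for i j z
  have b_eq: "b i j z = x $ i * y $ j / \<omega> z x y"
    if xy: "F\<^sub>1 z = range (\<lambda>s. s *s x)" "F\<^sub>2 z = range (\<lambda>s. s *s y)" "ccross x y \<noteq> 0" for i j z x y
  proof -
    let ?Q = "\<lambda>xy. F\<^sub>1 z = range (\<lambda>s. s *s fst xy) \<and> F\<^sub>2 z = range (\<lambda>s. s *s snd xy) \<and>
      ccross (fst xy) (snd xy) \<noteq> 0"
    have "?Q (x, y)" using xy by simp
    then have Q: "?Q (P z)" unfolding P_def by (rule someI)
    obtain l where l: "fst (P z) = l *s x" using range_smult_eqD[of x "fst (P z)"] Q xy(1) by auto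
    obtain m where m: "snd (P z) = m *s y" using range_smult_eqD[of y "snd (P z)"] Q xy(2) by auto
    have c: "ccross (l *s x) (m *s y) = (l * m) *s ccross x y"
      by (simp add: vec_eq_3_iff algebra_simps)
    have "\<omega> z (l *s x) (m *s y) = l * m * \<omega> z x y"
      unfolding \<omega>_def c by (simp add: cdot_smult_right)
    moreover have "l * m \<noteq> 0" using Q unfolding l m c by auto
    ultimately show ?thesis unfolding b_def l m by (simp add: field_simps)
  qed
  have loc_b: "\<exists>V X Y. z \<in> V \<and> open V \<and> V \<subseteq> \<Omega> - T \<and> cholomorphic_map_on X V \<and> cholomorphic_map_on Y V \<and>
      (\<forall>w\<in>V. cdot (a w) (X w) = 0 \<and> cdot (a w) (Y w) = 0 \<and> \<omega> w (X w) (Y w) \<noteq> 0 \<and>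
        F\<^sub>1 w = range (\<lambda>s. s *s X w) \<and> F\<^sub>2 w = range (\<lambda>s. s *s Y w) \<and>
        (\<forall>i j. b i j w = X w $ i * Y w $ j / \<omega> w (X w) (Y w)))" if z: "z \<in> \<Omega> - T" for z
  proof -
    obtain V X Y where V: "z \<in> V" "open V" "V \<subseteq> \<Omega> - T" "cholomorphic_map_on X V" "cholomorphic_map_on Y V"
      and XY: "\<And>w. w \<in> V \<Longrightarrow> cdot (a w) (X w) = 0 \<and> cdot (a w) (Y w) = 0 \<and> ccross (X w) (Y w) \<noteq> 0 \<and>
        F\<^sub>1 w = range (\<lambda>s. s *s X w) \<and> F\<^sub>2 w = range (\<lambda>s. s *s Y w)"
      using loc[OF z] by blast
    have "\<omega> w (X w) (Y w) \<noteq> 0" if w: "w \<in> V" for w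
      unfolding \<omega>_def
      by (rule cross_pairing_nonzero[of "a w"])
        (use XY[OF w] a(2)[of w] w V(3) in \<open>auto simp: contact_density_def\<close>)
    then show ?thesis using V XY b_eq by (intro exI[of _ V] exI[of _ X] exI[of _ Y]) auto
  qed
  have hol\<omega>: "cholomorphic_on (\<lambda>w. \<omega> w (X w) (Y w)) V"
    if V: "open V" "V \<subseteq> \<Omega>" and XY: "cholomorphic_map_on X V" "cholomorphic_map_on Y V" for V X Y
  proof -
    have c: "cholomorphic_map_on (curl a) V"
      by (rule cholomorphic_map_on_curl[OF V(1) cholomorphic_map_on_subset[OF a(1) V(2)]])
    show ?thesis
      unfolding \<omega>_def cdot_3 ccross_nth
      by (intro cholomorphic_on_add cholomorphic_on_mult cholomorphic_on_diff
          cholomorphic_on_component[OF c] XY[THEN cholomorphic_on_component])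
  qed
  have "cholomorphic_on (b i j) (\<Omega> - T)" for i j
  proof (rule cholomorphic_on_local)
    fix z assume "z \<in> \<Omega> - T"
    then obtain V X Y where V: "z \<in> V" "open V" "V \<subseteq> \<Omega> - T" "cholomorphic_map_on X V" "cholomorphic_map_on Y V"
      and XY: "\<And>w. w \<in> V \<Longrightarrow> \<omega> w (X w) (Y w) \<noteq> 0 \<and> b i j w = X w $ i * Y w $ j / \<omega> w (X w) (Y w)"
      using loc_b by metis
    have "cholomorphic_on (\<lambda>w. X w $ i * Y w $ j / \<omega> w (X w) (Y w)) V"
      using V XY by (intro cholomorphic_on_divide cholomorphic_on_mult cholomorphic_on_component hol\<omega>) auto
    then have "cholomorphic_on (b i j) V"
      by (rule cholomorphic_on_cong[rotated]) (use V XY in auto)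
    then show "\<exists>V. z \<in> V \<and> cholomorphic_on (b i j) V" using V(1) by blast
  qed
  then obtain B where B: "\<And>i j. cholomorphic_on (B i j) \<Omega>" "\<And>i j z. z \<in> \<Omega> - T \<Longrightarrow> B i j z = b i j z"
    using removable_in_extend_matrix[OF T] by metis
  have loc_B: "\<exists>x y. cdot (a z) x = 0 \<and> cdot (a z) y = 0 \<and> \<omega> z x y \<noteq> 0 \<and>
      F\<^sub>1 z = range (\<lambda>s. s *s x) \<and> F\<^sub>2 z = range (\<lambda>s. s *s y) \<and>
      (\<forall>i j. B i j z = x $ i * y $ j / \<omega> z x y)" if z: "z \<in> \<Omega> - T" for z
    using loc_b[OF z] B(2)[OF z] by metis
  have rank: "B i j z * B k l z = B i l z * B k j z" if "z \<in> \<Omega>" for i j k l z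
    by (rule removable_in_identity[OF T cholomorphic_on_mult cholomorphic_on_mult _ that])
      (auto simp: B b_def)
  define col where "col j z = (\<chi> k. B k j z)" for j z
  define row where "row i z = (\<chi> k. B i k z)" for i z
  have holcr: "cholomorphic_map_on (col j) \<Omega>" "cholomorphic_map_on (row j) \<Omega>" for j
    unfolding col_def row_def using B(1) by (auto intro!: cholomorphic_map_onI)
  have acol: "cdot (a z) (col j z) = 0" and arow: "cdot (a z) (row j z) = 0" if z: "z \<in> \<Omega>" for j z
  proof -
    have *: "cdot (a w) (col j w) = 0 \<and> cdot (a w) (row j w) = 0" if w: "w \<in> \<Omega> - T" for w
    proof -
      obtain x y where xy: "cdot (a w) x = 0" "cdot (a w) y = 0" "\<omega> w x y \<noteq> 0"
        "\<And>i j. B i j w = x $ i * y $ j / \<omega> w x y" using loc_B[OF w] by blast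
      have "col j w = (y $ j / \<omega> w x y) *s x" "row j w = (x $ j / \<omega> w x y) *s y"
        by (simp_all add: vec_eq_iff col_def row_def xy(4) mult.commute)
      then show ?thesis using xy(1,2) by (simp add: cdot_smult_right)
    qed
    show "cdot (a z) (col j z) = 0" "cdot (a z) (row j z) = 0"
      by (rule removable_in_identity[OF T cholomorphic_on_cdot[OF a(1) holcr(1)] cholomorphic_on_const _ z],
          use * in blast,
          rule removable_in_identity[OF T cholomorphic_on_cdot[OF a(1) holcr(2)] cholomorphic_on_const _ z],
          use * in blast)
  qed
  define S where "S z = curl a z $ 1 * (B 2 3 z - B 3 2 z) + curl a z $ 2 * (B 3 1 z - B 1 3 z)
    + curl a z $ 3 * (B 1 2 z - B 2 1 z)" for z
  have S1: "S z = 1" if z: "z \<in> \<Omega>" for z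
  proof (rule removable_in_identity[OF T _ cholomorphic_on_const _ z])
    note hc = cholomorphic_on_component[OF cholomorphic_map_on_curl[OF \<Omega> a(1)]]
    show "cholomorphic_on S \<Omega>"
      unfolding S_def[abs_def] by (intro cholomorphic_on_add cholomorphic_on_mult cholomorphic_on_diff hc B(1))
    fix w assume "w \<in> \<Omega> - T"
    then obtain x y where xy: "\<omega> w x y \<noteq> 0" "\<And>i j. B i j w = x $ i * y $ j / \<omega> w x y"
      using loc_B[of w] by blast
    have "S w = cdot (curl a w) (ccross x y) / \<omega> w x y"
      unfolding S_def xy(2) cdot_3 ccross_nth
      by (simp add: add_divide_distrib diff_divide_distrib right_diff_distrib)
    then show "S w = 1" using xy(1) by (simp add: \<omega>_def)
  qed
  have "\<exists>i j. B i j p \<noteq> 0"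
  proof (rule ccontr)
    assume "\<nexists>i j. B i j p \<noteq> 0"
    then have "S p = 0" by (simp add: S_def)
    then show False using S1[OF p] by simp
  qed
  then obtain i j where ij: "B i j p \<noteq> 0" by blast
  define V where "V = \<Omega> \<inter> B i j -` (- {0})"
  have opV: "open V" unfolding V_def
    by (intro continuous_open_preimage cholomorphic_on_imp_continuous_on B \<Omega>) auto
  \<comment> \<open>By rank one, the cross product of column \<open>j\<close> and row
    \<open>i\<close> is \<open>B i j z\<close> times the antisymmetric part of \<open>B\<close>; if
    it vanished, so would \<open>S z\<close>.\<close>
  have cross: "ccross (col j z) (row i z) \<noteq> 0" if z: "z \<in> V" for z
  proof
    have z': "z \<in> \<Omega>" "B i j z \<noteq> 0" using z by (auto simp: V_def)
    assume 0: "ccross (col j z) (row i z) = 0"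
    have r: "B k j z * B i l z = B i j z * B k l z" for k l using rank[OF z'(1), of k j i l] by (simp add: mult.commute)
    have "ccross (col j z) (row i z) $ 1 = B i j z * (B 2 3 z - B 3 2 z)"
      "ccross (col j z) (row i z) $ 2 = B i j z * (B 3 1 z - B 1 3 z)"
      "ccross (col j z) (row i z) $ 3 = B i j z * (B 1 2 z - B 2 1 z)"
      by (simp_all only: col_def row_def ccross_nth vec_lambda_beta right_diff_distrib r)
    then have "B 2 3 z - B 3 2 z = 0" "B 3 1 z - B 1 3 z = 0" "B 1 2 z - B 2 1 z = 0"
      unfolding 0 using z'(2) by simp_all
    then have "S z = 0" unfolding S_def by simp
    then show False using S1[OF z'(1)] by simp
  qed
  have F: "F\<^sub>1 z = range (\<lambda>s. s *s col j z) \<and> F\<^sub>2 z = range (\<lambda>s. s *s row i z)" if z: "z \<in> V - T" for z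
  proof -
    have z': "z \<in> \<Omega> - T" "B i j z \<noteq> 0" using z by (auto simp: V_def)
    obtain x y where xy: "\<omega> z x y \<noteq> 0" "F\<^sub>1 z = range (\<lambda>s. s *s x)" "F\<^sub>2 z = range (\<lambda>s. s *s y)"
      "\<And>i j. B i j z = x $ i * y $ j / \<omega> z x y" using loc_B[OF z'(1)] by blast
    have c: "col j z = (y $ j / \<omega> z x y) *s x" "row i z = (x $ i / \<omega> z x y) *s y"
      by (simp_all add: vec_eq_iff col_def row_def xy(4) mult.commute)
    have "y $ j / \<omega> z x y \<noteq> 0" "x $ i / \<omega> z x y \<noteq> 0" using z'(2) xy(1) xy(4)[of i j] by auto
    then show ?thesis
      unfolding c xy(2,3) by (intro conjI range_smult_smult[symmetric])
  qed
  have sub: "V \<subseteq> \<Omega>" by (auto simp: V_def)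
  show ?thesis
    by (rule that[of V "col j" "row i"])
      (use p ij opV sub cross F acol arow cholomorphic_map_on_subset[OF holcr(1) sub] cholomorphic_map_on_subset[OF holcr(2) sub] in \<open>auto simp: V_def\<close>)
qed

section \<open>Charts and tangent vectors\<close>

lemma complex_manifold_chart: "complex_manifold M A \<Longrightarrow> c \<in> A \<Longrightarrow> is_chart M c"
  unfolding complex_manifold_def by blast

lemma is_chart_facts:
  assumes c: "is_chart M c"
  shows chart_openin: "openin M (fst c)"
    and chart_open_image: "open (snd c ` fst c)"
    and chart_inj: "inj_on (snd c) (fst c)"
    and chart_image_open: "openin M W \<Longrightarrow> open (snd c ` (W \<inter> fst c))"
    and chart_preimage_open: "open V \<Longrightarrow> openin M {q\<in>fst c. snd c q \<in> V}"
proof -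
  let ?X = "subtopology M (fst c)" and ?Y = "top_of_set (snd c ` fst c)"
  show o: "openin M (fst c)" and oi: "open (snd c ` fst c)"
    using c unfolding is_chart_def by blast+
  have h: "homeomorphic_map ?X ?Y (snd c)" using c unfolding is_chart_def by blast
  have tX: "topspace ?X = fst c" by (rule topspace_subtopology_subset[OF openin_subset[OF o]])
  show "inj_on (snd c) (fst c)" using homeomorphic_imp_injective_map[OF h] tX by simp
  show "open (snd c ` (W \<inter> fst c))" if "openin M W"
  proof -
    have "openin ?X (W \<inter> fst c)" using that openin_subtopology by blast
    then have "openin ?Y (snd c ` (W \<inter> fst c))"
      using homeomorphic_imp_open_map[OF h] unfolding open_map_def by blast
    then show ?thesis using oi openin_open_trans by blast
  qed
  show "openin M {q\<in>fst c. snd c q \<in> V}" if "open V"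
  proof -
    have "openin ?Y (snd c ` fst c \<inter> V)" using that by (simp add: openin_open_Int)
    then have "openin ?X {x \<in> topspace ?X. snd c x \<in> snd c ` fst c \<inter> V}"
      using homeomorphic_imp_continuous_map[OF h] openin_continuous_map_preimage by blast
    moreover have "{x \<in> topspace ?X. snd c x \<in> snd c ` fst c \<inter> V} = {q\<in>fst c. snd c q \<in> V}"
      using tX by auto
    ultimately show ?thesis using o by (simp add: openin_open_subtopology)
  qed
qed

lemma chart_inv_left: "is_chart M c \<Longrightarrow> q \<in> fst c \<Longrightarrow> chart_inv c (snd c q) = q"
  unfolding chart_inv_def by (simp add: chart_inj inv_into_f_f)

lemma chart_inv_right: "z \<in> snd c ` fst c \<Longrightarrow> chart_inv c z \<in> fst c \<and> snd c (chart_inv c z) = z"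
  unfolding chart_inv_def by (simp add: inv_into_into f_inv_into_f)

lemma chart_image_mem:
  "is_chart M c \<Longrightarrow> z \<in> snd c ` (W \<inter> fst c) \<longleftrightarrow> z \<in> snd c ` fst c \<and> chart_inv c z \<in> W"
  by (auto simp: chart_inv_left)

section \<open>Coordinate changes, their derivatives, and the tangent vectors that they
  define\<close>

lemma transition_holomorphic:
  assumes "complex_manifold M A" "c \<in> A" "d \<in> A"
  shows "cholomorphic_map_on (transition c d) (snd c ` (fst c \<inter> fst d))"
  using assms unfolding complex_manifold_def compatible_def by blast

lemma transition_domain_open:
  assumes "complex_manifold M A" "c \<in> A" "d \<in> A"
  shows "open (snd c ` (fst c \<inter> fst d))"
  using chart_image_open[OF complex_manifold_chart[OF assms(1,2)] chart_openin[OF complex_manifold_chart[OF assms(1,3)]]]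
  by (simp add: Int_commute)

lemma transition_apply:
  "is_chart M c \<Longrightarrow> q \<in> fst c \<Longrightarrow> transition c d (snd c q) = snd d q"
  by (simp add: transition_def chart_inv_left)

lemma transition_derivative:
  assumes M: "complex_manifold M A" and c: "c \<in> A" "q \<in> fst c" and d: "d \<in> A" "q \<in> fst d"
  shows "(transition c d has_derivative frechet_derivative (transition c d) (at (snd c q))) (at (snd c q))"
    and "frechet_derivative (transition c d) (at (snd c q)) (a *s v) =
      a *s frechet_derivative (transition c d) (at (snd c q)) v"
    and "frechet_derivative (transition c d) (at (snd c q)) (v + w) =
      frechet_derivative (transition c d) (at (snd c q)) v + frechet_derivative (transition c d) (at (snd c q)) w"
proof -
  have q: "snd c q \<in> snd c ` (fst c \<inter> fst d)" using c d by blast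
  note D = cholomorphic_map_onD[OF transition_holomorphic[OF M c(1) d(1)] q]
  show "(transition c d has_derivative frechet_derivative (transition c d) (at (snd c q))) (at (snd c q))"
    "frechet_derivative (transition c d) (at (snd c q)) (a *s v) =
      a *s frechet_derivative (transition c d) (at (snd c q)) v"
    using D by blast+
  show "frechet_derivative (transition c d) (at (snd c q)) (v + w) =
      frechet_derivative (transition c d) (at (snd c q)) v + frechet_derivative (transition c d) (at (snd c q)) w"
    using D(1) has_derivative_linear linear_add by blast
qed

lemma transition_chain_rule:
  assumes M: "complex_manifold M A" and c: "c \<in> A" "q \<in> fst c" and d: "d \<in> A" "q \<in> fst d"
    and e: "e \<in> A" "q \<in> fst e"
  shows "frechet_derivative (transition c e) (at (snd c q)) v =
    frechet_derivative (transition d e) (at (snd d q)) (frechet_derivative (transition c d) (at (snd c q)) v)"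
proof -
  note cc = complex_manifold_chart[OF M c(1)] and dd = complex_manifold_chart[OF M d(1)]
  have "(transition d e \<circ> transition c d has_derivative
      frechet_derivative (transition d e) (at (snd d q)) \<circ> frechet_derivative (transition c d) (at (snd c q))) (at (snd c q))"
    using diff_chain_at[OF transition_derivative(1)[OF M c d], of "transition d e"]
      transition_derivative(1)[OF M d e] by (simp add: transition_apply[OF cc c(2)])
  then have "(transition c e has_derivative
      frechet_derivative (transition d e) (at (snd d q)) \<circ> frechet_derivative (transition c d) (at (snd c q))) (at (snd c q))"
  proof (rule has_derivative_transform_within_open)
    show "open (snd c ` (fst c \<inter> fst d))" by (rule transition_domain_open[OF M c(1) d(1)])
    show "snd c q \<in> snd c ` (fst c \<inter> fst d)" using c d by blast
    show "(transition d e \<circ> transition c d) x = transition c e x" if "x \<in> snd c ` (fst c \<inter> fst d)" for x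
      using that by (auto simp: transition_apply[OF cc] transition_apply[OF dd])
  qed
  then show ?thesis by (simp add: frechet_derivative_at[symmetric])
qed

lemma transition_same_derivative:
  assumes M: "complex_manifold M A" and c: "c \<in> A" "q \<in> fst c"
  shows "frechet_derivative (transition c c) (at (snd c q)) v = v"
proof -
  note cc = complex_manifold_chart[OF M c(1)]
  have "(transition c c has_derivative (\<lambda>v. v)) (at (snd c q))"
    by (rule has_derivative_transform_within_open[OF has_derivative_ident chart_open_image[OF cc]])
      (use c in \<open>auto simp: transition_apply[OF cc]\<close>)
  then show ?thesis by (simp add: frechet_derivative_at[symmetric])
qed

text \<open>The inverse of taking the component in the chart \<open>c\<close>: it turns coordinate
  vectors into tangent vectors at \<open>p\<close>.\<close>

definition tangent_lift ::
    "('a, 'n::finite) chart set \<Rightarrow> ('a, 'n) chart \<Rightarrow> 'a \<Rightarrow> complex^'n \<Rightarrow> ('a, 'n) tangent_vector" where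
  "tangent_lift A c p x =
     (\<lambda>d. if d \<in> A \<and> p \<in> fst d then frechet_derivative (transition c d) (at (snd c p)) x else 0)"

lemma tangent_lift:
  assumes M: "complex_manifold M A" and c: "c \<in> A" "p \<in> fst c"
  shows tangent_lift_in: "tangent_lift A c p x \<in> tangent_space A p"
    and tangent_lift_component: "tangent_lift A c p x c = x"
proof -
  show "tangent_lift A c p x \<in> tangent_space A p"
    unfolding tangent_space_def mem_Collect_eq
  proof (intro conjI ballI impI allI)
    fix d e assume "d \<in> A" "e \<in> A" "p \<in> fst d \<inter> fst e"
    then show "tangent_lift A c p x e =
        frechet_derivative (transition d e) (at (snd d p)) (tangent_lift A c p x d)"
      using transition_chain_rule[OF M c, of d e x] by (simp add: tangent_lift_def)
  qed (auto simp: tangent_lift_def)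
  show "tangent_lift A c p x c = x"
    unfolding tangent_lift_def using c transition_same_derivative[OF M c] by simp
qed

lemma tangent_space_component:
  "v \<in> tangent_space A p \<Longrightarrow> c \<in> A \<Longrightarrow> p \<in> fst c \<Longrightarrow> d \<in> A \<Longrightarrow> p \<in> fst d \<Longrightarrow>
    v d = frechet_derivative (transition c d) (at (snd c p)) (v c)"
  unfolding tangent_space_def by blast

lemma tangent_space_eqI:
  assumes "v \<in> tangent_space A p" "w \<in> tangent_space A p" "c \<in> A" "p \<in> fst c" "v c = w c"
  shows "v = w"
proof
  fix d
  show "v d = w d"
  proof (cases "d \<in> A \<and> p \<in> fst d")
    case True
    then show ?thesis using assms tangent_space_component by metis
  next
    case False
    then have "v d = 0" "w d = 0" using assms(1,2) unfolding tangent_space_def by blast+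
    then show ?thesis by simp
  qed
qed

lemma tangent_lift_eq:
  assumes "complex_manifold M A" "c \<in> A" "p \<in> fst c" "v \<in> tangent_space A p"
  shows "tangent_lift A c p (v c) = v"
  using tangent_space_eqI[OF tangent_lift_in[OF assms(1-3)] assms(4,2,3)]
    tangent_lift_component[OF assms(1-3)] by blast

lemma tangent_lift_combination:
  assumes M: "complex_manifold M A" and c: "c \<in> A" "p \<in> fst c"
  shows "tangent_lift A c p (s *s x + t *s y) =
    tangent_scale s (tangent_lift A c p x) + tangent_scale t (tangent_lift A c p y)"
  by (rule ext) (simp add: tangent_lift_def tangent_scale_def transition_derivative[OF M c])

lemma biholomorphic_on_inv:
  assumes "biholomorphic_on \<Phi> V"
  shows "biholomorphic_on (inv_into V \<Phi>) (\<Phi> ` V)"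
proof -
  note b = assms[unfolded biholomorphic_on_def]
  have im: "inv_into V \<Phi> ` \<Phi> ` V = V" using b by (simp add: inv_into_image_cancel)
  have "cholomorphic_map_on (inv_into (\<Phi> ` V) (inv_into V \<Phi>)) V"
  proof (rule cholomorphic_map_on_cong)
    fix z assume z: "z \<in> V"
    have "inv_into (\<Phi> ` V) (inv_into V \<Phi>) (inv_into V \<Phi> (\<Phi> z)) = \<Phi> z"
      by (rule inv_into_f_f[OF inj_on_inv_into]) (use z in auto)
    then show "\<Phi> z = inv_into (\<Phi> ` V) (inv_into V \<Phi>) z" using b z by (simp add: inv_into_f_f)
  qed (use b in auto)
  then show ?thesis
    unfolding biholomorphic_on_def im using b by (simp add: inj_on_inv_into)
qed

text \<open>Maximality of the atlas enters here. The new charts serve twice: to exhibit regular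
  points of the analytic set and to provide foliated charts.\<close>

lemma composed_chart:
  assumes M: "complex_manifold M A" and c: "c \<in> A" and V: "V \<subseteq> snd c ` fst c"
    and \<Phi>: "biholomorphic_on \<Phi> V"
  defines "c' \<equiv> ({q\<in>fst c. snd c q \<in> V}, \<Phi> \<circ> snd c)"
  shows "c' \<in> A"
proof -
  note b = \<Phi>[unfolded biholomorphic_on_def]
  note cc = complex_manifold_chart[OF M c]
  have fc: "fst c' = {q\<in>fst c. snd c q \<in> V}" "snd c' = \<Phi> \<circ> snd c" by (simp_all add: c'_def)
  have im: "snd c ` fst c' = V" using V unfolding fc by auto
  have im': "snd c' ` fst c' = \<Phi> ` V" by (simp only: fc(2) image_comp[symmetric] im)
  have o: "openin M (fst c')" unfolding fc(1) using chart_preimage_open[OF cc] b by blast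
  have inj': "inj_on (snd c') (fst c')" unfolding fc(2)
  proof (rule comp_inj_on)
    show "inj_on (snd c) (fst c')" using chart_inj[OF cc] by (rule inj_on_subset) (auto simp: fc)
    show "inj_on \<Phi> (snd c ` fst c')" using b im by simp
  qed
  have tX: "topspace (subtopology M (fst c')) = fst c'" by (rule topspace_subtopology_subset[OF openin_subset[OF o]])
  have "is_chart M c'"
    unfolding is_chart_def
  proof (intro conjI o)
    show "open (snd c' ` fst c')" using im' b by simp
    show "homeomorphic_map (subtopology M (fst c')) (top_of_set (snd c' ` fst c')) (snd c')"
    proof (rule bijective_open_imp_homeomorphic_map)
      show "continuous_map (subtopology M (fst c')) (top_of_set (snd c' ` fst c')) (snd c')"
        unfolding continuous_map_def
      proof (intro conjI allI impI)
        show "snd c' \<in> topspace (subtopology M (fst c')) \<rightarrow> topspace (top_of_set (snd c' ` fst c'))"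
          using tX by simp
        fix U assume "openin (top_of_set (snd c' ` fst c')) U"
        then obtain U0 where U0: "open U0" "U = snd c' ` fst c' \<inter> U0" by (auto simp: openin_open)
        have "open (V \<inter> \<Phi> -` U0)"
          using b U0(1) cholomorphic_map_on_imp_continuous_on by (intro continuous_open_preimage) auto
        then have "openin M {q\<in>fst c. snd c q \<in> V \<inter> \<Phi> -` U0}" by (rule chart_preimage_open[OF cc])
        moreover have "{x \<in> topspace (subtopology M (fst c')). snd c' x \<in> U} = {q\<in>fst c. snd c q \<in> V \<inter> \<Phi> -` U0}"
          unfolding tX U0(2) by (auto simp: fc)
        ultimately show "openin (subtopology M (fst c')) {x \<in> topspace (subtopology M (fst c')). snd c' x \<in> U}"
          using o by (simp add: openin_open_subtopology) (auto simp: fc)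
      qed
      show "open_map (subtopology M (fst c')) (top_of_set (snd c' ` fst c')) (snd c')"
        unfolding open_map_def
      proof (intro allI impI)
        fix W assume "openin (subtopology M (fst c')) W"
        then have W: "openin M W" "W \<subseteq> fst c'" using o by (simp_all add: openin_open_subtopology)
        then have "W \<inter> fst c = W" by (auto simp: fc)
        then have "open (snd c ` W)" using chart_image_open[OF cc W(1)] by simp
        moreover have sub: "snd c ` W \<subseteq> V" using W(2) im by blast
        ultimately have "open (\<Phi> ` snd c ` W)"
          using biholomorphic_on_subset[OF \<Phi>] unfolding biholomorphic_on_def by blast
        moreover have "snd c' ` W = \<Phi> ` snd c ` W" by (simp add: fc image_comp)
        ultimately show "openin (top_of_set (snd c' ` fst c')) (snd c' ` W)"
          using sub im' by (metis image_mono openin_open_eq b)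
      qed
      show "snd c' ` topspace (subtopology M (fst c')) = topspace (top_of_set (snd c' ` fst c'))"
        using tX by simp
      show "inj_on (snd c') (topspace (subtopology M (fst c')))" using tX inj' by simp
    qed
  qed
  moreover have "compatible c' d" if d: "d \<in> A" for d
  proof -
    note dd = complex_manifold_chart[OF M d]
    note c'c' = \<open>is_chart M c'\<close>
    have o1: "open (snd c' ` (fst c' \<inter> fst d))"
      using chart_image_open[OF c'c' chart_openin[OF dd]] by (simp add: Int_commute)
    have o2: "open (snd d ` (fst c' \<inter> fst d))"
      using chart_image_open[OF dd o] .
    have "cholomorphic_map_on (transition c' d) (snd c' ` (fst c' \<inter> fst d))"
    proof (rule cholomorphic_map_on_cong[OF o1])
      show "cholomorphic_map_on (\<lambda>z. transition c d (inv_into V \<Phi> z)) (snd c' ` (fst c' \<inter> fst d))"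
      proof (rule cholomorphic_map_on_compose[OF transition_holomorphic[OF M c d]])
        show "cholomorphic_map_on (inv_into V \<Phi>) (snd c' ` (fst c' \<inter> fst d))"
          by (rule cholomorphic_map_on_subset[of _ "\<Phi> ` V"]) (use b im' in auto)
        show "inv_into V \<Phi> ` snd c' ` (fst c' \<inter> fst d) \<subseteq> snd c ` (fst c \<inter> fst d)"
          using b by (auto simp: fc inv_into_f_f)
      qed
      fix z assume "z \<in> snd c' ` (fst c' \<inter> fst d)"
      then obtain q where q: "q \<in> fst c'" "q \<in> fst d" "z = snd c' q" by blast
      then have "inv_into V \<Phi> z = snd c q" "q \<in> fst c" using b by (auto simp: fc inv_into_f_f)
      then show "transition c d (inv_into V \<Phi> z) = transition c' d z"
        by (simp add: transition_apply[OF cc] q(3) transition_apply[OF c'c' q(1)])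
    qed
    moreover have "cholomorphic_map_on (transition d c') (snd d ` (fst c' \<inter> fst d))"
    proof (rule cholomorphic_map_on_cong[OF o2])
      show "cholomorphic_map_on (\<lambda>z. \<Phi> (transition d c z)) (snd d ` (fst c' \<inter> fst d))"
      proof (rule cholomorphic_map_on_compose[of \<Phi> V])
        show "cholomorphic_map_on (transition d c) (snd d ` (fst c' \<inter> fst d))"
          by (rule cholomorphic_map_on_subset[OF transition_holomorphic[OF M d c]]) (auto simp: fc)
      qed (use b in \<open>auto simp: transition_apply[OF dd] fc\<close>)
    qed (auto simp: transition_apply[OF dd] fc)
    ultimately show ?thesis unfolding compatible_def by (simp add: Int_commute)
  qed
  ultimately show ?thesis using M unfolding complex_manifold_def by blast
qed

section \<open>Closed sets of codimension two are removable\<close>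

lemma codim_two_germ_subset:
  assumes Z: "codim_two_germ Z W" and V: "open V" "V \<subseteq> W"
  shows "codim_two_germ Z V"
proof -
  note Zs = Z[unfolded codim_two_germ_def]
  obtain Fs where Fs: "finite Fs \<and> (\<forall>g\<in>Fs. cholomorphic_on g W) \<and> Z \<inter> W = {q\<in>W. \<forall>g\<in>Fs. g q = 0}"
    using conjunct1[OF conjunct2[OF Zs]] by (elim exE) (rule that)
  have "Z \<inter> V = {q\<in>V. \<forall>g\<in>Fs. g q = 0}"
  proof -
    have "q \<in> Z \<longleftrightarrow> (\<forall>g\<in>Fs. g q = 0)" if "q \<in> V" for q using Fs V(2) that by blast
    then show ?thesis by auto
  qed
  moreover have "\<forall>g\<in>Fs. cholomorphic_on g V" using Fs V(2) cholomorphic_on_subset by blast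
  moreover have "\<forall>U. open U \<and> U \<subseteq> V \<and> U \<subseteq> Z \<longrightarrow> U = {}"
    using conjunct1[OF conjunct2[OF conjunct2[OF Zs]]] V(2) by (meson subset_trans)
  moreover have "\<forall>U \<Phi> k. biholomorphic_on \<Phi> U \<and> U \<subseteq> V \<and> Z \<inter> U = {z\<in>U. \<Phi> z $ k = 0} \<longrightarrow> Z \<inter> U = {}"
    using conjunct2[OF conjunct2[OF conjunct2[OF Zs]]] V(2) by (meson subset_trans)
  ultimately show ?thesis
    unfolding codim_two_germ_def using V(1) Fs by (intro conjI exI[of _ Fs]) simp_all
qed

text \<open>A nonempty open subset of \<open>Z\<close> would yield a regular point of codimension 0,
  with no vanishing coordinate, and a hypersurface \<open>\<Phi> z $ k = 0\<close> one of
  codimension 1; both are excluded by codimension at least 2.\<close>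

lemma chart_codim_two_germ:
  fixes A :: "('a, 'n::finite) chart set"
  assumes M: "complex_manifold M A" and S: "complex_codim_ge M A S 2" and c: "c \<in> A"
    and s: "s \<in> S" "s \<in> fst c"
  obtains W Z where "snd c s \<in> W" "W \<subseteq> snd c ` fst c" "codim_two_germ Z W" "snd c ` (S \<inter> fst c) \<inter> W \<subseteq> Z"
proof -
  note cc = complex_manifold_chart[OF M c]
  obtain U Z where U: "openin M U" "s \<in> U" "S \<inter> U \<subseteq> Z" "analytic_subvariety M A U Z"
    and Z: "subvariety_codim_ge A Z 2"
    using S s(1) unfolding complex_codim_ge_def by blast
  obtain W Fs where W: "openin M W" "s \<in> W" "W \<subseteq> U" "finite Fs"
    "\<And>f. f \<in> Fs \<Longrightarrow> holomorphic_function A W f" "Z \<inter> W = {q \<in> W. \<forall>f\<in>Fs. f q = 0}"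
    using U(2,4) unfolding analytic_subvariety_def by meson
  have reg: "2 \<le> k" if "regular_point_codim A Z k q" for k q
    using Z that unfolding subvariety_codim_ge_def by blast
  let ?W = "snd c ` (W \<inter> fst c)"
  let ?Z = "snd c ` (Z \<inter> W \<inter> fst c)"
  let ?Fs = "(\<lambda>f z. f (chart_inv c z)) ` Fs"
  have memZ: "z \<in> ?Z \<longleftrightarrow> chart_inv c z \<in> Z" if "z \<in> ?W" for z
    using that by (auto simp: chart_inv_left[OF cc] chart_image_mem[OF cc])
  have oW: "open ?W" by (rule chart_image_open[OF cc W(1)])
  have "codim_two_germ ?Z ?W"
    unfolding codim_two_germ_def
  proof (intro conjI exI[of _ ?Fs] allI impI ballI)
    show "open ?W" by (rule oW)
    show "finite ?Fs" using W(4) by simp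
    show "cholomorphic_on g ?W" if "g \<in> ?Fs" for g
      using that W(5) c unfolding holomorphic_function_def by auto
    show "?Z \<inter> ?W = {q \<in> ?W. \<forall>g\<in>?Fs. g q = 0}"
    proof -
      have eqv: "z \<in> ?Z \<longleftrightarrow> (\<forall>g\<in>?Fs. g z = 0)" if z: "z \<in> ?W" for z
      proof -
        have "chart_inv c z \<in> W" using z chart_image_mem[OF cc] by blast
        then have "chart_inv c z \<in> Z \<longleftrightarrow> (\<forall>f\<in>Fs. f (chart_inv c z) = 0)" using W(6) by blast
        then show ?thesis using memZ[OF z] by simp
      qed
      have aux: "(\<And>z. z \<in> W' \<Longrightarrow> z \<in> Z' \<longleftrightarrow> P z) \<Longrightarrow> Z' \<inter> W' = {q \<in> W'. P q}"
        for Z' W' :: "(complex^'n) set" and P by blast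
      show ?thesis by (rule aux[OF eqv])
    qed
  next
    fix V assume V: "open V \<and> V \<subseteq> ?W \<and> V \<subseteq> ?Z"
    show "V = {}"
    proof (rule ccontr)
      assume "V \<noteq> {}"
      then obtain z where z: "z \<in> V" by blast
      have "biholomorphic_on (\<lambda>z. z) V"
      proof -
        have "cholomorphic_map_on (inv_into V (\<lambda>z. z)) V"
          by (rule cholomorphic_map_on_cong[of _ "\<lambda>z. z"]) (use V in \<open>auto intro!: cholomorphic_intros inv_into_f_f[symmetric]\<close>)
        then show ?thesis using V unfolding biholomorphic_on_def by (auto intro!: cholomorphic_intros)
      qed
      from composed_chart[OF M c _ this] have c': "({q\<in>fst c. snd c q \<in> V}, (\<lambda>z. z) \<circ> snd c) \<in> A" (is "?c' \<in> A")
        using V by blast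
      have "fst ?c' \<subseteq> Z"
      proof
        fix q assume "q \<in> fst ?c'"
        then have q: "q \<in> fst c" "snd c q \<in> V" by simp_all
        then have "snd c q \<in> ?W" "snd c q \<in> ?Z" using V by blast+
        then show "q \<in> Z" using memZ chart_inv_left[OF cc q(1)] by simp
      qed
      moreover have "chart_inv c z \<in> fst ?c'"
        using z V chart_inv_right[of z c] by auto
      ultimately have "regular_point_codim A Z 0 (chart_inv c z)"
        unfolding regular_point_codim_def using c' by (intro conjI bexI[of _ ?c'] exI[of _ "{}"]) auto
      then show False using reg by fastforce
    qed
  next
    fix V \<Phi> k assume a: "biholomorphic_on \<Phi> V \<and> V \<subseteq> ?W \<and> ?Z \<inter> V = {z \<in> V. \<Phi> z $ k = 0}"
    show "?Z \<inter> V = {}"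
    proof (rule ccontr)
      assume "?Z \<inter> V \<noteq> {}"
      then obtain z where z: "z \<in> V" "z \<in> ?Z" by blast
      have c': "({q\<in>fst c. snd c q \<in> V}, \<Phi> \<circ> snd c) \<in> A" (is "?c' \<in> A")
        by (rule composed_chart[OF M c]) (use a in auto)
      have mem: "q \<in> Z \<longleftrightarrow> \<Phi> (snd c q) $ k = 0" if "q \<in> fst c" "snd c q \<in> V" for q
      proof -
        have "snd c q \<in> ?W" using a that by blast
        then have "q \<in> Z \<longleftrightarrow> snd c q \<in> ?Z" using memZ chart_inv_left[OF cc that(1)] by simp
        also have "\<dots> \<longleftrightarrow> \<Phi> (snd c q) $ k = 0" using a that(2) by blast
        finally show ?thesis .
      qed
      have z': "chart_inv c z \<in> fst c" "snd c (chart_inv c z) = z"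
        using z a chart_inv_right[of z c] by auto
      have "regular_point_codim A Z 1 (chart_inv c z)"
        unfolding regular_point_codim_def
      proof (intro conjI bexI[of _ ?c'] exI[of _ "{k}"] c')
        show "chart_inv c z \<in> Z" using memZ[of z] z a by blast
        show "chart_inv c z \<in> fst ?c'" using z' z by simp
        show "Z \<inter> fst ?c' = {q \<in> fst ?c'. \<forall>i\<in>{k}. snd ?c' q $ i = 0}" using mem by auto
      qed simp
      then show False using reg by fastforce
    qed
  qed
  moreover have "snd c s \<in> ?W" using W(2) s(2) by blast
  moreover have "snd c ` (S \<inter> fst c) \<inter> ?W \<subseteq> ?Z"
  proof
    fix z assume "z \<in> snd c ` (S \<inter> fst c) \<inter> ?W"
    then have "chart_inv c z \<in> S \<inter> W" using chart_image_mem[OF cc] by blast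
    then have "chart_inv c z \<in> Z" using U(3) W(3) by blast
    then show "z \<in> ?Z" using memZ[of z] \<open>z \<in> snd c ` (S \<inter> fst c) \<inter> ?W\<close> by blast
  qed
  ultimately show ?thesis using that[of ?W ?Z] by blast
qed

text \<open>Near its points \<open>S\<close> is merely contained in an analytic set
  \<open>Z\<close>. The extension across \<open>Z\<close> agrees with \<open>f\<close> off
  \<open>Z\<close> at first, and then at the points of \<open>Z\<close> outside \<open>S\<close> by
  continuity.\<close>

lemma chart_removable_in:
  fixes A :: "('a, 'n::finite) chart set"
  assumes M: "complex_manifold M A" and cl: "closedin M S" and S: "complex_codim_ge M A S 2" and c: "c \<in> A"
  shows "removable_in (snd c ` (S \<inter> fst c)) (snd c ` fst c)"
proof -
  note cc = complex_manifold_chart[OF M c]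
  let ?T = "snd c ` (S \<inter> fst c)" and ?\<Omega> = "snd c ` fst c"
  have thin: "V = {}" if V: "open V" "V \<subseteq> ?\<Omega>" "V \<subseteq> ?T" for V
  proof (rule ccontr)
    assume "V \<noteq> {}"
    then obtain z where z: "z \<in> V" by blast
    then obtain s where s: "s \<in> S" "s \<in> fst c" "z = snd c s" using V(3) by blast
    obtain W Z where W: "snd c s \<in> W" "W \<subseteq> ?\<Omega>" "codim_two_germ Z W" "?T \<inter> W \<subseteq> Z"
      by (rule chart_codim_two_germ[OF M S c s(1,2)])
    note Zs = W(3)[unfolded codim_two_germ_def]
    have "V \<inter> W = {}"
    proof (rule conjunct1[OF conjunct2[OF conjunct2[OF Zs]], THEN spec, THEN mp], intro conjI)
      show "open (V \<inter> W)" using V(1) conjunct1[OF Zs] by (rule open_Int)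
      show "V \<inter> W \<subseteq> Z" using V(3) W(4) by blast
    qed simp
    then show False using z W(1) s(3) by blast
  qed
  have diff: "?\<Omega> - ?T = snd c ` ((topspace M - S) \<inter> fst c)"
    using chart_inj[OF cc] openin_subset[OF chart_openin[OF cc]] by (auto simp: inj_on_def)
  have oT: "open (?\<Omega> - ?T)"
    unfolding diff using cl by (intro chart_image_open[OF cc]) (simp add: closedin_def)
  have "\<exists>F. cholomorphic_on F V \<and> (\<forall>z\<in>V - ?T. F z = f z)"
    if V: "open V" "V \<subseteq> ?\<Omega>" and f: "cholomorphic_on f (V - ?T)" for V f
  proof (rule local_extensions_glue)
    show "U = {}" if "open U" "U \<subseteq> V" "U \<subseteq> ?T" for U using thin that V(2) by blast
    have oVT: "open (V - ?T)"
    proof -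
      have "V - ?T = V \<inter> (?\<Omega> - ?T)" using V(2) by blast
      then show ?thesis using V(1) oT by (simp add: open_Int)
    qed
    fix p assume p: "p \<in> V"
    show "\<exists>r>0. \<exists>F. ball p r \<subseteq> V \<and> cholomorphic_on F (ball p r) \<and> (\<forall>w\<in>ball p r - ?T. F w = f w)"
    proof (cases "p \<in> ?T")
      case False
      then obtain r where "r > 0" "ball p r \<subseteq> V - ?T" using oVT p openE by blast
      then show ?thesis using f cholomorphic_on_subset by blast
    next
      case True
      then obtain s where s: "s \<in> S" "s \<in> fst c" "p = snd c s" by blast
      obtain W Z where W': "snd c s \<in> W" "W \<subseteq> ?\<Omega>" "codim_two_germ Z W" "?T \<inter> W \<subseteq> Z"
        by (rule chart_codim_two_germ[OF M S c s(1,2)])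
      then have W: "p \<in> W" "codim_two_germ Z W" "?T \<inter> W \<subseteq> Z" using s(3) by simp_all
      have oW: "open W" using W(2) unfolding codim_two_germ_def by blast
      have g: "codim_two_germ Z (W \<inter> V)"
        by (rule codim_two_germ_subset[OF W(2)]) (use oW V in auto)
      have "cholomorphic_on f (W \<inter> V - Z)"
        by (rule cholomorphic_on_subset[OF f]) (use W(3) in blast)
      then obtain r F where r: "r > 0" "ball p r \<subseteq> W \<inter> V" "cholomorphic_on F (ball p r)"
        "\<And>w. w \<in> ball p r - Z \<Longrightarrow> F w = f w"
        using codim_two_removable[OF g, of p f] W(1) p by blast
      have "F w = f w" if w: "w \<in> ball p r - ?T" for w
      proof (rule continuous_on_eq_off_nowhere_dense[where W = "ball p r - ?T" and Z = Z])
        show "continuous_on (ball p r - ?T) F"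
          using cholomorphic_on_imp_continuous_on[OF r(3)] continuous_on_subset by blast
        show "continuous_on (ball p r - ?T) f"
          by (rule continuous_on_subset[OF cholomorphic_on_imp_continuous_on[OF f]]) (use r(2) in auto)
        have "ball p r - ?T = ball p r \<inter> (V - ?T)" using r(2) by blast
        then show "open (ball p r - ?T)" using oVT by (simp add: open_Int)
        show "U = {}" if "open U" "U \<subseteq> ball p r - ?T" "U \<subseteq> Z" for U
          using conjunct1[OF conjunct2[OF conjunct2[OF g[unfolded codim_two_germ_def]]]] that r(2)
          by (meson Diff_subset subset_trans)
      qed (use r(4) w in auto)
      then show ?thesis using r by blast
    qed
  qed
  then show ?thesis
    unfolding removable_in_def using chart_open_image[OF cc] oT thin by simp
qed

section \<open>Path geometries in charts\<close>

text \<open>Written in partial derivatives, the joint dependence on base point and vector is a sum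
  of products of holomorphic functions.\<close>

lemma cholomorphic_map_on_derivative_apply:
  fixes \<Phi> :: "complex^3 \<Rightarrow> complex^'m"
  assumes V: "open V" and W: "open W" and \<Phi>: "cholomorphic_map_on \<Phi> W"
    and y: "cholomorphic_map_on y V" "y ` V \<subseteq> W" and x: "cholomorphic_map_on x V"
  shows "cholomorphic_map_on (\<lambda>z. frechet_derivative \<Phi> (at (y z)) (x z)) V"
proof (rule cholomorphic_map_onI)
  fix i
  note \<Phi>i = cholomorphic_on_component[OF \<Phi>, of i]
  let ?D = "\<lambda>k z. frechet_derivative (\<lambda>w. \<Phi> w $ i) (at (y z)) (axis k 1)"
  have D: "cholomorphic_on (?D k) V" for k
    by (rule cholomorphic_on_compose[OF cholomorphic_on_frechet_derivative[OF W \<Phi>i] y])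
  have "cholomorphic_on (\<lambda>z. x z $ 1 * ?D 1 z + x z $ 2 * ?D 2 z + x z $ 3 * ?D 3 z) V"
    by (intro cholomorphic_on_add cholomorphic_on_mult D cholomorphic_on_component[OF x])
  then show "cholomorphic_on (\<lambda>z. frechet_derivative \<Phi> (at (y z)) (x z) $ i) V"
  proof (rule cholomorphic_on_cong[OF V])
    fix z assume "z \<in> V"
    then have "y z \<in> W" using y(2) by blast
    then show "x z $ 1 * ?D 1 z + x z $ 2 * ?D 2 z + x z $ 3 * ?D 3 z = frechet_derivative \<Phi> (at (y z)) (x z) $ i"
      using cholomorphic_map_onD(3)[OF \<Phi>, of "y z" "x z" i] cholomorphic_derivative_3[OF \<Phi>i, of "y z" "x z"]
      by simp
  qed
qed

definition chart_field ::
    "('a, 'n) chart \<Rightarrow> ('a \<Rightarrow> ('a, 'n) tangent_vector set) \<Rightarrow> complex^'n \<Rightarrow> (complex^'n) set" where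
  "chart_field c F z = (\<lambda>v. v c) ` F (chart_inv c z)"

lemma chart_field_mem:
  assumes M: "complex_manifold M A" and c: "c \<in> A" "q \<in> fst c" and F: "F q \<subseteq> tangent_space A q"
  shows "v \<in> F q \<longleftrightarrow> v \<in> tangent_space A q \<and> v c \<in> chart_field c F (snd c q)"
proof -
  have q: "chart_inv c (snd c q) = q" by (rule chart_inv_left[OF complex_manifold_chart[OF M c(1)] c(2)])
  show ?thesis
  proof
    assume "v \<in> tangent_space A q \<and> v c \<in> chart_field c F (snd c q)"
    then obtain w where "v \<in> tangent_space A q" "w \<in> F q" "v c = w c"
      unfolding chart_field_def q by blast
    then show "v \<in> F q" using tangent_space_eqI[of v A q w c] F c by blast
  qed (use F in \<open>auto simp: chart_field_def q\<close>)
qed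

lemma chart_field_Collect:
  assumes M: "complex_manifold M A" and c: "c \<in> A" "q \<in> fst c"
    and F: "\<And>v. v \<in> F q \<longleftrightarrow> v \<in> tangent_space A q \<and> P (v c)"
  shows "chart_field c F (snd c q) = {x. P x}"
proof -
  have q: "chart_inv c (snd c q) = q" by (rule chart_inv_left[OF complex_manifold_chart[OF M c(1)] c(2)])
  show ?thesis
  proof (intro equalityI subsetI)
    fix x assume "x \<in> {x. P x}"
    then have "tangent_lift A c q x \<in> F q"
      using F tangent_lift[OF M c] by simp
    then have "tangent_lift A c q x c \<in> chart_field c F (snd c q)"
      unfolding chart_field_def q by blast
    then show "x \<in> chart_field c F (snd c q)" by (simp add: tangent_lift_component[OF M c])
  qed (use F in \<open>auto simp: chart_field_def q\<close>)
qed

lemma contact_structure_in_chart: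
  fixes A :: "('a, 3) chart set"
  assumes M: "complex_manifold M A" and E: "contact_structure M A N E" and c: "c \<in> A"
    and z: "z \<in> snd c ` (N \<inter> fst c)"
  shows "\<exists>V a. z \<in> V \<and> V \<subseteq> snd c ` (N \<inter> fst c) \<and> contact_frame (chart_field c E) V a"
proof -
  note cc = complex_manifold_chart[OF M c]
  obtain p where p: "p \<in> N" "p \<in> fst c" "z = snd c p" using z by blast
  obtain U \<alpha> where U: "openin M U" "p \<in> U" "U \<subseteq> N" "contact_form A U \<alpha>"
    "\<And>q. q \<in> U \<Longrightarrow> E q = {v \<in> tangent_space A q. \<alpha> q v = 0}"
    using E p(1) unfolding contact_structure_def by meson
  obtain a where a: "form_in_chart A U \<alpha> c a"
    using U(4) c unfolding contact_form_def holomorphic_one_form_def by blast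
  let ?V = "snd c ` (U \<inter> fst c)"
  have hol: "cholomorphic_map_on a ?V" using a unfolding form_in_chart_def by blast
  have "contact_frame (chart_field c E) ?V a"
    unfolding contact_frame_def
  proof (intro conjI ballI)
    show "open ?V" by (rule chart_image_open[OF cc U(1)])
    show "cholomorphic_map_on a ?V" by (rule hol)
    fix w assume w: "w \<in> ?V"
    show "contact_density a w \<noteq> 0"
      using U(4) c a w wedge_nonzero_iff[OF hol w] unfolding contact_form_def by blast
    obtain q where q: "q \<in> U" "q \<in> fst c" "w = snd c q" using w by blast
    show "chart_field c E w = {v. cdot (a w) v = 0}"
      unfolding q(3)
    proof (rule chart_field_Collect[OF M c q(2)])
      fix v
      have "\<alpha> q v = cdot (a (snd c q)) (v c)" if "v \<in> tangent_space A q"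
        using a q that unfolding form_in_chart_def coord_form_eq_cdot by blast
      then show "v \<in> E q \<longleftrightarrow> v \<in> tangent_space A q \<and> cdot (a (snd c q)) (v c) = 0"
        unfolding U(5)[OF q(1)] by auto
    qed
  qed
  moreover have "z \<in> ?V" "?V \<subseteq> snd c ` (N \<inter> fst c)" using p U(2,3) by auto
  ultimately have "z \<in> ?V \<and> ?V \<subseteq> snd c ` (N \<inter> fst c) \<and> contact_frame (chart_field c E) ?V a"
    by (intro conjI)
  then show ?thesis by (intro exI)
qed

text \<open>\<open>X\<close> is the first coordinate vector field of a foliated chart
  \<open>d\<close>, carried over to \<open>c\<close> by the derivative of the transition
  map.\<close>

lemma foliation_in_chart:
  fixes A :: "('a, 3) chart set"
  assumes M: "complex_manifold M A" and F: "holomorphic_foliation_by_curves A N F" and c: "c \<in> A"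
    and z: "z \<in> snd c ` (N \<inter> fst c)"
  shows "\<exists>V X. z \<in> V \<and> open V \<and> V \<subseteq> snd c ` (N \<inter> fst c) \<and> cholomorphic_map_on X V \<and>
    (\<forall>w\<in>V. X w \<noteq> 0 \<and> chart_field c F w = range (\<lambda>s. s *s X w))"
proof -
  note cc = complex_manifold_chart[OF M c]
  obtain p where p: "p \<in> N" "p \<in> fst c" "z = snd c p" using z by blast
  obtain d where d: "d \<in> A" "p \<in> fst d" "fst d \<subseteq> N"
    "\<And>q. q \<in> fst d \<Longrightarrow> F q = {v \<in> tangent_space A q. v d $ 2 = 0 \<and> v d $ 3 = 0}"
    using F p(1) unfolding holomorphic_foliation_by_curves_def by meson
  note dd = complex_manifold_chart[OF M d(1)]
  let ?V = "snd c ` (fst c \<inter> fst d)"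
  let ?e = "axis 1 1 :: complex^3"
  define X where "X w = frechet_derivative (transition d c) (at (transition c d w)) ?e" for w
  have "cholomorphic_map_on X ?V"
    unfolding X_def
  proof (rule cholomorphic_map_on_derivative_apply)
    show "open ?V" by (rule transition_domain_open[OF M c d(1)])
    show "open (snd d ` (fst d \<inter> fst c))" by (rule transition_domain_open[OF M d(1) c])
    show "cholomorphic_map_on (transition d c) (snd d ` (fst d \<inter> fst c))"
      by (rule transition_holomorphic[OF M d(1) c])
    show "cholomorphic_map_on (transition c d) ?V" by (rule transition_holomorphic[OF M c d(1)])
    show "transition c d ` ?V \<subseteq> snd d ` (fst d \<inter> fst c)" by (auto simp: transition_apply[OF cc])
  qed (auto intro!: cholomorphic_map_onI cholomorphic_on_const)
  moreover have "\<forall>w\<in>?V. X w \<noteq> 0 \<and> chart_field c F w = range (\<lambda>s. s *s X w)"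
  proof
    fix w assume w: "w \<in> ?V"
    obtain q where q: "q \<in> fst c" "q \<in> fst d" "w = snd c q" using w by blast
    have Xq: "X (snd c q) = frechet_derivative (transition d c) (at (snd d q)) ?e"
      by (simp add: X_def transition_apply[OF cc q(1)])
    have comp: "v c = s *s X (snd c q) \<longleftrightarrow> v d = s *s ?e" if v: "v \<in> tangent_space A q" for v s
    proof -
      have l: "tangent_lift A d q (s *s ?e) c = s *s X (snd c q)"
        using c q by (simp add: tangent_lift_def Xq transition_derivative(2)[OF M d(1) q(2) c q(1)])
      show ?thesis
      proof
        assume "v c = s *s X (snd c q)"
        then have "v = tangent_lift A d q (s *s ?e)"
          by (intro tangent_space_eqI[OF v tangent_lift_in[OF M d(1) q(2)] c q(1)]) (simp add: l)
        then show "v d = s *s ?e" using tangent_lift_component[OF M d(1) q(2)] by metis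
      next
        assume "v d = s *s ?e"
        then have "v = tangent_lift A d q (s *s ?e)"
          using tangent_lift_eq[OF M d(1) q(2) v] by simp
        then show "v c = s *s X (snd c q)" using l by simp
      qed
    qed
    have "chart_field c F (snd c q) = {x. \<exists>s. x = s *s X (snd c q)}"
    proof (rule chart_field_Collect[OF M c q(1)])
      fix v
      have "v d $ 2 = 0 \<and> v d $ 3 = 0 \<longleftrightarrow> (\<exists>s. v d = s *s ?e)"
        by (auto simp: vec_eq_3_iff axis_def)
      then show "v \<in> F q \<longleftrightarrow> v \<in> tangent_space A q \<and> (\<exists>s. v c = s *s X (snd c q))"
        unfolding d(4)[OF q(2)] using comp by auto
    qed
    moreover have "X (snd c q) \<noteq> 0"
    proof
      assume X0: "X (snd c q) = 0"
      have "tangent_lift A d q ?e c = 1 *s X (snd c q)"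
        using c q by (simp add: tangent_lift_def Xq)
      then have "tangent_lift A d q ?e c = 0 *s X (snd c q)" using X0 by simp
      then have "tangent_lift A d q ?e d = 0 *s ?e"
        using comp[OF tangent_lift_in[OF M d(1) q(2)]] by blast
      then show False by (simp add: tangent_lift_component[OF M d(1) q(2)] vec_eq_3_iff axis_def)
    qed
    ultimately show "X w \<noteq> 0 \<and> chart_field c F w = range (\<lambda>s. s *s X w)" unfolding q(3) by auto
  qed
  moreover have "z \<in> ?V" "?V \<subseteq> snd c ` (N \<inter> fst c)" "open ?V"
    using p d(2,3) transition_domain_open[OF M c d(1)] by auto
  ultimately have "z \<in> ?V \<and> open ?V \<and> ?V \<subseteq> snd c ` (N \<inter> fst c) \<and> cholomorphic_map_on X ?V \<and>
    (\<forall>w\<in>?V. X w \<noteq> 0 \<and> chart_field c F w = range (\<lambda>s. s *s X w))"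
    by (intro conjI)
  then show ?thesis by (intro exI)
qed

lemma foliation_subset_tangent_space:
  assumes "holomorphic_foliation_by_curves A N F" "q \<in> N"
  shows "F q \<subseteq> tangent_space A q"
proof -
  obtain d where "q \<in> fst d" "\<forall>q\<in>fst d. F q = {v \<in> tangent_space A q. v d $ 2 = 0 \<and> v d $ 3 = 0}"
    using assms unfolding holomorphic_foliation_by_curves_def by meson
  then show ?thesis by blast
qed

lemma contact_structure_subset_tangent_space:
  assumes "contact_structure M A N E" "q \<in> N"
  shows "E q \<subseteq> tangent_space A q"
proof -
  have "\<exists>U \<alpha>. openin M U \<and> q \<in> U \<and> U \<subseteq> N \<and> contact_form A U \<alpha> \<and>
      (\<forall>q\<in>U. E q = {v \<in> tangent_space A q. \<alpha> q v = 0})"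
    using bspec[OF conjunct2[OF assms(1)[unfolded contact_structure_def]] assms(2)] .
  then obtain U \<alpha> where "openin M U \<and> q \<in> U \<and> U \<subseteq> N \<and> contact_form A U \<alpha> \<and>
      (\<forall>q\<in>U. E q = {v \<in> tangent_space A q. \<alpha> q v = 0})"
    by (elim exE) (rule that)
  then have "q \<in> U" "\<forall>q\<in>U. E q = {v \<in> tangent_space A q. \<alpha> q v = 0}" by simp_all
  then have "E q = {v \<in> tangent_space A q. \<alpha> q v = 0}" by (rule bspec[rotated])
  then show ?thesis by simp
qed

lemma ccross_eq_0_imp_smult:
  assumes "ccross x y = 0" "x \<noteq> 0"
  shows "\<exists>l. y = l *s x"
proof -
  have e: "x$2 * y$3 = x$3 * y$2" "x$3 * y$1 = x$1 * y$3" "x$1 * y$2 = x$2 * y$1"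
    using assms(1) by (simp_all add: vec_eq_3_iff)
  consider "x$1 \<noteq> 0" | "x$2 \<noteq> 0" | "x$3 \<noteq> 0" using assms(2) by (auto simp: vec_eq_3_iff)
  then show ?thesis
  proof cases
    case 1
    then have "y = (y$1 / x$1) *s x" using e by (simp add: vec_eq_3_iff field_simps)
    then show ?thesis ..
  next
    case 2
    then have "y = (y$2 / x$2) *s x" using e by (simp add: vec_eq_3_iff field_simps)
    then show ?thesis ..
  next
    case 3
    then have "y = (y$3 / x$3) *s x" using e by (simp add: vec_eq_3_iff field_simps)
    then show ?thesis ..
  qed
qed

section \<open>The path geometry defined by a contact form and two vector fields in one
  chart\<close>

locale chart_frame =
  fixes M :: "'a topology" and A :: "('a, 3) chart set" and c :: "('a, 3) chart"
    and V :: "(complex^3) set" and a X Y :: "complex^3 \<Rightarrow> complex^3"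
  assumes M: "complex_manifold M A" and c: "c \<in> A" and V: "open V" "V \<subseteq> snd c ` fst c"
    and hol_a: "cholomorphic_map_on a V" and hol_X: "cholomorphic_map_on X V"
    and hol_Y: "cholomorphic_map_on Y V"
    and density: "\<And>z. z \<in> V \<Longrightarrow> contact_density a z \<noteq> 0"
    and aX: "\<And>z. z \<in> V \<Longrightarrow> cdot (a z) (X z) = 0" and aY: "\<And>z. z \<in> V \<Longrightarrow> cdot (a z) (Y z) = 0"
    and XY: "\<And>z. z \<in> V \<Longrightarrow> ccross (X z) (Y z) \<noteq> 0"
begin

definition domain :: "'a set" where
  "domain = {q\<in>fst c. snd c q \<in> V}"

definition plane :: "'a \<Rightarrow> ('a, 3) tangent_vector set" where
  "plane q = {v\<in>tangent_space A q. cdot (a (snd c q)) (v c) = 0}"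

definition line :: "(complex^3 \<Rightarrow> complex^3) \<Rightarrow> 'a \<Rightarrow> ('a, 3) tangent_vector set" where
  "line x q = {v\<in>tangent_space A q. v c \<in> range (\<lambda>s. s *s x (snd c q))}"

lemma chart_c: "is_chart M c" by (rule complex_manifold_chart[OF M c])

lemma domain_open: "openin M domain"
  unfolding domain_def by (rule chart_preimage_open[OF chart_c V(1)])

lemma domainD: "q \<in> domain \<Longrightarrow> q \<in> fst c" "q \<in> domain \<Longrightarrow> snd c q \<in> V"
  by (auto simp: domain_def)

lemma nonzero: "z \<in> V \<Longrightarrow> a z \<noteq> 0" "z \<in> V \<Longrightarrow> X z \<noteq> 0" "z \<in> V \<Longrightarrow> Y z \<noteq> 0"
  using XY[of z] contact_density_nonzero_imp[OF density, of z] by (auto simp: vec_eq_3_iff)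

text \<open>Cramer's rule for \<open>v\<close>, \<open>X z\<close>, \<open>Y z\<close> and
  \<open>curl a z\<close>: the coefficient of the curl is the determinant of \<open>v\<close>,
  \<open>X z\<close>, \<open>Y z\<close>, which vanishes on the plane, and the coefficient of
  \<open>v\<close> is nonzero.\<close>

lemma plane_combination:
  assumes z: "z \<in> V" and v: "cdot (a z) v = 0"
  obtains s t where "v = s *s X z + t *s Y z"
proof -
  let ?c = "curl a z"
  let ?\<omega> = "cdot ?c (ccross (X z) (Y z))"
  have ac: "cdot (a z) ?c \<noteq> 0" using density[OF z] by (simp add: contact_density_def)
  have \<omega>: "?\<omega> \<noteq> 0" by (rule cross_pairing_nonzero[OF aX[OF z] aY[OF z] ac XY[OF z]])
  have "cdot v (ccross (X z) (Y z)) = 0"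
    using cdot_cross_exchange[OF aX[OF z] aY[OF z], of ?c v] ac v by simp
  moreover have "?\<omega> *s v + cdot ?c (ccross (Y z) v) *s X z + cdot ?c (ccross v (X z)) *s Y z =
      cdot v (ccross (X z) (Y z)) *s ?c"
    unfolding vec_eq_3_iff cdot_3 by (simp add: algebra_simps)
  ultimately have e: "?\<omega> *s v + cdot ?c (ccross (Y z) v) *s X z + cdot ?c (ccross v (X z)) *s Y z = 0"
    by simp
  have "v = (- cdot ?c (ccross (Y z) v) / ?\<omega>) *s X z + (- cdot ?c (ccross v (X z)) / ?\<omega>) *s Y z"
  proof -
    have "?\<omega> * v $ i + cdot ?c (ccross (Y z) v) * X z $ i + cdot ?c (ccross v (X z)) * Y z $ i = 0" for i
      using arg_cong[OF e, of "\<lambda>x. x $ i"] by simp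
    then have "?\<omega> * v $ i = - cdot ?c (ccross (Y z) v) * X z $ i - cdot ?c (ccross v (X z)) * Y z $ i" for i
      by (simp add: eq_neg_iff_add_eq_0 algebra_simps)
    then have "v $ i = (- cdot ?c (ccross (Y z) v) * X z $ i - cdot ?c (ccross v (X z)) * Y z $ i) / ?\<omega>" for i
      using \<omega> by (metis nonzero_mult_div_cancel_left)
    then show ?thesis
      unfolding vec_eq_iff by (simp add: diff_divide_distrib)
  qed
  then show ?thesis by (rule that)
qed

lemma lift_vector_field:
  assumes x: "cholomorphic_map_on x V"
  shows "holomorphic_vector_field A domain (\<lambda>q. tangent_lift A c q (x (snd c q)))"
  unfolding holomorphic_vector_field_def
proof (intro conjI ballI)
  fix q assume "q \<in> domain"
  then show "tangent_lift A c q (x (snd c q)) \<in> tangent_space A q"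
    by (intro tangent_lift_in[OF M c] domainD)
next
  fix d assume d: "d \<in> A"
  note dd = complex_manifold_chart[OF M d]
  let ?W = "snd d ` (domain \<inter> fst d)"
  have oW: "open ?W" by (rule chart_image_open[OF dd domain_open])
  have t: "cholomorphic_map_on (transition d c) ?W"
    by (rule cholomorphic_map_on_subset[OF transition_holomorphic[OF M d c]]) (auto simp: domain_def)
  show "cholomorphic_map_on (\<lambda>z. tangent_lift A c (chart_inv d z) (x (snd c (chart_inv d z))) d) ?W"
  proof (rule cholomorphic_map_on_cong[OF oW])
    show "cholomorphic_map_on (\<lambda>z. frechet_derivative (transition c d) (at (transition d c z)) (x (transition d c z))) ?W"
    proof (rule cholomorphic_map_on_derivative_apply[OF oW transition_domain_open[OF M c d] transition_holomorphic[OF M c d] t])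
      show "transition d c ` ?W \<subseteq> snd c ` (fst c \<inter> fst d)"
        by (auto simp: transition_apply[OF dd] domain_def)
      show "cholomorphic_map_on (\<lambda>z. x (transition d c z)) ?W"
        by (rule cholomorphic_map_on_compose[OF x t]) (auto simp: transition_apply[OF dd] domain_def)
    qed
    fix z assume "z \<in> ?W"
    then obtain q where q: "q \<in> domain" "q \<in> fst d" "z = snd d q" by blast
    then show "frechet_derivative (transition c d) (at (transition d c z)) (x (transition d c z)) =
        tangent_lift A c (chart_inv d z) (x (snd c (chart_inv d z))) d"
      using d by (simp add: tangent_lift_def chart_inv_left[OF dd] transition_apply[OF dd])
  qed
qed

text \<open>In another chart the coefficients are those of \<open>b\<close> after the coordinate
  change, multiplied by the transposed Jacobian matrix.\<close>

lemma coordinate_one_form: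
  assumes b: "cholomorphic_map_on b V"
  shows "holomorphic_one_form A domain (\<lambda>q v. cdot (b (snd c q)) (v c))"
  unfolding holomorphic_one_form_def
proof
  fix d assume d: "d \<in> A"
  note dd = complex_manifold_chart[OF M d]
  let ?W = "snd d ` (domain \<inter> fst d)"
  have oW: "open ?W" by (rule chart_image_open[OF dd domain_open])
  have t: "cholomorphic_map_on (transition d c) ?W"
    by (rule cholomorphic_map_on_subset[OF transition_holomorphic[OF M d c]]) (auto simp: domain_def)
  let ?b = "\<lambda>z. \<chi> j. cdot (b (transition d c z)) (frechet_derivative (transition d c) (at z) (axis j 1))"
  have "form_in_chart A domain (\<lambda>q v. cdot (b (snd c q)) (v c)) d ?b"
    unfolding form_in_chart_def
  proof (intro conjI ballI cholomorphic_map_onI)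
    fix j
    have "cholomorphic_on (\<lambda>z. cdot (b (transition d c z)) (frechet_derivative (transition d c) (at z) (axis j 1))) ?W"
    proof (rule cholomorphic_on_cdot)
      show "cholomorphic_map_on (\<lambda>z. b (transition d c z)) ?W"
        by (rule cholomorphic_map_on_compose[OF b t]) (auto simp: transition_apply[OF dd] domain_def)
      show "cholomorphic_map_on (\<lambda>z. frechet_derivative (transition d c) (at z) (axis j 1)) ?W"
        by (rule cholomorphic_map_on_derivative_apply[OF oW oW t, of "\<lambda>z. z"])
          (auto intro!: cholomorphic_map_onI cholomorphic_on_nth cholomorphic_on_const)
    qed
    then show "cholomorphic_on (\<lambda>z. ?b z $ j) ?W" by simp
  next
    fix q v assume q: "q \<in> domain \<inter> fst d" and v: "v \<in> tangent_space A q"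
    let ?D = "frechet_derivative (transition d c) (at (snd d q))"
    have qc: "q \<in> fst c" "q \<in> fst d" using q by (auto simp: domain_def)
    note D = transition_derivative(2,3)[OF M d qc(2) c qc(1)]
    have "v d = (v d $ 1) *s axis 1 1 + (v d $ 2) *s axis 2 1 + (v d $ 3) *s axis 3 1"
      by (simp add: vec_eq_3_iff axis_def)
    then have "?D (v d) = ?D ((v d $ 1) *s axis 1 1 + (v d $ 2) *s axis 2 1 + (v d $ 3) *s axis 3 1)"
      by simp
    then have "v c = (v d $ 1) *s ?D (axis 1 1) + (v d $ 2) *s ?D (axis 2 1) + (v d $ 3) *s ?D (axis 3 1)"
      using tangent_space_component[OF v d qc(2) c qc(1)] by (simp add: D)
    then show "cdot (b (snd c q)) (v c) = coord_form ?b (snd d q) (v d)"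
      unfolding coord_form_eq_cdot cdot_3[of "?b (snd d q)"]
      by (simp add: transition_apply[OF dd qc(2)] cdot_3 algebra_simps)
  qed
  then show "\<exists>b'. form_in_chart A domain (\<lambda>q v. cdot (b (snd c q)) (v c)) d b'" by blast
qed

lemma plane_subbundle: "holomorphic_subbundle M A domain 2 plane"
  unfolding holomorphic_subbundle_def
proof
  fix p assume p: "p \<in> domain"
  define Z where "Z i q = tangent_lift A c q ((if i = 0 then X else Y) (snd c q))" for i :: nat and q
  have "plane q = tangent.span ((\<lambda>i. Z i q) ` {..<2}) \<and> tangent.dim (plane q) = 2" if q: "q \<in> domain" for q
  proof -
    note qc = domainD[OF q]
    let ?x = "tangent_lift A c q (X (snd c q))" and ?y = "tangent_lift A c q (Y (snd c q))"
    have xy: "?x \<in> tangent_space A q" "?y \<in> tangent_space A q" "?x c = X (snd c q)" "?y c = Y (snd c q)"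
      using tangent_lift[OF M c qc(1)] by auto
    have lin: "tangent_lift A c q (s *s X (snd c q) + t *s Y (snd c q)) = tangent_scale s ?x + tangent_scale t ?y" for s t
      by (rule tangent_lift_combination[OF M c qc(1)])
    have im: "(\<lambda>i. Z i q) ` {..<2} = {?x, ?y}"
      by (auto simp: Z_def lessThan_Suc numeral_2_eq_2)
    have sp: "tangent.span {?x, ?y} = {tangent_scale s ?x + tangent_scale t ?y | s t. True}"
    proof -
      have "v \<in> tangent.span {?x, ?y} \<longleftrightarrow> (\<exists>s t. v = tangent_scale s ?x + tangent_scale t ?y)" for v
        unfolding tangent.span_insert tangent.span_singleton[of ?y] tangent.span_empty
        by (auto simp: diff_eq_eq add.commute)
      then show ?thesis by blast
    qed
    have "plane q = tangent.span {?x, ?y}"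
      unfolding sp
    proof (intro equalityI subsetI)
      fix v assume "v \<in> plane q"
      then have v: "v \<in> tangent_space A q" "cdot (a (snd c q)) (v c) = 0" by (auto simp: plane_def)
      obtain s t where "v c = s *s X (snd c q) + t *s Y (snd c q)"
        using plane_combination[OF qc(2) v(2)] by blast
      then have "v = tangent_scale s ?x + tangent_scale t ?y"
        using tangent_lift_eq[OF M c qc(1) v(1)] lin by metis
      then show "v \<in> {tangent_scale s ?x + tangent_scale t ?y | s t. True}" by blast
    next
      fix v assume "v \<in> {tangent_scale s ?x + tangent_scale t ?y | s t. True}"
      then obtain s t where v: "v = tangent_lift A c q (s *s X (snd c q) + t *s Y (snd c q))"
        unfolding lin[symmetric] by blast
      have "cdot (a (snd c q)) (s *s X (snd c q) + t *s Y (snd c q)) =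
          s * cdot (a (snd c q)) (X (snd c q)) + t * cdot (a (snd c q)) (Y (snd c q))"
        by (simp add: cdot_3 algebra_simps)
      then show "v \<in> plane q"
        unfolding v plane_def using tangent_lift[OF M c qc(1)] aX[OF qc(2)] aY[OF qc(2)] by simp
    qed
    moreover have "tangent.dim (tangent.span {?x, ?y}) = 2"
    proof -
      have notin: "?x \<notin> tangent.span {?y}"
      proof
        assume "?x \<in> tangent.span {?y}"
        then obtain s where "?x = tangent_scale s ?y" using tangent.span_singleton by blast
        then have "X (snd c q) = s *s Y (snd c q)" using xy(3,4) by (metis tangent_scale_def)
        then show False using XY[OF qc(2)] by (simp add: vec_eq_3_iff)
      qed
      moreover have "?y \<noteq> 0" using xy(4) nonzero(3)[OF qc(2)] by (metis zero_fun_apply)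
      ultimately have "tangent.independent {?x, ?y}"
        by (simp add: tangent.independent_insert)
      moreover have "?x \<noteq> ?y" using notin tangent.span_base[of ?y "{?y}"] by auto
      ultimately show ?thesis using tangent.dim_span_eq_card_independent by fastforce
    qed
    ultimately show ?thesis unfolding im by simp
  qed
  then have h2: "\<forall>q\<in>domain. plane q = tangent.span ((\<lambda>i. Z i q) ` {..<2}) \<and> tangent.dim (plane q) = 2"
    by (rule ballI)
  have h1: "\<forall>i<2. holomorphic_vector_field A domain (Z i)"
    unfolding Z_def using lift_vector_field[OF hol_X] lift_vector_field[OF hol_Y] by auto
  show "\<exists>U X. openin M U \<and> p \<in> U \<and> U \<subseteq> domain \<and> (\<forall>i<(2::nat). holomorphic_vector_field A U (X i)) \<and>
      (\<forall>q\<in>U. plane q = tangent.span ((\<lambda>i. X i q) ` {..<2}) \<and> tangent.dim (plane q) = 2)"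
    by (intro exI[of _ domain] exI[of _ Z] conjI domain_open p subset_refl h1 h2)
qed

text \<open>\<open>contact_form\<close> asks for a nonvanishing density in every chart, while the
  frame controls it in \<open>c\<close> only. Instead of transforming \<open>d\<alpha>\<close>, the
  proof compares with the contact forms of the given \<open>E\<close>, which have the same kernel
  off \<open>S\<close>.\<close>

lemma plane_contact_structure:
  assumes rem: "\<And>d. d \<in> A \<Longrightarrow> removable_in (snd d ` (S \<inter> fst d)) (snd d ` fst d)"
    and N: "domain - S \<subseteq> N" and E: "contact_structure M A N E"
    and eq: "\<And>q. q \<in> domain - S \<Longrightarrow> E q = plane q"
  shows "contact_structure M A domain plane"
proof -
  define \<alpha> where "\<alpha> = (\<lambda>q (v :: ('a, 3) tangent_vector). cdot (a (snd c q)) (v c))"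
  have "contact_form A domain \<alpha>"
    unfolding contact_form_def
  proof (intro conjI ballI allI impI)
    show "holomorphic_one_form A domain \<alpha>" unfolding \<alpha>_def by (rule coordinate_one_form[OF hol_a])
    fix d b z assume d: "d \<in> A" and b: "form_in_chart A domain \<alpha> d b" and z: "z \<in> snd d ` (domain \<inter> fst d)"
    note dd = complex_manifold_chart[OF M d]
    let ?W = "snd d ` (domain \<inter> fst d)" and ?T = "snd d ` (S \<inter> fst d)"
    have oW: "open ?W" by (rule chart_image_open[OF dd domain_open])
    have R: "removable_in ?T ?W"
      by (rule removable_in_subset[OF rem[OF d] oW]) auto
    have hb: "cholomorphic_map_on b ?W" using b unfolding form_in_chart_def by blast
    have dens: "contact_density b w \<noteq> 0" if w: "w \<in> ?W - ?T" for w
    proof -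
      have ker: "chart_field d E y = {x. cdot (b y) x = 0}" if "y \<in> ?W - ?T" for y
      proof -
        obtain q where q: "q \<in> domain - S" "q \<in> fst d" "y = snd d q" using \<open>y \<in> ?W - ?T\<close> by blast
        show ?thesis unfolding q(3)
        proof (rule chart_field_Collect[OF M d q(2)])
          fix v
          have "\<alpha> q v = cdot (b (snd d q)) (v d)" if "v \<in> tangent_space A q"
            using b q that unfolding form_in_chart_def coord_form_eq_cdot by blast
          then show "v \<in> E q \<longleftrightarrow> v \<in> tangent_space A q \<and> cdot (b (snd d q)) (v d) = 0"
            unfolding eq[OF q(1)] plane_def \<alpha>_def by auto
        qed
      qed
      have "w \<in> snd d ` (N \<inter> fst d)" using w N by blast
      then obtain U e where U: "w \<in> U" "contact_frame (chart_field d E) U e"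
        using contact_structure_in_chart[OF M E d] by blast
      note Us = U(2)[unfolded contact_frame_def]
      let ?U = "U \<inter> (?W - ?T)"
      have o: "open ?U" using Us removable_in_open(2)[OF R] by (intro open_Int) auto
      have wU: "w \<in> ?U" using U(1) w by blast
      have he: "cholomorphic_map_on e ?U" using Us cholomorphic_map_on_subset by blast
      have hb': "cholomorphic_map_on b ?U" by (rule cholomorphic_map_on_subset[OF hb]) blast
      have ker': "{v. cdot (e y) v = 0} = {v. cdot (b y) v = 0}" if "y \<in> ?U" for y
        using Us ker[of y] that by auto
      have de: "contact_density e w \<noteq> 0" using Us U(1) by blast
      have "b w \<noteq> 0"
      proof
        assume "b w = 0"
        then have "{v. cdot (e w) v = 0} = UNIV" using ker'[OF wU] by (simp add: cdot_def)
        then have "cdot (e w) (axis i 1) = 0" for i by blast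
        then have "e w = 0" by (simp add: cdot_axis vec_eq_iff)
        then show False using contact_density_nonzero_imp[OF de] by blast
      qed
      then obtain l where "contact_density e w = l\<^sup>2 * contact_density b w"
        using contact_density_kernel[OF o wU he hb' ker'] by blast
      then show ?thesis using de by auto
    qed
    \<comment> \<open>The inverse of the density extends over \<open>S\<close>, so the density does not vanish there.\<close>
    have hd: "cholomorphic_on (contact_density b) ?W" by (rule cholomorphic_on_contact_density[OF oW hb])
    have "cholomorphic_on (\<lambda>w. inverse (contact_density b w)) (?W - ?T)"
      by (intro cholomorphic_on_inverse cholomorphic_on_subset[OF hd] dens) auto
    then obtain F where F: "cholomorphic_on F ?W" "\<And>w. w \<in> ?W - ?T \<Longrightarrow> F w = inverse (contact_density b w)"
      using removable_in_extend[OF R oW subset_refl] by blast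
    have "contact_density b z * F z = 1"
      by (rule removable_in_identity[OF R cholomorphic_on_mult[OF hd F(1)] cholomorphic_on_const _ z])
        (simp add: F(2) dens)
    then have "contact_density b z \<noteq> 0" by auto
    then show "\<exists>u v w. wedge12 (coord_form b z) (ext_deriv (coord_form b) z) u v w \<noteq> 0"
      using wedge_nonzero_iff[OF hb z] by blast
  qed
  then show ?thesis
    unfolding contact_structure_def using plane_subbundle domain_open
    by (intro conjI ballI exI[of _ domain] exI[of _ \<alpha>]) (auto simp: plane_def \<alpha>_def)
qed

text \<open>A flow box with \<open>j = 1\<close> straightens \<open>x\<close> to the first
  coordinate field, in keeping with plaques on which the second and third coordinates are constant.
  Composing \<open>c\<close> with its inverse gives a foliated chart, which belongs to the maximal
  atlas.\<close>

lemma line_foliation: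
  assumes x: "cholomorphic_map_on x V" and nz: "\<And>z. z \<in> V \<Longrightarrow> x z \<noteq> 0"
  shows "holomorphic_foliation_by_curves A domain (line x)"
  unfolding holomorphic_foliation_by_curves_def
proof
  fix p assume p: "p \<in> domain"
  let ?e = "axis 1 1 :: complex^3"
  obtain W G where W: "0 \<in> W" "biholomorphic_on G W" "G ` W \<subseteq> V" "G 0 = snd c p"
    and flow: "\<And>w. w \<in> W \<Longrightarrow> frechet_derivative G (at w) ?e = x (G w)"
    using flow_box[OF V(1) domainD(2)[OF p] x nz[OF domainD(2)[OF p]], where j = 1] by blast
  note bG = W(2)[unfolded biholomorphic_on_def]
  let ?\<Phi> = "inv_into W G"
  define c' where "c' = ({q\<in>fst c. snd c q \<in> G ` W}, ?\<Phi> \<circ> snd c)"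
  have c': "c' \<in> A"
    unfolding c'_def
    by (rule composed_chart[OF M c _ biholomorphic_on_inv[OF W(2)]]) (use W(3) V(2) in auto)
  note cc' = complex_manifold_chart[OF M c']
  have fc': "q \<in> fst c'" "q \<in> fst c" "q \<in> domain" "snd c' q \<in> W" "snd c q = G (snd c' q)"
    if "q \<in> fst c'" for q
    using that W(3) by (auto simp: c'_def domain_def f_inv_into_f inv_into_into)
  have der: "frechet_derivative (transition c' c) (at (snd c' q)) = frechet_derivative G (at (snd c' q))"
    if q: "q \<in> fst c'" for q
  proof -
    have "(transition c' c has_derivative frechet_derivative (transition c' c) (at (snd c' q))) (at (snd c' q))"
      by (rule transition_derivative(1)[OF M c' q c fc'(2)[OF q]])
    then have "(G has_derivative frechet_derivative (transition c' c) (at (snd c' q))) (at (snd c' q))"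
    proof (rule has_derivative_transform_within_open)
      show "open (snd c' ` (fst c' \<inter> fst c))" by (rule transition_domain_open[OF M c' c])
      show "snd c' q \<in> snd c' ` (fst c' \<inter> fst c)" using fc'[OF q] by blast
      show "transition c' c w = G w" if "w \<in> snd c' ` (fst c' \<inter> fst c)" for w
        using that fc'(5) by (auto simp: transition_apply[OF cc'])
    qed
    then show ?thesis by (rule frechet_derivative_at)
  qed
  have "line x q = {v \<in> tangent_space A q. v c' $ 2 = 0 \<and> v c' $ 3 = 0}" if q: "q \<in> fst c'" for q
  proof -
    note f = fc'[OF q]
    have l: "tangent_lift A c' q (s *s ?e) c = s *s x (snd c q)" for s
      using c f(2) flow[OF f(4)] transition_derivative(2)[OF M c' q c f(2), of s ?e]
      by (simp add: tangent_lift_def der[OF q] f(5)[symmetric])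
    have "v c \<in> range (\<lambda>s. s *s x (snd c q)) \<longleftrightarrow> v c' $ 2 = 0 \<and> v c' $ 3 = 0" if v: "v \<in> tangent_space A q" for v
    proof
      assume "v c \<in> range (\<lambda>s. s *s x (snd c q))"
      then obtain s where "v c = s *s x (snd c q)" by blast
      then have "v = tangent_lift A c' q (s *s ?e)"
        by (intro tangent_space_eqI[OF v tangent_lift_in[OF M c' q] c f(2)]) (simp add: l)
      then have "v c' = s *s ?e" using tangent_lift_component[OF M c' q] by metis
      then show "v c' $ 2 = 0 \<and> v c' $ 3 = 0" by (simp add: axis_def)
    next
      assume "v c' $ 2 = 0 \<and> v c' $ 3 = 0"
      then have "v c' = (v c' $ 1) *s ?e" by (simp add: vec_eq_3_iff axis_def)
      then have "v = tangent_lift A c' q ((v c' $ 1) *s ?e)"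
        using tangent_lift_eq[OF M c' q v] by simp
      then show "v c \<in> range (\<lambda>s. s *s x (snd c q))" using l by (metis rangeI)
    qed
    then show ?thesis unfolding line_def by blast
  qed
  moreover have "p \<in> fst c'" using p W(1,4) by (auto simp: c'_def domain_def intro: rev_image_eqI)
  ultimately show "\<exists>c\<in>A. p \<in> fst c \<and> fst c \<subseteq> domain \<and>
      (\<forall>q\<in>fst c. line x q = {v \<in> tangent_space A q. v c $ 2 = 0 \<and> v c $ 3 = 0})"
    using c' fc'(3) by blast
qed

lemma lines_in_plane:
  assumes q: "q \<in> domain"
  shows "line X q \<subseteq> plane q" "line Y q \<subseteq> plane q" "line X q \<noteq> line Y q"
proof -
  note qc = domainD[OF q]
  show "line X q \<subseteq> plane q" "line Y q \<subseteq> plane q"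
    unfolding line_def plane_def using aX[OF qc(2)] aY[OF qc(2)] by (auto simp: cdot_smult_right)
  show "line X q \<noteq> line Y q"
  proof
    assume eq: "line X q = line Y q"
    have "1 *s X (snd c q) \<in> range (\<lambda>s. s *s X (snd c q))" by blast
    then have "tangent_lift A c q (X (snd c q)) \<in> line X q"
      unfolding line_def using tangent_lift[OF M c qc(1)] by simp
    then have "tangent_lift A c q (X (snd c q)) \<in> line Y q" using eq by simp
    then obtain s where "X (snd c q) = s *s Y (snd c q)"
      unfolding line_def using tangent_lift_component[OF M c qc(1)] by auto
    then show False using XY[OF qc(2)] by (simp add: vec_eq_3_iff)
  qed
qed

end

section \<open>Gluing the local extensions\<close>

text \<open>This defines the extension of \<open>F\<close> over \<open>S\<close> without choosing local extensions.\<close>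

definition annihilator_hull ::
    "'a topology \<Rightarrow> ('a, 'n::finite) chart set \<Rightarrow> 'a set \<Rightarrow>
     ('a \<Rightarrow> ('a, 'n) tangent_vector set) \<Rightarrow> 'a \<Rightarrow> ('a, 'n) tangent_vector set" where
  "annihilator_hull M A S F q = {v\<in>tangent_space A q. \<forall>U \<beta>. openin M U \<and> q \<in> U \<and>
     holomorphic_one_form A U \<beta> \<and> (\<forall>r\<in>U - S. \<forall>u\<in>F r. \<beta> r u = 0) \<longrightarrow> \<beta> q v = 0}"

context chart_frame
begin

text \<open>The forms \<open>b i\<close> are themselves admissible in the hull, which gives one
  inclusion. Conversely, a vector of \<open>K q\<close> extends to a holomorphic section of
  \<open>K\<close>; an admissible form vanishes on this section off \<open>S\<close>, hence also at
  \<open>q\<close>. The index \<open>i\<close> allows both planes, cut out by one form, and lines,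
  cut out by three.\<close>

lemma annihilator_hull_eq:
  assumes R: "removable_in (snd c ` (S \<inter> fst c)) (snd c ` fst c)"
    and b: "\<And>i. cholomorphic_map_on (b i) V"
    and K: "\<And>q. q \<in> domain \<Longrightarrow> K q = {v\<in>tangent_space A q. \<forall>i. cdot (b i (snd c q)) (v c) = 0}"
    and sect: "\<And>q v. q \<in> domain \<Longrightarrow> v \<in> K q \<Longrightarrow>
      \<exists>x. cholomorphic_map_on x V \<and> x (snd c q) = v c \<and> (\<forall>z\<in>V. \<forall>i. cdot (b i z) (x z) = 0)"
    and eq: "\<And>q. q \<in> domain - S \<Longrightarrow> F q = K q"
    and q: "q \<in> domain"
  shows "annihilator_hull M A S F q = K q"
proof (intro equalityI subsetI)
  fix v assume v: "v \<in> annihilator_hull M A S F q"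
  have "cdot (b i (snd c q)) (v c) = 0" for i
  proof -
    have "\<forall>r\<in>domain - S. \<forall>u\<in>F r. cdot (b i (snd c r)) (u c) = 0"
      using eq K by auto
    then show ?thesis
      using v coordinate_one_form[OF b] domain_open q unfolding annihilator_hull_def by blast
  qed
  then show "v \<in> K q" using v K[OF q] unfolding annihilator_hull_def by simp
next
  fix v assume v: "v \<in> K q"
  then have vT: "v \<in> tangent_space A q" using K[OF q] by simp
  obtain x where x: "cholomorphic_map_on x V" "x (snd c q) = v c"
    "\<And>z i. z \<in> V \<Longrightarrow> cdot (b i z) (x z) = 0"
    using sect[OF q v] by blast
  have "\<beta> q v = 0" if U: "openin M U" "q \<in> U" and \<beta>: "holomorphic_one_form A U \<beta>"
    and kill: "\<forall>r\<in>U - S. \<forall>u\<in>F r. \<beta> r u = 0" for U \<beta>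
  proof -
    obtain e where e: "form_in_chart A U \<beta> c e"
      using \<beta> c unfolding holomorphic_one_form_def by blast
    have \<beta>e: "\<beta> r u = cdot (e (snd c r)) (u c)" if "r \<in> U" "r \<in> fst c" "u \<in> tangent_space A r" for r u
      using e that unfolding form_in_chart_def coord_form_eq_cdot by blast
    let ?W = "snd c ` ((domain \<inter> U) \<inter> fst c)" and ?T = "snd c ` (S \<inter> fst c)"
    have oW: "open ?W" by (rule chart_image_open[OF chart_c openin_Int[OF domain_open U(1)]])
    have RW: "removable_in ?T ?W" by (rule removable_in_subset[OF R oW]) auto
    have "cholomorphic_map_on e (snd c ` (U \<inter> fst c))" using e unfolding form_in_chart_def by (rule conjunct1)
    then have "cholomorphic_map_on e ?W" by (rule cholomorphic_map_on_subset) blast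
    moreover have "cholomorphic_map_on x ?W"
      by (rule cholomorphic_map_on_subset[OF x(1)]) (auto simp: domain_def)
    ultimately have hex: "cholomorphic_on (\<lambda>z. cdot (e z) (x z)) ?W" by (rule cholomorphic_on_cdot)
    have "cdot (e (snd c q)) (x (snd c q)) = 0"
    proof (rule removable_in_identity[OF RW hex cholomorphic_on_const[of 0]])
      show "snd c q \<in> ?W" using q U(2) domainD by blast
      fix z assume z: "z \<in> ?W - ?T"
      then obtain r where r: "r \<in> domain" "r \<in> U" "r \<in> fst c" "z = snd c r" "r \<notin> S" by blast
      let ?u = "tangent_lift A c r (x (snd c r))"
      note tl = tangent_lift[OF M c r(3), of "x (snd c r)"]
      have "?u \<in> K r" unfolding K[OF r(1)] using tl x(3)[OF domainD(2)[OF r(1)]] by simp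
      then have "\<beta> r ?u = 0" using kill eq[of r] r by simp
      then show "cdot (e z) (x z) = 0" using \<beta>e[OF r(2,3) tl(1)] tl(2) r(4) by simp
    qed
    then show ?thesis using \<beta>e[OF U(2) domainD(1)[OF q] vT] x(2) by simp
  qed
  then show "v \<in> annihilator_hull M A S F q"
    unfolding annihilator_hull_def using vT by blast
qed

lemma annihilator_hull_plane:
  assumes R: "removable_in (snd c ` (S \<inter> fst c)) (snd c ` fst c)"
    and eq: "\<And>q. q \<in> domain - S \<Longrightarrow> F q = plane q" and q: "q \<in> domain"
  shows "annihilator_hull M A S F q = plane q"
proof (rule annihilator_hull_eq[OF R, where b = "\<lambda>_::unit. a"])
  show "plane q = {v\<in>tangent_space A q. \<forall>i::unit. cdot (a (snd c q)) (v c) = 0}" for q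
    by (simp add: plane_def)
  fix q v assume q: "q \<in> domain" and "v \<in> plane q"
  then have "cdot (a (snd c q)) (v c) = 0" by (simp add: plane_def)
  \<comment> \<open>The section through \<open>v\<close> keeps these coefficients constant.\<close>
  then obtain s t where "v c = s *s X (snd c q) + t *s Y (snd c q)"
    using plane_combination[OF domainD(2)[OF q]] by blast
  moreover have "cdot (a z) (s *s X z + t *s Y z) = 0" if "z \<in> V" for z
  proof -
    have "cdot (a z) (s *s X z + t *s Y z) = s * cdot (a z) (X z) + t * cdot (a z) (Y z)"
      by (simp add: cdot_3 algebra_simps)
    then show ?thesis using aX[OF that] aY[OF that] by simp
  qed
  moreover have "cholomorphic_map_on (\<lambda>z. s *s X z + t *s Y z) V"
    by (rule cholomorphic_map_onI)
      (simp add: cholomorphic_on_add cholomorphic_on_mult cholomorphic_on_const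
        cholomorphic_on_component[OF hol_X] cholomorphic_on_component[OF hol_Y])
  ultimately show "\<exists>x. cholomorphic_map_on x V \<and> x (snd c q) = v c \<and> (\<forall>z\<in>V. \<forall>i::unit. cdot (a z) (x z) = 0)"
    by (intro exI[of _ "\<lambda>z. s *s X z + t *s Y z"]) simp
qed (use hol_a eq q in auto)

text \<open>The three forms are the components of the cross product with \<open>x\<close>, which
  vanish together exactly on the multiples of \<open>x\<close>. The sections are constant multiples
  of \<open>x\<close>.\<close>

lemma annihilator_hull_line:
  assumes R: "removable_in (snd c ` (S \<inter> fst c)) (snd c ` fst c)"
    and x: "cholomorphic_map_on x V" and nz: "\<And>z. z \<in> V \<Longrightarrow> x z \<noteq> 0"
    and eq: "\<And>q. q \<in> domain - S \<Longrightarrow> F q = line x q" and q: "q \<in> domain"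
  shows "annihilator_hull M A S F q = line x q"
proof (rule annihilator_hull_eq[OF R, where b = "\<lambda>i z. ccross (axis i 1) (x z)"])
  have triple: "cdot (ccross (axis i 1) y) v = ccross y v $ i" for i y v
    using exhaust_3[of i] by (auto simp: cdot_3 axis_def)
  have zero: "(\<forall>i. ccross y v $ i = 0) \<longleftrightarrow> v \<in> range (\<lambda>s. s *s y)" if "y \<noteq> 0" for y v
  proof
    assume "\<forall>i. ccross y v $ i = 0"
    then have "ccross y v = 0" by (simp add: vec_eq_iff)
    then show "v \<in> range (\<lambda>s. s *s y)" using ccross_eq_0_imp_smult[OF _ that] by blast
  next
    assume "v \<in> range (\<lambda>s. s *s y)"
    then have "ccross y v = 0" by (auto simp: vec_eq_3_iff)
    then show "\<forall>i. ccross y v $ i = 0" by simp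
  qed
  show "line x q = {v\<in>tangent_space A q. \<forall>i. cdot (ccross (axis i 1) (x (snd c q))) (v c) = 0}"
    if "q \<in> domain" for q
    unfolding triple line_def zero[OF nz[OF domainD(2)[OF that]]] by simp
  fix i :: 3
  have "cholomorphic_on (\<lambda>z. ccross (axis i 1) (x z) $ j) V" for j
  proof -
    note h = cholomorphic_on_component[OF x]
    have "j = 1 \<or> j = 2 \<or> j = 3" by (rule exhaust_3)
    then show ?thesis
      by (elim disjE) (simp_all only: ccross_nth,
          (intro cholomorphic_on_diff cholomorphic_on_mult cholomorphic_on_const h)+)
  qed
  then show "cholomorphic_map_on (\<lambda>z. ccross (axis i 1) (x z)) V" by (rule cholomorphic_map_onI)
next
  fix q v assume q: "q \<in> domain" and "v \<in> line x q"
  then obtain s where s: "v c = s *s x (snd c q)" by (auto simp: line_def)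
  have "cholomorphic_map_on (\<lambda>z. s *s x z) V"
    by (rule cholomorphic_map_onI)
      (simp add: cholomorphic_on_mult cholomorphic_on_const cholomorphic_on_component[OF x])
  moreover have "cdot (ccross (axis i 1) y) (s *s y) = 0" for i y
    by (simp add: cdot_3 algebra_simps)
  ultimately show "\<exists>y. cholomorphic_map_on y V \<and> y (snd c q) = v c \<and>
      (\<forall>z\<in>V. \<forall>i. cdot (ccross (axis i 1) (x z)) (y z) = 0)"
    using s by (intro exI[of _ "\<lambda>z. s *s x z"]) simp
qed (use eq q in auto)

lemma domain_path_geometry:
  assumes "\<And>d. d \<in> A \<Longrightarrow> removable_in (snd d ` (S \<inter> fst d)) (snd d ` fst d)"
    and "domain - S \<subseteq> N" "contact_structure M A N E"
    and "\<And>q. q \<in> domain - S \<Longrightarrow> E q = plane q"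
  shows "path_geometry M A domain plane (line X) (line Y)"
  unfolding path_geometry_def
  using plane_contact_structure[OF assms] line_foliation[OF hol_X nonzero(2)]
    line_foliation[OF hol_Y nonzero(3)] lines_in_plane by blast

end

section \<open>Path geometries may be checked locally\<close>

lemma contact_structure_local:
  assumes "\<And>p. p \<in> N \<Longrightarrow> \<exists>U G. p \<in> U \<and> U \<subseteq> N \<and> contact_structure M A U G \<and> (\<forall>q\<in>U. E q = G q)"
  shows "contact_structure M A N E"
  unfolding contact_structure_def holomorphic_subbundle_def
proof (intro conjI ballI)
  fix p assume "p \<in> N"
  from assms[OF this] obtain W G where W: "p \<in> W" "W \<subseteq> N" "contact_structure M A W G" "\<forall>q\<in>W. E q = G q"
    by (elim exE conjE)
  note G = W(3)[unfolded contact_structure_def holomorphic_subbundle_def]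
  obtain U X where U: "openin M U \<and> p \<in> U \<and> U \<subseteq> W \<and> (\<forall>i<2. holomorphic_vector_field A U (X i)) \<and>
      (\<forall>q\<in>U. G q = tangent.span ((\<lambda>i. X i q) ` {..<(2::nat)}) \<and> tangent.dim (G q) = 2)"
    using bspec[OF conjunct1[OF G] W(1)] by (elim exE) (rule that)
  have "\<forall>q\<in>U. E q = tangent.span ((\<lambda>i. X i q) ` {..<(2::nat)}) \<and> tangent.dim (E q) = 2"
  proof
    fix q assume q: "q \<in> U"
    then have "E q = G q" using U W(4) by blast
    moreover have "G q = tangent.span ((\<lambda>i. X i q) ` {..<(2::nat)}) \<and> tangent.dim (G q) = 2"
      using U q by blast
    ultimately show "E q = tangent.span ((\<lambda>i. X i q) ` {..<(2::nat)}) \<and> tangent.dim (E q) = 2"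
      by (rule ssubst)
  qed
  moreover have "U \<subseteq> N" using U W(2) by blast
  ultimately show "\<exists>U X. openin M U \<and> p \<in> U \<and> U \<subseteq> N \<and> (\<forall>i<2. holomorphic_vector_field A U (X i)) \<and>
      (\<forall>q\<in>U. E q = tangent.span ((\<lambda>i. X i q) ` {..<(2::nat)}) \<and> tangent.dim (E q) = 2)"
    using U by (intro exI[of _ U] exI[of _ X]) (elim conjE, intro conjI; assumption)
  obtain U \<alpha> where U: "openin M U \<and> p \<in> U \<and> U \<subseteq> W \<and> contact_form A U \<alpha> \<and>
      (\<forall>q\<in>U. G q = {v \<in> tangent_space A q. \<alpha> q v = 0})"
    using bspec[OF conjunct2[OF G] W(1)] by (elim exE) (rule that)
  have "E q = G q" if "q \<in> U" for q using U W(4) that by blast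
  then have "\<forall>q\<in>U. E q = {v \<in> tangent_space A q. \<alpha> q v = 0}" using U by simp
  moreover have "U \<subseteq> N" using U W(2) by blast
  ultimately show "\<exists>U \<alpha>. openin M U \<and> p \<in> U \<and> U \<subseteq> N \<and> contact_form A U \<alpha> \<and>
      (\<forall>q\<in>U. E q = {v \<in> tangent_space A q. \<alpha> q v = 0})"
    using U by (intro exI[of _ U] exI[of _ \<alpha>]) (elim conjE, intro conjI; assumption)
qed

lemma holomorphic_foliation_by_curves_local:
  assumes "\<And>p. p \<in> N \<Longrightarrow> \<exists>U H. p \<in> U \<and> U \<subseteq> N \<and> holomorphic_foliation_by_curves A U H \<and> (\<forall>q\<in>U. F q = H q)"
  shows "holomorphic_foliation_by_curves A N F"
  unfolding holomorphic_foliation_by_curves_def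
proof
  fix p assume "p \<in> N"
  from assms[OF this] obtain U H where U: "p \<in> U" "U \<subseteq> N" "holomorphic_foliation_by_curves A U H" "\<forall>q\<in>U. F q = H q"
    by (elim exE conjE)
  obtain d where d: "d \<in> A" "p \<in> fst d" "fst d \<subseteq> U"
    "\<forall>q\<in>fst d. H q = {v \<in> tangent_space A q. v d $ 2 = 0 \<and> v d $ 3 = 0}"
    using bspec[OF U(3)[unfolded holomorphic_foliation_by_curves_def] U(1)] by blast
  have "F q = H q" if "q \<in> fst d" for q using U(4) d(3) that by blast
  then have "\<forall>q\<in>fst d. F q = {v \<in> tangent_space A q. v d $ 2 = 0 \<and> v d $ 3 = 0}" using d(4) by simp
  then show "\<exists>d\<in>A. p \<in> fst d \<and> fst d \<subseteq> N \<and>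
      (\<forall>q\<in>fst d. F q = {v \<in> tangent_space A q. v d $ 2 = 0 \<and> v d $ 3 = 0})"
    using d U(2) by (intro bexI[of _ d] conjI) auto
qed

lemma path_geometry_local:
  assumes loc: "\<And>p. p \<in> N \<Longrightarrow> \<exists>U G H\<^sub>1 H\<^sub>2. p \<in> U \<and> U \<subseteq> N \<and> path_geometry M A U G H\<^sub>1 H\<^sub>2 \<and>
    (\<forall>q\<in>U. E q = G q \<and> F\<^sub>1 q = H\<^sub>1 q \<and> F\<^sub>2 q = H\<^sub>2 q)"
  shows "path_geometry M A N E F\<^sub>1 F\<^sub>2"
proof -
  have *: "(\<exists>U G. p \<in> U \<and> U \<subseteq> N \<and> contact_structure M A U G \<and> (\<forall>q\<in>U. E q = G q)) \<and>
    (\<exists>U H. p \<in> U \<and> U \<subseteq> N \<and> holomorphic_foliation_by_curves A U H \<and> (\<forall>q\<in>U. F\<^sub>1 q = H q)) \<and>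
    (\<exists>U H. p \<in> U \<and> U \<subseteq> N \<and> holomorphic_foliation_by_curves A U H \<and> (\<forall>q\<in>U. F\<^sub>2 q = H q)) \<and>
    F\<^sub>1 p \<subseteq> E p \<and> F\<^sub>2 p \<subseteq> E p \<and> F\<^sub>1 p \<noteq> F\<^sub>2 p" if p: "p \<in> N" for p
  proof -
    from loc[OF p] obtain U G H\<^sub>1 H\<^sub>2 where U: "p \<in> U" "U \<subseteq> N" "path_geometry M A U G H\<^sub>1 H\<^sub>2"
      and eq: "\<forall>q\<in>U. E q = G q \<and> F\<^sub>1 q = H\<^sub>1 q \<and> F\<^sub>2 q = H\<^sub>2 q" by (elim exE conjE)
    have h: "contact_structure M A U G" "holomorphic_foliation_by_curves A U H\<^sub>1"
      "holomorphic_foliation_by_curves A U H\<^sub>2" "\<forall>q\<in>U. H\<^sub>1 q \<subseteq> G q \<and> H\<^sub>2 q \<subseteq> G q \<and> H\<^sub>1 q \<noteq> H\<^sub>2 q"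
      using U(3) unfolding path_geometry_def by simp_all
    have e: "\<forall>q\<in>U. E q = G q" "\<forall>q\<in>U. F\<^sub>1 q = H\<^sub>1 q" "\<forall>q\<in>U. F\<^sub>2 q = H\<^sub>2 q" using eq by simp_all
    have "\<exists>U G. p \<in> U \<and> U \<subseteq> N \<and> contact_structure M A U G \<and> (\<forall>q\<in>U. E q = G q)"
      using U(1,2) h(1) e(1) by (intro exI conjI)
    moreover have "\<exists>U H. p \<in> U \<and> U \<subseteq> N \<and> holomorphic_foliation_by_curves A U H \<and> (\<forall>q\<in>U. F\<^sub>1 q = H q)"
      using U(1,2) h(2) e(2) by (intro exI conjI)
    moreover have "\<exists>U H. p \<in> U \<and> U \<subseteq> N \<and> holomorphic_foliation_by_curves A U H \<and> (\<forall>q\<in>U. F\<^sub>2 q = H q)"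
      using U(1,2) h(3) e(3) by (intro exI conjI)
    moreover have "F\<^sub>1 p \<subseteq> E p" "F\<^sub>2 p \<subseteq> E p" "F\<^sub>1 p \<noteq> F\<^sub>2 p"
      using bspec[OF h(4) U(1)] bspec[OF eq U(1)] by simp_all
    ultimately show ?thesis by (intro conjI)
  qed
  show ?thesis
    unfolding path_geometry_def
  proof (intro conjI)
    show "contact_structure M A N E" by (rule contact_structure_local[OF conjunct1[OF *]])
    show "holomorphic_foliation_by_curves A N F\<^sub>1"
      by (rule holomorphic_foliation_by_curves_local[OF conjunct1[OF conjunct2[OF *]]])
    show "holomorphic_foliation_by_curves A N F\<^sub>2"
      by (rule holomorphic_foliation_by_curves_local[OF conjunct1[OF conjunct2[OF conjunct2[OF *]]]])
    show "\<forall>q\<in>N. F\<^sub>1 q \<subseteq> E q \<and> F\<^sub>2 q \<subseteq> E q \<and> F\<^sub>1 q \<noteq> F\<^sub>2 q"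
      by (rule ballI[OF conjunct2[OF conjunct2[OF conjunct2[OF *]]]])
  qed
qed

text \<open>The contact form has to come first: the tensor of the line pair is normalized by its
  exterior derivative, so the lines are extended over the domain \<open>V0\<close> of the extended
  form.\<close>

lemma local_path_geometry_extension:
  fixes A :: "('a, 3) chart set"
  assumes M: "complex_manifold M A" and c: "c \<in> A" "p \<in> fst c"
    and R: "removable_in (snd c ` (S \<inter> fst c)) (snd c ` fst c)"
    and P: "path_geometry M A (topspace M - S) E F\<^sub>1 F\<^sub>2"
  obtains V a X Y where "chart_frame M A c V a X Y" "p \<in> chart_frame.domain c V"
    "\<forall>q\<in>chart_frame.domain c V - S. E q = chart_frame.plane A c a q \<and>
      F\<^sub>1 q = chart_frame.line A c X q \<and> F\<^sub>2 q = chart_frame.line A c Y q"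
proof -
  note cc = complex_manifold_chart[OF M c(1)]
  let ?N = "topspace M - S" and ?T = "snd c ` (S \<inter> fst c)" and ?\<Omega> = "snd c ` fst c"
  have E: "contact_structure M A ?N E" and F1: "holomorphic_foliation_by_curves A ?N F\<^sub>1"
    and F2: "holomorphic_foliation_by_curves A ?N F\<^sub>2"
    and inc: "\<And>q. q \<in> ?N \<Longrightarrow> F\<^sub>1 q \<subseteq> E q \<and> F\<^sub>2 q \<subseteq> E q \<and> F\<^sub>1 q \<noteq> F\<^sub>2 q"
    using P unfolding path_geometry_def by auto
  note sub = contact_structure_subset_tangent_space[OF E] foliation_subset_tangent_space[OF F1]
    foliation_subset_tangent_space[OF F2]
  have diff: "?\<Omega> - ?T = snd c ` (?N \<inter> fst c)"
    using chart_inj[OF cc] openin_subset[OF chart_openin[OF cc]] by (auto simp: inj_on_def)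
  have p: "snd c p \<in> ?\<Omega>" and pc: "p \<in> fst c" using c by blast+
  have loc_contact: "\<exists>V a. z \<in> V \<and> V \<subseteq> ?\<Omega> - ?T \<and> contact_frame (chart_field c E) V a"
    if "z \<in> ?\<Omega> - ?T" for z
    using contact_structure_in_chart[OF M E c(1)] that unfolding diff by blast
  obtain V0 a where V0: "snd c p \<in> V0" "open V0" "V0 \<subseteq> ?\<Omega>" "cholomorphic_map_on a V0"
    and V0': "\<forall>z\<in>V0. contact_density a z \<noteq> 0" "\<forall>z\<in>V0 - ?T. chart_field c E z = {v. cdot (a z) v = 0}"
    by (rule contact_extension[OF R p loc_contact])
  have R0: "removable_in ?T V0" by (rule removable_in_subset[OF R V0(2,3)])
  have loc_lines: "\<exists>V X Y. z \<in> V \<and> open V \<and> V \<subseteq> V0 - ?T \<and> cholomorphic_map_on X V \<and> cholomorphic_map_on Y V \<and>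
      (\<forall>w\<in>V. cdot (a w) (X w) = 0 \<and> cdot (a w) (Y w) = 0 \<and> ccross (X w) (Y w) \<noteq> 0 \<and>
        chart_field c F\<^sub>1 w = range (\<lambda>s. s *s X w) \<and> chart_field c F\<^sub>2 w = range (\<lambda>s. s *s Y w))"
    if z: "z \<in> V0 - ?T" for z
  proof -
    have zN: "z \<in> snd c ` (?N \<inter> fst c)" unfolding diff[symmetric] using V0(3) z by blast
    obtain V1 X where "z \<in> V1 \<and> open V1 \<and> V1 \<subseteq> snd c ` (?N \<inter> fst c) \<and> cholomorphic_map_on X V1 \<and>
      (\<forall>w\<in>V1. X w \<noteq> 0 \<and> chart_field c F\<^sub>1 w = range (\<lambda>s. s *s X w))"
      using foliation_in_chart[OF M F1 c(1) zN] by (elim exE) (rule that)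
    then have V1: "z \<in> V1" "open V1" "V1 \<subseteq> snd c ` (?N \<inter> fst c)" "cholomorphic_map_on X V1"
      "\<forall>w\<in>V1. X w \<noteq> 0 \<and> chart_field c F\<^sub>1 w = range (\<lambda>s. s *s X w)" by simp_all
    obtain V2 Y where "z \<in> V2 \<and> open V2 \<and> V2 \<subseteq> snd c ` (?N \<inter> fst c) \<and> cholomorphic_map_on Y V2 \<and>
      (\<forall>w\<in>V2. Y w \<noteq> 0 \<and> chart_field c F\<^sub>2 w = range (\<lambda>s. s *s Y w))"
      using foliation_in_chart[OF M F2 c(1) zN] by (elim exE) (rule that)
    then have V2: "z \<in> V2" "open V2" "V2 \<subseteq> snd c ` (?N \<inter> fst c)" "cholomorphic_map_on Y V2"
      "\<forall>w\<in>V2. Y w \<noteq> 0 \<and> chart_field c F\<^sub>2 w = range (\<lambda>s. s *s Y w)" by simp_all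
    let ?V = "V1 \<inter> V2 \<inter> V0"
    have VN: "?V \<subseteq> V0 - ?T" using V1(3) unfolding diff[symmetric] by blast
    have "cdot (a w) (X w) = 0 \<and> cdot (a w) (Y w) = 0 \<and> ccross (X w) (Y w) \<noteq> 0 \<and>
        chart_field c F\<^sub>1 w = range (\<lambda>s. s *s X w) \<and> chart_field c F\<^sub>2 w = range (\<lambda>s. s *s Y w)"
      if w: "w \<in> ?V" for w
    proof -
      obtain q where q: "q \<in> ?N" "q \<in> fst c" "w = snd c q" using w V1(3) by blast
      have qw: "chart_inv c w = q" unfolding q(3) by (rule chart_inv_left[OF cc q(2)])
      have 1: "chart_field c F\<^sub>1 w = range (\<lambda>s. s *s X w)" "X w \<noteq> 0"
        and 2: "chart_field c F\<^sub>2 w = range (\<lambda>s. s *s Y w)" "Y w \<noteq> 0"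
        using V1(5) V2(5) w by auto
      have "chart_field c F\<^sub>1 w \<subseteq> chart_field c E w" "chart_field c F\<^sub>2 w \<subseteq> chart_field c E w"
        unfolding chart_field_def qw using inc[OF q(1)] by blast+
      moreover have "chart_field c E w = {v. cdot (a w) v = 0}" using V0'(2) VN w by blast
      moreover have "X w \<in> range (\<lambda>s. s *s X w)" "Y w \<in> range (\<lambda>s. s *s Y w)"
        by (rule range_eqI[of _ _ 1]; simp)+
      ultimately have aXY: "cdot (a w) (X w) = 0" "cdot (a w) (Y w) = 0"
        unfolding 1(1) 2(1) by blast+
      \<comment> \<open>Parallel \<open>X w\<close> and \<open>Y w\<close> would give equal lines in
        the chart, hence equal lines at \<open>q\<close>, since \<open>F\<^sub>1\<close> and
        \<open>F\<^sub>2\<close> are recovered from their chart fields.\<close>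
      have "ccross (X w) (Y w) \<noteq> 0"
      proof
        assume "ccross (X w) (Y w) = 0"
        then obtain l where l: "Y w = l *s X w" using ccross_eq_0_imp_smult 1(2) by blast
        then have "l \<noteq> 0" using 2(2) by auto
        then have "chart_field c F\<^sub>1 w = chart_field c F\<^sub>2 w"
          unfolding 1(1) 2(1) l by (rule range_smult_smult[symmetric])
        then have "F\<^sub>1 q = F\<^sub>2 q"
          unfolding q(3)
          using chart_field_mem[of M A c q F\<^sub>1, OF M c(1) q(2) sub(2)[OF q(1)]]
            chart_field_mem[of M A c q F\<^sub>2, OF M c(1) q(2) sub(3)[OF q(1)]] by blast
        then show False using inc[OF q(1)] by blast
      qed
      then show ?thesis using aXY 1(1) 2(1) by blast
    qed
    then have *: "\<forall>w\<in>?V. cdot (a w) (X w) = 0 \<and> cdot (a w) (Y w) = 0 \<and> ccross (X w) (Y w) \<noteq> 0 \<and>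
        chart_field c F\<^sub>1 w = range (\<lambda>s. s *s X w) \<and> chart_field c F\<^sub>2 w = range (\<lambda>s. s *s Y w)"
      by (rule ballI)
    have h: "cholomorphic_map_on X ?V" "cholomorphic_map_on Y ?V"
      by (rule cholomorphic_map_on_subset[OF V1(4)], blast, rule cholomorphic_map_on_subset[OF V2(4)], blast)
    have "z \<in> ?V" "open ?V" using z V1(1,2) V2(1,2) V0(2) by auto
    with h VN * show ?thesis by (intro exI conjI)
  qed
  obtain V X Y where V1: "snd c p \<in> V" "open V" "V \<subseteq> V0" "cholomorphic_map_on X V" "cholomorphic_map_on Y V"
    and V': "\<forall>z\<in>V. cdot (a z) (X z) = 0 \<and> cdot (a z) (Y z) = 0 \<and> ccross (X z) (Y z) \<noteq> 0"
    "\<forall>z\<in>V - ?T. chart_field c F\<^sub>1 z = range (\<lambda>s. s *s X z) \<and> chart_field c F\<^sub>2 z = range (\<lambda>s. s *s Y z)"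
    by (rule line_pair_extension[OF R0 V0(1,4) bspec[OF V0'(1)] loc_lines])
  interpret chart_frame M A c V a X Y
    by unfold_locales (use M c V1 V0 V0' V' cholomorphic_map_on_subset[OF V0(4)] in auto)
  have dom: "snd c q \<in> V - ?T \<and> q \<in> ?N \<and> q \<in> fst c" if "q \<in> domain - S" for q
  proof -
    have q: "q \<in> fst c" "snd c q \<in> V" "q \<notin> S" using that domainD by auto
    then have "q \<in> ?N" using openin_subset[OF chart_openin[OF cc]] by blast
    moreover have "snd c q \<notin> ?T" using q chart_inj[OF cc] by (auto simp: inj_on_def)
    ultimately show ?thesis using q by blast
  qed
  have "E q = plane q" "F\<^sub>1 q = line X q" "F\<^sub>2 q = line Y q" if "q \<in> domain - S" for q
  proof -
    note q = dom[OF that]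
    then have m: "q \<in> fst c" "q \<in> ?N" "snd c q \<in> V - ?T" "snd c q \<in> V0 - ?T" using V1(3) by blast+
    show "E q = plane q"
      using chart_field_mem[of M A c q E, OF M c(1) m(1) sub(1)[OF m(2)]]
      unfolding plane_def bspec[OF V0'(2) m(4)] by blast
    show "F\<^sub>1 q = line X q"
      using chart_field_mem[of M A c q F\<^sub>1, OF M c(1) m(1) sub(2)[OF m(2)]]
      unfolding line_def conjunct1[OF bspec[OF V'(2) m(3)]] by blast
    show "F\<^sub>2 q = line Y q"
      using chart_field_mem[of M A c q F\<^sub>2, OF M c(1) m(1) sub(3)[OF m(2)]]
      unfolding line_def conjunct2[OF bspec[OF V'(2) m(3)]] by blast
  qed
  moreover have "p \<in> domain" using pc V1(1) by (simp add: domain_def)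
  ultimately show ?thesis using that[OF chart_frame_axioms] by blast
qed

theorem mainTheorem11:
  fixes M :: "'a topology"
    and A :: "('a, 3) chart set"
    and S :: "'a set"
    and E F\<^sub>1 F\<^sub>2 :: "'a \<Rightarrow> ('a, 3) tangent_vector set"
  assumes "complex_manifold M A"
    and "closedin M S"
    and "complex_codim_ge M A S 2"
    and "path_geometry M A (topspace M - S) E F\<^sub>1 F\<^sub>2"
  shows "\<exists>E' F\<^sub>1' F\<^sub>2'. path_geometry M A (topspace M) E' F\<^sub>1' F\<^sub>2' \<and>
           (\<forall>p\<in>topspace M - S. E' p = E p \<and> F\<^sub>1' p = F\<^sub>1 p \<and> F\<^sub>2' p = F\<^sub>2 p)"
proof -
  note R = chart_removable_in[OF assms(1-3)]
  \<comment> \<open>The hull is defined globally from the data off \<open>S\<close>, and every local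
    extension is identified with it; this replaces a comparison of the local extensions on
    overlaps.\<close>
  let ?H = "annihilator_hull M A S"
  have contact: "contact_structure M A (topspace M - S) E"
    using assms(4) unfolding path_geometry_def by blast
  have loc: "(\<exists>U G H\<^sub>1 H\<^sub>2. p \<in> U \<and> U \<subseteq> topspace M \<and> path_geometry M A U G H\<^sub>1 H\<^sub>2 \<and>
        (\<forall>q\<in>U. ?H E q = G q \<and> ?H F\<^sub>1 q = H\<^sub>1 q \<and> ?H F\<^sub>2 q = H\<^sub>2 q)) \<and>
      (p \<notin> S \<longrightarrow> ?H E p = E p \<and> ?H F\<^sub>1 p = F\<^sub>1 p \<and> ?H F\<^sub>2 p = F\<^sub>2 p)"
    if p: "p \<in> topspace M" for p
  proof -
    have "\<exists>c\<in>A. p \<in> fst c" using assms(1) p unfolding complex_manifold_def by auto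
    then obtain c where c: "c \<in> A" "p \<in> fst c" by blast
    obtain V a X Y where fr: "chart_frame M A c V a X Y" and p': "p \<in> chart_frame.domain c V"
      and eq': "\<forall>q\<in>chart_frame.domain c V - S. E q = chart_frame.plane A c a q \<and>
        F\<^sub>1 q = chart_frame.line A c X q \<and> F\<^sub>2 q = chart_frame.line A c Y q"
      by (rule local_path_geometry_extension[OF assms(1) c R[OF c(1)] assms(4)])
    interpret chart_frame M A c V a X Y by (rule fr)
    have eq: "E q = plane q" "F\<^sub>1 q = line X q" "F\<^sub>2 q = line Y q" if "q \<in> domain - S" for q
      using eq' that by simp_all
    have sub: "domain \<subseteq> topspace M" by (rule openin_subset[OF domain_open])
    have H: "?H E q = plane q" "?H F\<^sub>1 q = line X q" "?H F\<^sub>2 q = line Y q" if "q \<in> domain" for q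
      using annihilator_hull_plane[OF R[OF c(1)] eq(1) that]
        annihilator_hull_line[OF R[OF c(1)] hol_X nonzero(2) eq(2) that]
        annihilator_hull_line[OF R[OF c(1)] hol_Y nonzero(3) eq(3) that] by blast+
    have "path_geometry M A domain plane (line X) (line Y)"
      by (rule domain_path_geometry[OF R _ contact eq(1)]) (use sub in auto)
    moreover have "\<forall>q\<in>domain. ?H E q = plane q \<and> ?H F\<^sub>1 q = line X q \<and> ?H F\<^sub>2 q = line Y q"
      using H by blast
    moreover have "p \<notin> S \<longrightarrow> ?H E p = E p \<and> ?H F\<^sub>1 p = F\<^sub>1 p \<and> ?H F\<^sub>2 p = F\<^sub>2 p"
      using H[OF p'] eq[of p] p' by simp
    ultimately show ?thesis using p' sub by meson
  qed
  have "path_geometry M A (topspace M) (?H E) (?H F\<^sub>1) (?H F\<^sub>2)"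
    by (rule path_geometry_local[OF conjunct1[OF loc]])
  moreover have "\<forall>p\<in>topspace M - S. ?H E p = E p \<and> ?H F\<^sub>1 p = F\<^sub>1 p \<and> ?H F\<^sub>2 p = F\<^sub>2 p"
    using loc by blast
  ultimately show ?thesis by blast
qed

end
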